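(* For any category of partitions $\mathcal{C}$ and any transcendental $t\in\mathbb{C}$, the category $\underline{\mathrm{Rep}}(\mathcal{C},t)$ is semisimple.
   Context: For $k,l\in\mathbb{N}_0$ let $P(k,l)$ be the set of set partitions of $\{1,\dots,k,1',\dots,l'\}$ ($k$ upper points, $l$ lower points). Operations: the tensor product $p\otimes q$ is horizontal concatenation; the involution $p^*\in P(l,k)$ swaps upper and lower points; for $p\in P(k,l)$, $q\in P(l,m)$, stack $p$ above $q$, identifying the lower points of $p$ with the upper points of $q$; $q\cdot p\in P(k,m)$ is the induced partition of the outer points by connected components, and $\ell(q,p)$ is the number of connected components containing only middle points. A category of partitions $\mathcal{C}$ is a collection of subsets $\mathcal{C}(k,l)\subseteq P(k,l)$ containing $\{\{1,2\}\}\in P(2,0)$ and $\{\{1,1'\}\}\in P(1,1)$ and closed under $\otimes$, $*$ and $\cdot$. For $t\in\mathbb{C}$, $\underline{\mathrm{Rep}}_0(\mathcal{C},t)$ is the $\mathbb{C}$-linear category with objects $[k]$, $k\in\mathbb{N}_0$, $\mathrm{Hom}([k],[l])=\mathbb{C}\,\mathcal{C}(k,l)$, and composition extending $qp:=t^{\ell(q,p)}\,q\cdot p$; $\underline{\mathrm{Rep}}(\mathcal{C},t)$ is its Karoubi envelope (idempotent completion of the additive completion). Semisimple means: abelian, and every object is a finite direct sum of simple objects. *)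

theory Defs
  imports
    Complex_Main
    "HOL-Library.Disjoint_Sets"
    "HOL-Library.Function_Algebras"
    "HOL-Library.Poly_Mapping"
    "HOL-Computational_Algebra.Polynomial"
begin

section \<open>Set partitions and their operations\<close>

datatype point = Upper nat | Lower nat

definition points :: "nat \<Rightarrow> nat \<Rightarrow> point set" where
  "points k l = Upper ` {1..k} \<union> Lower ` {1..l}"

type_synonym parti = "point set set"

definition partitions :: "nat \<Rightarrow> nat \<Rightarrow> parti set" where
  "partitions k l = {p. partition_on (points k l) p}"

fun shift :: "nat \<Rightarrow> nat \<Rightarrow> point \<Rightarrow> point" where
  "shift k l (Upper i) = Upper (k + i)"
| "shift k l (Lower j) = Lower (l + j)"

text \<open>The tensor product \<open>p \<otimes> q\<close> for \<open>p \<in> P(k,l)\<close>.\<close>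

definition tensor :: "nat \<Rightarrow> nat \<Rightarrow> parti \<Rightarrow> parti \<Rightarrow> parti" where
  "tensor k l p q = p \<union> (\<lambda>b. shift k l ` b) ` q"

fun flip :: "point \<Rightarrow> point" where
  "flip (Upper i) = Lower i"
| "flip (Lower j) = Upper j"

definition invol :: "parti \<Rightarrow> parti" where
  "invol p = (\<lambda>b. flip ` b) ` p"

text \<open>In the stack of \<open>p \<in> P(k,l)\<close> above \<open>q \<in> P(l,m)\<close>, the outer points are the upper points
  of \<open>p\<close> and the lower points of \<open>q\<close>; the lower point \<open>j\<close> of \<open>p\<close> and the upper point \<open>j\<close> of \<open>q\<close>
  are both sent to \<open>Middle j\<close>.\<close>

datatype stack_point = Outer point | Middle nat

fun stack_above :: "point \<Rightarrow> stack_point" where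
  "stack_above (Upper i) = Outer (Upper i)"
| "stack_above (Lower j) = Middle j"

fun stack_below :: "point \<Rightarrow> stack_point" where
  "stack_below (Upper j) = Middle j"
| "stack_below (Lower i) = Outer (Lower i)"

definition stack_blocks :: "parti \<Rightarrow> parti \<Rightarrow> stack_point set set" where
  "stack_blocks q p = (\<lambda>b. stack_above ` b) ` p \<union> (\<lambda>b. stack_below ` b) ` q"

definition stack_components :: "parti \<Rightarrow> parti \<Rightarrow> stack_point set set" where
  "stack_components q p = \<Union>(stack_blocks q p) // (\<Union>b\<in>stack_blocks q p. b \<times> b)\<^sup>+"

definition pcomp :: "parti \<Rightarrow> parti \<Rightarrow> parti" where
  "pcomp q p = {Outer -` c |c. c \<in> stack_components q p} - {{}}"

definition loops :: "parti \<Rightarrow> parti \<Rightarrow> nat" where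
  "loops q p = card {c \<in> stack_components q p. c \<subseteq> range Middle}"

definition id_parti :: "nat \<Rightarrow> parti" where
  "id_parti k = {{Upper i, Lower i} |i. i \<in> {1..k}}"

definition category_of_partitions :: "(nat \<Rightarrow> nat \<Rightarrow> parti set) \<Rightarrow> bool" where
  "category_of_partitions C \<longleftrightarrow>
     (\<forall>k l. C k l \<subseteq> partitions k l) \<and>
     {{Upper 1, Upper 2}} \<in> C 2 0 \<and>
     {{Upper 1, Lower 1}} \<in> C 1 1 \<and>
     (\<forall>k l k' l'. \<forall>p\<in>C k l. \<forall>q\<in>C k' l'. tensor k l p q \<in> C (k + k') (l + l')) \<and>
     (\<forall>k l. \<forall>p\<in>C k l. invol p \<in> C l k) \<and>
     (\<forall>k l m. \<forall>p\<in>C k l. \<forall>q\<in>C l m. pcomp q p \<in> C k m)"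


section \<open>Complex-linear categories\<close>

text \<open>Hom-sets are subspaces of one ambient complex vector space, whose addition is that of the
  type class and whose scalar multiplication is \<open>Scale\<close>. They need not be disjoint (they share
  the zero morphism), so composition takes the objects involved as arguments:
  \<open>Comp K X Y Z g f\<close> is \<open>g \<circ> f\<close> for \<open>f : X \<rightarrow> Y\<close> and \<open>g : Y \<rightarrow> Z\<close>.\<close>

record ('o, 'm) lincat =
  Obj :: "'o set"
  Hom :: "'o \<Rightarrow> 'o \<Rightarrow> 'm set"
  Comp :: "'o \<Rightarrow> 'o \<Rightarrow> 'o \<Rightarrow> 'm \<Rightarrow> 'm \<Rightarrow> 'm"
  Ident :: "'o \<Rightarrow> 'm"
  Scale :: "complex \<Rightarrow> 'm \<Rightarrow> 'm"

definition linear_category :: "('o, 'm::ab_group_add) lincat \<Rightarrow> bool" where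
  "linear_category K \<longleftrightarrow>
     vector_space (Scale K) \<and>
     (\<forall>X\<in>Obj K. \<forall>Y\<in>Obj K. module.subspace (Scale K) (Hom K X Y)) \<and>
     (\<forall>X\<in>Obj K. Ident K X \<in> Hom K X X) \<and>
     (\<forall>X\<in>Obj K. \<forall>Y\<in>Obj K. \<forall>f\<in>Hom K X Y.
        Comp K X Y Y (Ident K Y) f = f \<and> Comp K X X Y f (Ident K X) = f) \<and>
     (\<forall>X\<in>Obj K. \<forall>Y\<in>Obj K. \<forall>Z\<in>Obj K. \<forall>f\<in>Hom K X Y. \<forall>g\<in>Hom K Y Z.
        Comp K X Y Z g f \<in> Hom K X Z) \<and>
     (\<forall>W\<in>Obj K. \<forall>X\<in>Obj K. \<forall>Y\<in>Obj K. \<forall>Z\<in>Obj K.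
        \<forall>f\<in>Hom K W X. \<forall>g\<in>Hom K X Y. \<forall>h\<in>Hom K Y Z.
        Comp K W X Z (Comp K X Y Z h g) f = Comp K W Y Z h (Comp K W X Y g f)) \<and>
     (\<forall>X\<in>Obj K. \<forall>Y\<in>Obj K. \<forall>Z\<in>Obj K.
        \<forall>f\<in>Hom K X Y. \<forall>f'\<in>Hom K X Y. \<forall>g\<in>Hom K Y Z. \<forall>g'\<in>Hom K Y Z. \<forall>a.
        Comp K X Y Z g (f + f') = Comp K X Y Z g f + Comp K X Y Z g f' \<and>
        Comp K X Y Z (g + g') f = Comp K X Y Z g f + Comp K X Y Z g' f \<and>
        Comp K X Y Z g (Scale K a f) = Scale K a (Comp K X Y Z g f) \<and>
        Comp K X Y Z (Scale K a g) f = Scale K a (Comp K X Y Z g f))"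

definition is_zero_object :: "('o, 'm) lincat \<Rightarrow> 'o \<Rightarrow> bool" where
  "is_zero_object K Z \<longleftrightarrow>
     Z \<in> Obj K \<and> (\<forall>X\<in>Obj K. (\<exists>!f. f \<in> Hom K Z X) \<and> (\<exists>!f. f \<in> Hom K X Z))"

definition is_mono :: "('o, 'm) lincat \<Rightarrow> 'o \<Rightarrow> 'o \<Rightarrow> 'm \<Rightarrow> bool" where
  "is_mono K X Y f \<longleftrightarrow>
     f \<in> Hom K X Y \<and>
     (\<forall>W\<in>Obj K. \<forall>g\<in>Hom K W X. \<forall>h\<in>Hom K W X. Comp K W X Y f g = Comp K W X Y f h \<longrightarrow> g = h)"

definition is_epi :: "('o, 'm) lincat \<Rightarrow> 'o \<Rightarrow> 'o \<Rightarrow> 'm \<Rightarrow> bool" where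
  "is_epi K X Y f \<longleftrightarrow>
     f \<in> Hom K X Y \<and>
     (\<forall>Z\<in>Obj K. \<forall>g\<in>Hom K Y Z. \<forall>h\<in>Hom K Y Z. Comp K X Y Z g f = Comp K X Y Z h f \<longrightarrow> g = h)"

definition is_iso :: "('o, 'm) lincat \<Rightarrow> 'o \<Rightarrow> 'o \<Rightarrow> 'm \<Rightarrow> bool" where
  "is_iso K X Y f \<longleftrightarrow>
     f \<in> Hom K X Y \<and>
     (\<exists>g\<in>Hom K Y X. Comp K X Y X g f = Ident K X \<and> Comp K Y X Y f g = Ident K Y)"

definition is_kernel :: "('o, 'm::zero) lincat \<Rightarrow> 'o \<Rightarrow> 'o \<Rightarrow> 'm \<Rightarrow> 'o \<Rightarrow> 'm \<Rightarrow> bool" where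
  "is_kernel K X Y f A i \<longleftrightarrow>
     A \<in> Obj K \<and> i \<in> Hom K A X \<and> Comp K A X Y f i = 0 \<and>
     (\<forall>W\<in>Obj K. \<forall>g\<in>Hom K W X. Comp K W X Y f g = 0 \<longrightarrow>
        (\<exists>!h. h \<in> Hom K W A \<and> Comp K W A X i h = g))"

definition is_cokernel :: "('o, 'm::zero) lincat \<Rightarrow> 'o \<Rightarrow> 'o \<Rightarrow> 'm \<Rightarrow> 'o \<Rightarrow> 'm \<Rightarrow> bool" where
  "is_cokernel K X Y f B c \<longleftrightarrow>
     B \<in> Obj K \<and> c \<in> Hom K Y B \<and> Comp K X Y B c f = 0 \<and>
     (\<forall>Z\<in>Obj K. \<forall>g\<in>Hom K Y Z. Comp K X Y Z g f = 0 \<longrightarrow>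
        (\<exists>!h. h \<in> Hom K B Z \<and> Comp K Y B Z h c = g))"

text \<open>\<open>S\<close> is a direct sum (biproduct) of the objects in the list \<open>Xs\<close>; for \<open>Xs = []\<close> this says
  that the identity of \<open>S\<close> is zero.\<close>

definition is_direct_sum :: "('o, 'm::comm_monoid_add) lincat \<Rightarrow> 'o list \<Rightarrow> 'o \<Rightarrow> bool" where
  "is_direct_sum K Xs S \<longleftrightarrow>
     set Xs \<subseteq> Obj K \<and> S \<in> Obj K \<and>
     (\<exists>\<iota> \<pi>.
        (\<forall>i<length Xs. \<iota> i \<in> Hom K (Xs ! i) S \<and> \<pi> i \<in> Hom K S (Xs ! i)) \<and>
        (\<forall>i<length Xs. \<forall>j<length Xs.
           Comp K (Xs ! j) S (Xs ! i) (\<pi> i) (\<iota> j) = (if i = j then Ident K (Xs ! i) else 0)) \<and>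
        (\<Sum>i<length Xs. Comp K S (Xs ! i) S (\<iota> i) (\<pi> i)) = Ident K S)"

definition abelian_category :: "('o, 'm::ab_group_add) lincat \<Rightarrow> bool" where
  "abelian_category K \<longleftrightarrow>
     linear_category K \<and>
     (\<exists>Z. is_zero_object K Z) \<and>
     (\<forall>X\<in>Obj K. \<forall>Y\<in>Obj K. \<exists>S. is_direct_sum K [X, Y] S) \<and>
     (\<forall>X\<in>Obj K. \<forall>Y\<in>Obj K. \<forall>f\<in>Hom K X Y.
        (\<exists>A i. is_kernel K X Y f A i) \<and> (\<exists>B c. is_cokernel K X Y f B c)) \<and>
     (\<forall>X\<in>Obj K. \<forall>Y\<in>Obj K. \<forall>f. is_mono K X Y f \<longrightarrow>
        (\<exists>Z\<in>Obj K. \<exists>g\<in>Hom K Y Z. is_kernel K Y Z g X f)) \<and>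
     (\<forall>X\<in>Obj K. \<forall>Y\<in>Obj K. \<forall>f. is_epi K X Y f \<longrightarrow>
        (\<exists>W\<in>Obj K. \<exists>g\<in>Hom K W X. is_cokernel K W X g Y f))"

definition simple_object :: "('o, 'm) lincat \<Rightarrow> 'o \<Rightarrow> bool" where
  "simple_object K X \<longleftrightarrow>
     X \<in> Obj K \<and> \<not> is_zero_object K X \<and>
     (\<forall>A\<in>Obj K. \<forall>i. is_mono K A X i \<longrightarrow> is_zero_object K A \<or> is_iso K A X i)"

definition semisimple_category :: "('o, 'm::ab_group_add) lincat \<Rightarrow> bool" where
  "semisimple_category K \<longleftrightarrow>
     abelian_category K \<and>
     (\<forall>X\<in>Obj K. \<exists>Xs. (\<forall>Y\<in>set Xs. simple_object K Y) \<and> is_direct_sum K Xs X)"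


section \<open>Additive completion and idempotent completion\<close>

text \<open>Objects are formal finite direct sums, i.e. lists of objects. A morphism \<open>F\<close> is a matrix
  whose entry \<open>F i j\<close> is a morphism from the \<open>j\<close>-th summand of the source to the \<open>i\<close>-th summand of
  the target; entries out of range are zero.\<close>

definition additive_completion ::
  "('o, 'm::ab_group_add) lincat \<Rightarrow> ('o list, nat \<Rightarrow> nat \<Rightarrow> 'm) lincat" where
  "additive_completion K =
    \<lparr> Obj = lists (Obj K),
      Hom = (\<lambda>Xs Ys. {F. \<forall>i j.
        if i < length Ys \<and> j < length Xs then F i j \<in> Hom K (Xs ! j) (Ys ! i) else F i j = 0}),
      Comp = (\<lambda>Xs Ys Zs G F i j.
        if i < length Zs \<and> j < length Xs
        then \<Sum>k<length Ys. Comp K (Xs ! j) (Ys ! k) (Zs ! i) (G i k) (F k j) else 0),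
      Ident = (\<lambda>Xs i j. if i = j \<and> i < length Xs then Ident K (Xs ! i) else 0),
      Scale = (\<lambda>a F i j. Scale K a (F i j)) \<rparr>"

text \<open>Morphisms \<open>(X, e) \<rightarrow> (Y, e')\<close> are the morphisms \<open>f : X \<rightarrow> Y\<close> with \<open>e' f e = f\<close>, so \<open>e\<close> is the identity of
  \<open>(X, e)\<close>.\<close>

definition idempotent_completion ::
  "('o, 'm::ab_group_add) lincat \<Rightarrow> ('o \<times> 'm, 'm) lincat" where
  "idempotent_completion K =
    \<lparr> Obj = {(X, e). X \<in> Obj K \<and> e \<in> Hom K X X \<and> Comp K X X X e e = e},
      Hom = (\<lambda>(X, e) (Y, e'). {f \<in> Hom K X Y. Comp K X Y Y e' (Comp K X X Y f e) = f}),
      Comp = (\<lambda>(X, _) (Y, _) (Z, _). Comp K X Y Z),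
      Ident = (\<lambda>(X, e). e),
      Scale = Scale K \<rparr>"

definition karoubi_envelope ::
  "('o, 'm::ab_group_add) lincat \<Rightarrow> ('o list \<times> (nat \<Rightarrow> nat \<Rightarrow> 'm), nat \<Rightarrow> nat \<Rightarrow> 'm) lincat" where
  "karoubi_envelope K = idempotent_completion (additive_completion K)"


section \<open>Interpolating partition categories\<close>

text \<open>The object \<open>[k]\<close> is the number \<open>k\<close>, and \<open>Hom([k],[l])\<close> is the free complex vector space on
  \<open>C k l\<close>.\<close>

definition Rep0 ::
  "(nat \<Rightarrow> nat \<Rightarrow> parti set) \<Rightarrow> complex \<Rightarrow> (nat, parti \<Rightarrow>\<^sub>0 complex) lincat" where
  "Rep0 C t =
    \<lparr> Obj = UNIV,
      Hom = (\<lambda>k l. {f. Poly_Mapping.keys f \<subseteq> C k l}),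
      Comp = (\<lambda>k l m g f.
        \<Sum>q\<in>Poly_Mapping.keys g. \<Sum>p\<in>Poly_Mapping.keys f.
          Poly_Mapping.single (pcomp q p)
            (Poly_Mapping.lookup g q * Poly_Mapping.lookup f p * t ^ loops q p)),
      Ident = (\<lambda>k. Poly_Mapping.single (id_parti k) 1),
      Scale = (\<lambda>a. Poly_Mapping.map ((*) a)) \<rparr>"

definition Rep ::
  "(nat \<Rightarrow> nat \<Rightarrow> parti set) \<Rightarrow> complex \<Rightarrow>
   (nat list \<times> (nat \<Rightarrow> nat \<Rightarrow> parti \<Rightarrow>\<^sub>0 complex), nat \<Rightarrow> nat \<Rightarrow> parti \<Rightarrow>\<^sub>0 complex) lincat" where
  "Rep C t = karoubi_envelope (Rep0 C t)"

end

theory Submission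
  imports "Jordan_Normal_Form.Schur_Decomposition" "Jordan_Normal_Form.Char_Poly" Defs
begin

text \<open>Call a linear category semiprime if for every \<open>u \<noteq> 0\<close> there is \<open>h\<close> with \<open>u h u \<noteq> 0\<close>. With
  finite-dimensional Hom spaces, Brauer's lemma makes every right ideal of an endomorphism algebra
  generated by an idempotent, so every \<open>f\<close> has a \<open>g\<close> with \<open>f g f = f\<close>; once idempotents split, this gives
  kernels, cokernels and decompositions into simples. Semiprimeness passes to the additive and
  idempotent completions, hence only \<open>Hom([k],[l])\<close> has to be examined.

  If \<open>u h u = 0\<close> for all \<open>h\<close>, then \<open>x \<mapsto> u r\<^sup>* x\<close> is a square-zero endomorphism of \<open>Hom([k],[l])\<close> for every
  \<open>r\<close> and has trace \<open>0\<close>. This trace is a bilinear form in \<open>(u, r)\<close> whose determinant is a polynomial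
  in \<open>t\<close> with integer coefficients. At a large natural number \<open>t = n\<close> the category acts faithfully by
  real matrices closed under transposition, where the form is positive definite; hence the
  determinant is a nonzero polynomial and does not vanish at a transcendental \<open>t\<close>. The same matrices
  show that composition is associative.\<close>

section \<open>Semiprime linear categories\<close>

text \<open>The trace is that of an operator on the finite-dimensional space
  \<open>Hom([k],[l])\<close>, not the diagrammatic trace that closes up a partition. Its vanishing
  on square-zero operators is then plain linear algebra, valid at every complex \<open>t\<close>.
  The price is paid at \<open>t = n\<close>, where positivity has to be extracted by evaluating the
  trace in an orthonormal basis.

  The two halves of the argument live at different parameters: \<open>u h u = 0\<close> is known at
  the given \<open>t\<close>, where nothing is positive, and positivity is known at
  \<open>n\<close>, where nothing is known about \<open>u\<close>. What they share is the
  multiplication table. Composing two basis partitions gives one partition times a power of the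
  parameter, so the matrix of the form has entries in \<open>Z[t]\<close>. The zeros of its
  determinant vary with \<open>C\<close>, \<open>k\<close> and \<open>l\<close>, but all of them are
  algebraic.

  Semiprimeness is the right property to carry along because it concerns one morphism
  \<open>u\<close> at a time: a witness \<open>h\<close> can be placed in a single matrix entry or
  cut down by idempotents.\<close>

lemma (in vector_space) dim_strict_mono:
  assumes B: "finite B" "W \<subseteq> span B" and V: "subspace V" and VW: "V \<subset> W"
  shows "dim V < dim W"
proof -
  obtain S where S: "S \<subseteq> V" "independent S" "V \<subseteq> span S" "card S = dim V"
    by (rule basis_exists)
  obtain x where x: "x \<in> W" "x \<notin> V" using VW by blast
  have "x \<notin> span S" using S(1) V x(2) span_minimal by blast
  then have ind: "independent (insert x S)" using S(2) by (simp add: independent_insertI)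
  obtain S' where S': "S' \<subseteq> W" "independent S'" "W \<subseteq> span S'" "card S' = dim W"
    by (rule basis_exists)
  \<comment> \<open>Without the finite set \<open>B\<close> the basis \<open>S'\<close> could be
    infinite, and \<open>card S'\<close> would default to 0.\<close>
  have finS': "finite S'" using independent_span_bound[OF B(1) S'(2)] S'(1) B(2) by blast
  have sub: "insert x S \<subseteq> span S'" using x(1) S(1) VW S'(3) by blast
  have xS: "x \<notin> S" using S(1) x(2) by blast
  from independent_span_bound[OF finS' ind sub] have "finite S" "card (insert x S) \<le> card S'" by auto
  then show ?thesis using xS S(4) S'(4) by simp
qed

lemma sum_lessThan_add:
  "(\<Sum>k<m + n::nat. f k) = (\<Sum>k<m. f k) + (\<Sum>k<n. f (m + k) :: 'a::comm_monoid_add)"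
  by (induction n) (simp_all add: add.assoc)

locale lin_cat =
  fixes K :: "('o, 'm::ab_group_add) lincat"
  assumes linear: "linear_category K"
begin

sublocale vs: vector_space "Scale K"
  using linear by (simp add: linear_category_def)

lemma Hom_subspace: "X \<in> Obj K \<Longrightarrow> Y \<in> Obj K \<Longrightarrow> vs.subspace (Hom K X Y)"
  using linear by (simp add: linear_category_def)

lemma Ident_in [simp]: "X \<in> Obj K \<Longrightarrow> Ident K X \<in> Hom K X X"
  using linear by (simp add: linear_category_def)

lemma Comp_Ident [simp]:
  assumes "X \<in> Obj K" "Y \<in> Obj K" "f \<in> Hom K X Y"
  shows "Comp K X Y Y (Ident K Y) f = f" "Comp K X X Y f (Ident K X) = f"
  using linear assms by (simp_all add: linear_category_def)

lemma Comp_in [simp]: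
  "\<lbrakk>X \<in> Obj K; Y \<in> Obj K; Z \<in> Obj K; f \<in> Hom K X Y; g \<in> Hom K Y Z\<rbrakk>
    \<Longrightarrow> Comp K X Y Z g f \<in> Hom K X Z"
  using linear by (simp add: linear_category_def)

lemma Comp_assoc:
  "\<lbrakk>W \<in> Obj K; X \<in> Obj K; Y \<in> Obj K; Z \<in> Obj K; f \<in> Hom K W X; g \<in> Hom K X Y; h \<in> Hom K Y Z\<rbrakk>
    \<Longrightarrow> Comp K W X Z (Comp K X Y Z h g) f = Comp K W Y Z h (Comp K W X Y g f)"
  using linear by (simp add: linear_category_def)

lemma Comp_add_right:
  "\<lbrakk>X \<in> Obj K; Y \<in> Obj K; Z \<in> Obj K; f \<in> Hom K X Y; f' \<in> Hom K X Y; g \<in> Hom K Y Z\<rbrakk>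
    \<Longrightarrow> Comp K X Y Z g (f + f') = Comp K X Y Z g f + Comp K X Y Z g f'"
  using linear unfolding linear_category_def by blast

lemma Comp_add_left:
  "\<lbrakk>X \<in> Obj K; Y \<in> Obj K; Z \<in> Obj K; f \<in> Hom K X Y; g \<in> Hom K Y Z; g' \<in> Hom K Y Z\<rbrakk>
    \<Longrightarrow> Comp K X Y Z (g + g') f = Comp K X Y Z g f + Comp K X Y Z g' f"
  using linear unfolding linear_category_def by blast

lemma Comp_scale_right:
  "\<lbrakk>X \<in> Obj K; Y \<in> Obj K; Z \<in> Obj K; f \<in> Hom K X Y; g \<in> Hom K Y Z\<rbrakk>
    \<Longrightarrow> Comp K X Y Z g (Scale K a f) = Scale K a (Comp K X Y Z g f)"
  using linear unfolding linear_category_def by blast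

lemma Comp_scale_left:
  "\<lbrakk>X \<in> Obj K; Y \<in> Obj K; Z \<in> Obj K; f \<in> Hom K X Y; g \<in> Hom K Y Z\<rbrakk>
    \<Longrightarrow> Comp K X Y Z (Scale K a g) f = Scale K a (Comp K X Y Z g f)"
  using linear unfolding linear_category_def by blast

lemma Hom_0 [simp]: "X \<in> Obj K \<Longrightarrow> Y \<in> Obj K \<Longrightarrow> 0 \<in> Hom K X Y"
  using Hom_subspace vs.subspace_0 by blast

lemma Hom_add [simp]:
  "\<lbrakk>X \<in> Obj K; Y \<in> Obj K; f \<in> Hom K X Y; g \<in> Hom K X Y\<rbrakk> \<Longrightarrow> f + g \<in> Hom K X Y"
  using Hom_subspace vs.subspace_add by blast

lemma Hom_diff [simp]:
  "\<lbrakk>X \<in> Obj K; Y \<in> Obj K; f \<in> Hom K X Y; g \<in> Hom K X Y\<rbrakk> \<Longrightarrow> f - g \<in> Hom K X Y"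
  using Hom_subspace vs.subspace_diff by blast

lemma Hom_scale [simp]:
  "\<lbrakk>X \<in> Obj K; Y \<in> Obj K; f \<in> Hom K X Y\<rbrakk> \<Longrightarrow> Scale K a f \<in> Hom K X Y"
  using Hom_subspace vs.subspace_scale by blast

lemma Hom_sum:
  "\<lbrakk>X \<in> Obj K; Y \<in> Obj K; \<And>i. i \<in> I \<Longrightarrow> f i \<in> Hom K X Y\<rbrakk> \<Longrightarrow> (\<Sum>i\<in>I. f i) \<in> Hom K X Y"
  using Hom_subspace vs.subspace_sum by blast

lemma Comp_0_right [simp]:
  "\<lbrakk>X \<in> Obj K; Y \<in> Obj K; Z \<in> Obj K; g \<in> Hom K Y Z\<rbrakk> \<Longrightarrow> Comp K X Y Z g 0 = 0"
  using Comp_add_right[of X Y Z 0 0 g] by simp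

lemma Comp_0_left [simp]:
  "\<lbrakk>X \<in> Obj K; Y \<in> Obj K; Z \<in> Obj K; f \<in> Hom K X Y\<rbrakk> \<Longrightarrow> Comp K X Y Z 0 f = 0"
  using Comp_add_left[of X Y Z f 0 0] by simp

lemma Comp_diff_right:
  "\<lbrakk>X \<in> Obj K; Y \<in> Obj K; Z \<in> Obj K; f \<in> Hom K X Y; f' \<in> Hom K X Y; g \<in> Hom K Y Z\<rbrakk>
    \<Longrightarrow> Comp K X Y Z g (f - f') = Comp K X Y Z g f - Comp K X Y Z g f'"
  using Comp_add_right[of X Y Z "f - f'" f' g] by simp

lemma Comp_diff_left:
  "\<lbrakk>X \<in> Obj K; Y \<in> Obj K; Z \<in> Obj K; f \<in> Hom K X Y; g \<in> Hom K Y Z; g' \<in> Hom K Y Z\<rbrakk>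
    \<Longrightarrow> Comp K X Y Z (g - g') f = Comp K X Y Z g f - Comp K X Y Z g' f"
  using Comp_add_left[of X Y Z f "g - g'" g'] by simp

lemma Comp_sum_right:
  assumes "X \<in> Obj K" "Y \<in> Obj K" "Z \<in> Obj K" "g \<in> Hom K Y Z" "\<forall>i\<in>I. f i \<in> Hom K X Y"
  shows "Comp K X Y Z g (\<Sum>i\<in>I. f i) = (\<Sum>i\<in>I. Comp K X Y Z g (f i))"
  using assms(5) by (induction I rule: infinite_finite_induct)
    (simp_all add: assms(1-4) Comp_add_right Hom_sum)

lemma Comp_sum_left:
  assumes "X \<in> Obj K" "Y \<in> Obj K" "Z \<in> Obj K" "f \<in> Hom K X Y" "\<forall>i\<in>I. g i \<in> Hom K Y Z"
  shows "Comp K X Y Z (\<Sum>i\<in>I. g i) f = (\<Sum>i\<in>I. Comp K X Y Z (g i) f)"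
  using assms(5) by (induction I rule: infinite_finite_induct)
    (simp_all add: assms(1-4) Comp_add_left Hom_sum)

lemma is_zero_object_iff: "is_zero_object K X \<longleftrightarrow> X \<in> Obj K \<and> Ident K X = 0"
proof
  assume "is_zero_object K X"
  then have X: "X \<in> Obj K" and "\<exists>!f. f \<in> Hom K X X" by (auto simp: is_zero_object_def)
  then show "X \<in> Obj K \<and> Ident K X = 0" using Ident_in[OF X] Hom_0[OF X X] by blast
next
  assume a: "X \<in> Obj K \<and> Ident K X = 0"
  show "is_zero_object K X" unfolding is_zero_object_def
  proof (intro conjI ballI)
    fix Y assume Y: "Y \<in> Obj K"
    have "f = 0" if "f \<in> Hom K X Y" for f
      using Comp_Ident(2)[of X Y f] Comp_0_right[of X X Y f] a Y that by simp
    then show "\<exists>!f. f \<in> Hom K X Y" using a Y Hom_0 by blast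
    have "f = 0" if "f \<in> Hom K Y X" for f
      using Comp_Ident(1)[of Y X f] Comp_0_left[of Y X X f] a Y that by simp
    then show "\<exists>!f. f \<in> Hom K Y X" using a Y Hom_0 by blast
  qed (use a in simp)
qed

lemma is_direct_sum_Nil: "is_zero_object K X \<Longrightarrow> is_direct_sum K [] X"
  by (simp add: is_direct_sum_def is_zero_object_iff)

lemma is_direct_sum_single: "X \<in> Obj K \<Longrightarrow> is_direct_sum K [X] X"
  by (auto simp: is_direct_sum_def intro!: exI[of _ "\<lambda>_. Ident K X"])

text \<open>Two decompositions are composed with a biproduct diagram for \<open>S\<close>. Longer
  lists occur when an object is decomposed into simples; one-element lists turn explicit inclusions
  and projections into a biproduct in either completion.\<close>

lemma is_direct_sum_append:
  assumes X: "is_direct_sum K Xs X" and Y: "is_direct_sum K Ys Y" and S: "S \<in> Obj K"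
    and i: "i \<in> Hom K X S" "p \<in> Hom K S X" "Comp K X S X p i = Ident K X"
    and j: "j \<in> Hom K Y S" "q \<in> Hom K S Y" "Comp K Y S Y q j = Ident K Y"
    and pj: "Comp K Y S X p j = 0" and qi: "Comp K X S Y q i = 0"
    and sum: "Comp K S X S i p + Comp K S Y S j q = Ident K S"
  shows "is_direct_sum K (Xs @ Ys) S"
proof -
  let ?n = "length Xs"
  obtain a b where ab: "\<And>k. k < length Xs \<Longrightarrow> a k \<in> Hom K (Xs ! k) X \<and> b k \<in> Hom K X (Xs ! k)"
    and ba: "\<And>k l. k < length Xs \<Longrightarrow> l < length Xs \<Longrightarrow>
      Comp K (Xs ! l) X (Xs ! k) (b k) (a l) = (if k = l then Ident K (Xs ! k) else 0)"
    and sab: "(\<Sum>k<length Xs. Comp K X (Xs ! k) X (a k) (b k)) = Ident K X"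
    using X unfolding is_direct_sum_def by blast
  obtain c d where cd: "\<And>k. k < length Ys \<Longrightarrow> c k \<in> Hom K (Ys ! k) Y \<and> d k \<in> Hom K Y (Ys ! k)"
    and dc: "\<And>k l. k < length Ys \<Longrightarrow> l < length Ys \<Longrightarrow>
      Comp K (Ys ! l) Y (Ys ! k) (d k) (c l) = (if k = l then Ident K (Ys ! k) else 0)"
    and scd: "(\<Sum>k<length Ys. Comp K Y (Ys ! k) Y (c k) (d k)) = Ident K Y"
    using Y unfolding is_direct_sum_def by blast
  have O: "X \<in> Obj K" "Y \<in> Obj K" "set Xs \<subseteq> Obj K" "set Ys \<subseteq> Obj K"
    using X Y by (auto simp: is_direct_sum_def)
  have Ox [simp]: "k < length Xs \<Longrightarrow> Xs ! k \<in> Obj K" for k using O(3) by auto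
  have Oy [simp]: "k < length Ys \<Longrightarrow> Ys ! k \<in> Obj K" for k using O(4) by auto
  note [simp] = S O(1,2) i(1,2) j(1,2)
  have [simp]: "k < length Xs \<Longrightarrow> a k \<in> Hom K (Xs ! k) X" "k < length Xs \<Longrightarrow> b k \<in> Hom K X (Xs ! k)"
    for k using ab by auto
  have [simp]: "k < length Ys \<Longrightarrow> c k \<in> Hom K (Ys ! k) Y" "k < length Ys \<Longrightarrow> d k \<in> Hom K Y (Ys ! k)"
    for k using cd by auto
  define e where "e k = (if k < ?n then Comp K (Xs ! k) X S i (a k)
      else Comp K (Ys ! (k - ?n)) Y S j (c (k - ?n)))" for k
  define f where "f k = (if k < ?n then Comp K S X (Xs ! k) (b k) p
      else Comp K S Y (Ys ! (k - ?n)) (d (k - ?n)) q)" for k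
  \<comment> \<open>Each product of a projection with an inclusion has the form
    \<open>v (z w) u\<close>, where \<open>z w\<close> is one of the four known products of
    \<open>p\<close>, \<open>q\<close> with \<open>i\<close>, \<open>j\<close>.\<close>
  have sandwich: "Comp K U S V (Comp K S B V v z) (Comp K U A S w u)
      = Comp K U B V v (Comp K U A B (Comp K A S B z w) u)"
    if "U \<in> Obj K" "V \<in> Obj K" "A \<in> Obj K" "B \<in> Obj K" "u \<in> Hom K U A" "w \<in> Hom K A S"
      "z \<in> Hom K S B" "v \<in> Hom K B V" for U V A B u v w z
    using that by (simp add: Comp_assoc)
  have sandwich': "Comp K S U S (Comp K U A S w u) (Comp K S A U v z)
      = Comp K S A S w (Comp K S A A (Comp K A U A u v) z)"
    if "U \<in> Obj K" "A \<in> Obj K" "u \<in> Hom K U A" "w \<in> Hom K A S"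
      "z \<in> Hom K S A" "v \<in> Hom K A U" for U A u v w z
    using that by (simp add: Comp_assoc)
  have exI2: "\<exists>\<iota> \<pi>. P \<iota> \<pi>" if "P e f" for P using that by blast
  show ?thesis unfolding is_direct_sum_def
  proof (intro conjI exI2 allI impI)
    show "set (Xs @ Ys) \<subseteq> Obj K" using O by simp
    show "S \<in> Obj K" by simp
    fix k assume k: "k < length (Xs @ Ys)"
    show "e k \<in> Hom K ((Xs @ Ys) ! k) S" "f k \<in> Hom K S ((Xs @ Ys) ! k)"
      using k by (auto simp: e_def f_def nth_append)
    fix l assume l: "l < length (Xs @ Ys)"
    have kl: "\<not> k < ?n \<Longrightarrow> k - ?n < length Ys" "\<not> l < ?n \<Longrightarrow> l - ?n < length Ys"
      using k l by auto
    show "Comp K ((Xs @ Ys) ! l) S ((Xs @ Ys) ! k) (f k) (e l) =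
      (if k = l then Ident K ((Xs @ Ys) ! k) else 0)"
    proof (cases "k < ?n"; cases "l < ?n")
      assume "k < ?n" "l < ?n"
      then show ?thesis using i by (simp add: e_def f_def nth_append sandwich ba)
    next
      assume "k < ?n" "\<not> l < ?n"
      then show ?thesis using kl pj by (simp add: e_def f_def nth_append sandwich) 
    next
      assume "\<not> k < ?n" "l < ?n"
      then show ?thesis using kl qi by (simp add: e_def f_def nth_append sandwich) 
    next
      assume "\<not> k < ?n" "\<not> l < ?n"
      then show ?thesis using kl j by (auto simp add: e_def f_def nth_append sandwich dc)
    qed
  next
    have "(\<Sum>k<length (Xs @ Ys). Comp K S ((Xs @ Ys) ! k) S (e k) (f k))
      = (\<Sum>k<?n. Comp K S ((Xs @ Ys) ! k) S (e k) (f k))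
        + (\<Sum>k<length Ys. Comp K S ((Xs @ Ys) ! (?n + k)) S (e (?n + k)) (f (?n + k)))"
      by (simp add: sum_lessThan_add)
    also have "(\<Sum>k<?n. Comp K S ((Xs @ Ys) ! k) S (e k) (f k))
      = (\<Sum>k<?n. Comp K S X S i (Comp K S X X (Comp K X (Xs ! k) X (a k) (b k)) p))"
      by (rule sum.cong) (simp_all add: e_def f_def nth_append sandwich')
    \<comment> \<open>Read backwards: \<open>Ident K X\<close> is inserted between \<open>i\<close>
      and \<open>p\<close> and expanded over the summands of \<open>X\<close>.\<close>
    also have "\<dots> = Comp K S X S i p"
      using i by (subst (2) Comp_Ident(1)[of S X p, symmetric])
        (simp_all add: Comp_sum_left Comp_sum_right flip: sab cong: sum.cong_simp)
    also have "(\<Sum>k<length Ys. Comp K S ((Xs @ Ys) ! (?n + k)) S (e (?n + k)) (f (?n + k)))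
      = (\<Sum>k<length Ys. Comp K S Y S j (Comp K S Y Y (Comp K Y (Ys ! k) Y (c k) (d k)) q))"
      by (rule sum.cong) (simp_all add: e_def f_def nth_append sandwich')
    also have "\<dots> = Comp K S Y S j q"
      using j by (subst (2) Comp_Ident(1)[of S Y q, symmetric])
        (simp_all add: Comp_sum_left Comp_sum_right flip: scd cong: sum.cong_simp)
    finally show "(\<Sum>k<length (Xs @ Ys). Comp K S ((Xs @ Ys) ! k) S (e k) (f k)) = Ident K S"
      using sum by simp
  qed
qed

end

definition has_splittings :: "('o, 'm) lincat \<Rightarrow> bool" where
  "has_splittings K \<longleftrightarrow> (\<forall>X\<in>Obj K. \<forall>e\<in>Hom K X X. Comp K X X X e e = e \<longrightarrow>
    (\<exists>A\<in>Obj K. \<exists>i\<in>Hom K A X. \<exists>p\<in>Hom K X A. Comp K A X A p i = Ident K A \<and> Comp K X A X i p = e))"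

definition finite_dim_homs :: "('o, 'm::ab_group_add) lincat \<Rightarrow> bool" where
  "finite_dim_homs K \<longleftrightarrow>
    (\<forall>X\<in>Obj K. \<forall>Y\<in>Obj K. \<exists>B. finite B \<and> Hom K X Y \<subseteq> module.span (Scale K) B)"

text \<open>For \<open>X = Y\<close> this is semiprimeness of the endomorphism algebra. Morphisms
  between different objects are included because kernels and cokernels require regularity of all
  morphisms.\<close>

definition semiprime_category :: "('o, 'm::zero) lincat \<Rightarrow> bool" where
  "semiprime_category K \<longleftrightarrow> (\<forall>X\<in>Obj K. \<forall>Y\<in>Obj K. \<forall>u\<in>Hom K X Y. u \<noteq> 0 \<longrightarrow>
    (\<exists>h\<in>Hom K Y X. Comp K X X Y u (Comp K X Y X h u) \<noteq> 0))"

locale semiprime_cat = lin_cat K for K :: "('o, 'm::ab_group_add) lincat" +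
  assumes findim: "finite_dim_homs K" and semiprime: "semiprime_category K"
begin

section \<open>Right ideals of endomorphism algebras\<close>

definition right_ideal :: "'o \<Rightarrow> 'm set \<Rightarrow> bool" where
  "right_ideal X J \<longleftrightarrow> X \<in> Obj K \<and> J \<subseteq> Hom K X X \<and> vs.subspace J \<and>
    (\<forall>a\<in>J. \<forall>h\<in>Hom K X X. Comp K X X X a h \<in> J)"

lemma right_idealD:
  assumes "right_ideal X J"
  shows "X \<in> Obj K" "a \<in> J \<Longrightarrow> a \<in> Hom K X X" "vs.subspace J"
    "a \<in> J \<Longrightarrow> h \<in> Hom K X X \<Longrightarrow> Comp K X X X a h \<in> J"
    "a \<in> J \<Longrightarrow> b \<in> J \<Longrightarrow> a - b \<in> J" "a \<in> J \<Longrightarrow> b \<in> J \<Longrightarrow> a + b \<in> J" "0 \<in> J"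
  using assms vs.subspace_diff vs.subspace_add vs.subspace_0 unfolding right_ideal_def by blast+

lemma dim_less:
  assumes "X \<in> Obj K" "vs.subspace V" "V \<subset> W" "W \<subseteq> Hom K X X"
  shows "vs.dim V < vs.dim W"
proof -
  obtain B where "finite B" "Hom K X X \<subseteq> vs.span B"
    using findim assms(1) unfolding finite_dim_homs_def by blast
  then show ?thesis using vs.dim_strict_mono[of B W V] assms by auto
qed

lemma right_ideal_annihilator:
  assumes J: "right_ideal X J" and c: "c \<in> Hom K X X"
  shows "right_ideal X {x \<in> J. Comp K X X X c x = 0}"
  unfolding right_ideal_def
proof (intro conjI ballI)
  note [simp] = right_idealD(1)[OF J] right_idealD(2)[OF J] c
  show "X \<in> Obj K" by simp
  show "{x \<in> J. Comp K X X X c x = 0} \<subseteq> Hom K X X" by auto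
  show "vs.subspace {x \<in> J. Comp K X X X c x = 0}"
    using right_idealD(3)[OF J] unfolding vs.subspace_def by (auto simp: Comp_add_right Comp_scale_right)
  fix a h assume "a \<in> {x \<in> J. Comp K X X X c x = 0}" "h \<in> Hom K X X"
  then show "Comp K X X X a h \<in> {x \<in> J. Comp K X X X c x = 0}"
    by (auto simp: right_idealD(4)[OF J] simp flip: Comp_assoc)
qed

text \<open>Two uses fix the generality: \<open>c J\<close> for a right ideal \<open>J\<close>, and
  \<open>f Hom(Y,X)\<close> as a right ideal of \<open>End(Y)\<close>.\<close>

lemma right_ideal_image:
  assumes X: "X \<in> Obj K" "Y \<in> Obj K" and c: "c \<in> Hom K Y X"
    and V: "vs.subspace V" "V \<subseteq> Hom K X Y" "\<And>a h. a \<in> V \<Longrightarrow> h \<in> Hom K X X \<Longrightarrow> Comp K X X Y a h \<in> V"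
  shows "right_ideal X (Comp K X Y X c ` V)"
  unfolding right_ideal_def
proof (intro conjI ballI)
  have [simp]: "a \<in> V \<Longrightarrow> a \<in> Hom K X Y" for a using V by auto
  note [simp] = X c
  show "X \<in> Obj K" "Comp K X Y X c ` V \<subseteq> Hom K X X" by auto
  show "vs.subspace (Comp K X Y X c ` V)" unfolding vs.subspace_def
  proof (intro conjI ballI allI)
    show "0 \<in> Comp K X Y X c ` V" using vs.subspace_0[OF V(1)] Comp_0_right[of X Y X c] by force
    fix x y a assume "x \<in> Comp K X Y X c ` V"
    then obtain x' where x': "x' \<in> V" "x = Comp K X Y X c x'" by auto
    then have "Scale K a x = Comp K X Y X c (Scale K a x')" by (simp add: Comp_scale_right)
    then show "Scale K a x \<in> Comp K X Y X c ` V" using vs.subspace_scale[OF V(1) x'(1)] by blast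
    assume "y \<in> Comp K X Y X c ` V"
    then obtain y' where y': "y' \<in> V" "y = Comp K X Y X c y'" by auto
    then have "x + y = Comp K X Y X c (x' + y')" using x' by (simp add: Comp_add_right)
    then show "x + y \<in> Comp K X Y X c ` V" using vs.subspace_add[OF V(1) x'(1) y'(1)] by blast
  qed
  fix a h assume "a \<in> Comp K X Y X c ` V" and h: "h \<in> Hom K X X"
  then obtain x where "x \<in> V" "a = Comp K X Y X c x" by auto
  then show "Comp K X X X a h \<in> Comp K X Y X c ` V" using h V(3) by (auto simp: Comp_assoc)
qed

text \<open>Brauer's lemma: in a minimal right ideal \<open>J\<close> some \<open>c\<close> satisfies \<open>c J = J\<close>, and the solution of
  \<open>c e = c\<close> in \<open>J\<close> is idempotent because \<open>c\<close> has trivial annihilator in \<open>J\<close>.\<close>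

lemma right_ideal_has_idempotent:
  assumes "right_ideal X J" "J \<noteq> {0}"
  shows "\<exists>e\<in>J. e \<noteq> 0 \<and> Comp K X X X e e = e"
  using assms
proof (induction "vs.dim J" arbitrary: J rule: less_induct)
  case less
  note J = less.prems(1)
  note [simp] = right_idealD(1)[OF J] right_idealD(2)[OF J]
  \<comment> \<open>No minimal ideal is chosen. A nonzero right ideal properly inside
    \<open>J\<close> settles the claim by induction, so \<open>J\<close> may be treated as minimal
    whenever such an ideal turns up.\<close>
  have minimal: ?case if "right_ideal X J'" "J' \<noteq> {0}" "J' \<subset> J" for J'
    using less.hyps[OF _ that(1,2)] that dim_less[OF right_idealD(1)[OF J] right_idealD(3)[OF that(1)] that(3)]
      J unfolding right_ideal_def by blast
  obtain u where u: "u \<in> J" "u \<noteq> 0" using less.prems right_idealD(7)[OF J] by blast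
  then obtain h where h: "h \<in> Hom K X X" "Comp K X X X u (Comp K X X X h u) \<noteq> 0"
    using semiprime unfolding semiprime_category_def by (meson right_idealD(1,2)[OF J])
  \<comment> \<open>This \<open>c\<close> lies in \<open>J\<close> and satisfies
    \<open>c u \<noteq> 0\<close>, so \<open>c J\<close> is nonzero and the annihilator of
    \<open>c\<close> in \<open>J\<close> is proper.\<close>
  define c where "c = Comp K X X X u h"
  have c: "c \<in> J" using right_idealD(4)[OF J] u h c_def by blast
  have cu: "Comp K X X X c u \<noteq> 0" using u h by (simp add: c_def Comp_assoc)
  show ?case
  proof (cases "Comp K X X X c ` J = J")
    case False
    have "right_ideal X (Comp K X X X c ` J)"
      using right_ideal_image[of X X c J] J c right_idealD[OF J] by (auto simp: right_ideal_def)
    moreover have "Comp K X X X c ` J \<subseteq> J" using right_idealD(2,4)[OF J] c by blast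
    moreover have "Comp K X X X c ` J \<noteq> {0}" using cu u by blast
    ultimately show ?thesis using minimal False by blast
  next
    case True
    then obtain e where e: "e \<in> J" "Comp K X X X c e = c" using c by (metis imageE)
    let ?A = "{x \<in> J. Comp K X X X c x = 0}"
    show ?thesis
    proof (cases "?A = {0}")
      case False
      have "right_ideal X ?A" using right_ideal_annihilator[OF J] c by simp
      moreover have "?A \<subset> J" using cu u by blast
      ultimately show ?thesis using minimal False by blast
    next
      case True
      have "Comp K X X X e e - e \<in> ?A"
        using e c right_idealD(4,5)[OF J] by (auto simp: Comp_diff_right simp flip: Comp_assoc)
      then have "Comp K X X X e e - e = 0" using True by blast
      moreover have "e \<noteq> 0" using e(2) c cu u by auto
      ultimately show ?thesis using e by auto
    qed
  qed
qed

text \<open>A nonzero idempotent \<open>e\<close> in \<open>J\<close> splits \<open>J\<close> into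
  \<open>e J\<close> and the annihilator of \<open>e\<close>. The latter has smaller dimension,
  hence by induction a left unit \<open>e'\<close>, and the two left units are combined.\<close>

lemma right_ideal_generated_by_idempotent:
  assumes "right_ideal X J"
  shows "\<exists>e\<in>J. \<forall>x\<in>J. Comp K X X X e x = x"
  using assms
proof (induction "vs.dim J" arbitrary: J rule: less_induct)
  case less
  note J = less.prems(1)
  note [simp] = right_idealD(1)[OF J] right_idealD(2)[OF J]
  show ?case
  proof (cases "J = {0}")
    case True
    then show ?thesis by simp
  next
    case False
    then obtain e where e: "e \<in> J" "e \<noteq> 0" "Comp K X X X e e = e"
      using right_ideal_has_idempotent[OF J] by blast
    let ?A = "{x \<in> J. Comp K X X X e x = 0}"
    have A: "right_ideal X ?A" using right_ideal_annihilator[OF J] e by simp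
    have "?A \<subset> J" using e by force
    then have "vs.dim ?A < vs.dim J"
      using dim_less[OF right_idealD(1)[OF J] right_idealD(3)[OF A]] J unfolding right_ideal_def by blast
    from less.hyps[OF this A] obtain e' where e': "e' \<in> J" "Comp K X X X e e' = 0"
      "\<And>x. x \<in> J \<Longrightarrow> Comp K X X X e x = 0 \<Longrightarrow> Comp K X X X e' x = x" by blast
    \<comment> \<open>Here \<open>e e' = 0\<close>, but \<open>e' e\<close> need not vanish. The
      correction term makes \<open>?f\<close> the identity both on \<open>e J\<close> and on the
      annihilator of \<open>e\<close>.\<close>
    let ?f = "e + e' - Comp K X X X e' e"
    have "?f \<in> J" using e e' by (intro right_idealD(4-6)[OF J]) auto
    moreover have "Comp K X X X ?f x = x" if x: "x \<in> J" for x
    proof -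
      let ?y = "x - Comp K X X X e x"
      have ex: "Comp K X X X e x \<in> J" using right_idealD(4)[OF J e(1)] x by simp
      then have y: "?y \<in> J" using right_idealD(5)[OF J] x by blast
      have "Comp K X X X e ?y = 0" using e x by (simp add: Comp_diff_right flip: Comp_assoc)
      with e'(3)[OF y] have "Comp K X X X e' ?y = ?y" by blast
      then have "Comp K X X X e' x - Comp K X X X e' (Comp K X X X e x) = ?y"
        using e' e x by (simp add: Comp_diff_right)
      moreover have "Comp K X X X ?f x
          = Comp K X X X e x + Comp K X X X e' x - Comp K X X X e' (Comp K X X X e x)"
        using e e' x by (simp add: Comp_diff_left Comp_add_left Comp_assoc)
      ultimately show ?thesis by (simp add: algebra_simps)
    qed
    ultimately show ?thesis by blast
  qed
qed

text \<open>The right ideal \<open>f Hom(Y,X)\<close> of \<open>End(Y)\<close> has a left unit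
  \<open>f g\<close>. Then \<open>u = f - f g f\<close> satisfies \<open>u h = 0\<close> for all
  \<open>h : Y \<rightarrow> X\<close>, so \<open>u h u = 0\<close>, and semiprimeness forces
  \<open>u = 0\<close>.\<close>

lemma von_Neumann_regular:
  assumes X: "X \<in> Obj K" and Y: "Y \<in> Obj K" and f: "f \<in> Hom K X Y"
  obtains g where "g \<in> Hom K Y X" "Comp K X X Y f (Comp K X Y X g f) = f"
proof -
  note [simp] = X Y f
  let ?J = "Comp K Y X Y f ` Hom K Y X"
  have "right_ideal Y ?J" by (rule right_ideal_image) (auto intro: Hom_subspace)
  from right_ideal_generated_by_idempotent[OF this] obtain g where g: "g \<in> Hom K Y X"
    and id: "\<And>h. h \<in> Hom K Y X \<Longrightarrow> Comp K Y Y Y (Comp K Y X Y f g) (Comp K Y X Y f h) = Comp K Y X Y f h"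
    by (auto)
  let ?u = "f - Comp K X X Y f (Comp K X Y X g f)"
  have "Comp K Y X Y ?u h = 0" if "h \<in> Hom K Y X" for h
    using id[OF that] g that by (simp add: Comp_diff_left Comp_assoc)
  then have "Comp K X X Y ?u (Comp K X Y X h ?u) = 0" if "h \<in> Hom K Y X" for h
    using that g by (simp flip: Comp_assoc)
  then have "?u = 0" using semiprime g unfolding semiprime_category_def
    by (metis X Y f Hom_diff Comp_in)
  then show ?thesis using that g by simp
qed


section \<open>Splitting of monomorphisms and epimorphisms\<close>

lemma split_mono_of_mono:
  assumes X: "X \<in> Obj K" and Y: "Y \<in> Obj K" and f: "is_mono K X Y f"
  obtains g where "g \<in> Hom K Y X" "Comp K X Y X g f = Ident K X"
proof -
  have fH: "f \<in> Hom K X Y" using f by (simp add: is_mono_def)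
  obtain g where g: "g \<in> Hom K Y X" "Comp K X X Y f (Comp K X Y X g f) = f"
    using von_Neumann_regular[OF X Y fH] by blast
  have "Comp K X X Y f (Comp K X Y X g f) = Comp K X X Y f (Ident K X)" using g X Y fH by simp
  then have "Comp K X Y X g f = Ident K X" using f X Y fH g(1) unfolding is_mono_def by (meson Comp_in Ident_in)
  with g that show ?thesis by blast
qed

lemma split_epi_of_epi:
  assumes X: "X \<in> Obj K" and Y: "Y \<in> Obj K" and f: "is_epi K X Y f"
  obtains g where "g \<in> Hom K Y X" "Comp K Y X Y f g = Ident K Y"
proof -
  have fH: "f \<in> Hom K X Y" using f by (simp add: is_epi_def)
  obtain g where g: "g \<in> Hom K Y X" "Comp K X X Y f (Comp K X Y X g f) = f"
    using von_Neumann_regular[OF X Y fH] by blast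
  have "Comp K X Y Y (Comp K Y X Y f g) f = Comp K X Y Y (Ident K Y) f"
    using g X Y fH by (simp add: Comp_assoc)
  then have "Comp K Y X Y f g = Ident K Y" using f X Y fH g(1) unfolding is_epi_def by (meson Comp_in Ident_in)
  with g that show ?thesis by blast
qed

text \<open>With a retraction \<open>g\<close>, the morphism \<open>f\<close> is a kernel of the
  complementary idempotent \<open>1 - f g\<close> of \<open>Y\<close>.\<close>

lemma mono_is_kernel:
  assumes X: "X \<in> Obj K" and Y: "Y \<in> Obj K" and f: "is_mono K X Y f"
  shows "\<exists>Z\<in>Obj K. \<exists>g\<in>Hom K Y Z. is_kernel K Y Z g X f"
proof -
  have fH: "f \<in> Hom K X Y" using f by (simp add: is_mono_def)
  obtain g where g: "g \<in> Hom K Y X" "Comp K X Y X g f = Ident K X"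
    using split_mono_of_mono[OF assms] by blast
  note [simp] = X Y fH g
  let ?e = "Ident K Y - Comp K Y X Y f g"
  have gf: "Comp K W Y X g (Comp K W X Y f k) = k" if "W \<in> Obj K" "k \<in> Hom K W X" for W k
    using that by (simp flip: Comp_assoc)
  have "is_kernel K Y Y ?e X f" unfolding is_kernel_def
  proof (intro conjI ballI impI)
    show "Comp K X Y Y ?e f = 0" by (simp add: Comp_diff_left Comp_assoc)
    fix W h assume W: "W \<in> Obj K" "h \<in> Hom K W Y" "Comp K W Y Y ?e h = 0"
    then have "Comp K W X Y f (Comp K W Y X g h) = h" by (simp add: Comp_diff_left Comp_assoc)
    then show "\<exists>!k. k \<in> Hom K W X \<and> Comp K W X Y f k = h" 
      using W gf by (intro ex1I[of _ "Comp K W Y X g h"]) auto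
  qed auto
  then show ?thesis by (intro bexI[of _ Y] bexI[of _ ?e]) auto
qed

lemma epi_is_cokernel:
  assumes X: "X \<in> Obj K" and Y: "Y \<in> Obj K" and f: "is_epi K X Y f"
  shows "\<exists>W\<in>Obj K. \<exists>g\<in>Hom K W X. is_cokernel K W X g Y f"
proof -
  have fH: "f \<in> Hom K X Y" using f by (simp add: is_epi_def)
  obtain g where g: "g \<in> Hom K Y X" "Comp K Y X Y f g = Ident K Y"
    using split_epi_of_epi[OF assms] by blast
  note [simp] = X Y fH g
  let ?e = "Ident K X - Comp K X Y X g f"
  have gf: "Comp K Y X W (Comp K X Y W k f) g = k" if "W \<in> Obj K" "k \<in> Hom K Y W" for W k
    using that by (simp add: Comp_assoc)
  have "is_cokernel K X X ?e Y f" unfolding is_cokernel_def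
  proof (intro conjI ballI impI)
    show "Comp K X X Y f ?e = 0" by (simp add: Comp_diff_right flip: Comp_assoc)
    fix W h assume W: "W \<in> Obj K" "h \<in> Hom K X W" "Comp K X X W h ?e = 0"
    then have "Comp K X Y W (Comp K Y X W h g) f = h" by (simp add: Comp_diff_right Comp_assoc)
    then show "\<exists>!k. k \<in> Hom K Y W \<and> Comp K X Y W k f = h" 
      using W gf by (intro ex1I[of _ "Comp K Y X W h g"]) auto
  qed auto
  then show ?thesis by (intro bexI[of _ X] bexI[of _ ?e]) auto
qed

text \<open>A subobject showing that \<open>X\<close> is not simple is a direct summand. The last
  two conditions say that this summand is neither all of \<open>X\<close> nor zero, so both it and
  its complement are proper.\<close>

lemma simple_object_or_split:
  assumes X: "X \<in> Obj K" "\<not> is_zero_object K X" "\<not> simple_object K X"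
  obtains B j r where "B \<in> Obj K" "j \<in> Hom K B X" "r \<in> Hom K X B" "Comp K B X B r j = Ident K B"
    "Comp K X B X j r \<noteq> Ident K X" "Ident K B \<noteq> 0"
proof -
  obtain B j where B: "B \<in> Obj K" "is_mono K B X j" "\<not> is_zero_object K B" "\<not> is_iso K B X j"
    using X unfolding simple_object_def by blast
  obtain r where r: "r \<in> Hom K X B" "Comp K B X B r j = Ident K B"
    using split_mono_of_mono[OF B(1) X(1) B(2)] by blast
  have j: "j \<in> Hom K B X" using B(2) by (simp add: is_mono_def)
  show ?thesis
    by (rule that[OF B(1) j r]) (use B r j in \<open>auto simp: is_iso_def is_zero_object_iff\<close>)
qed

end

section \<open>Kernels, cokernels and decomposition into simple objects\<close>

locale split_semiprime_cat = semiprime_cat K for K :: "('o, 'm::ab_group_add) lincat" +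
  assumes splittings: "has_splittings K"
begin

text \<open>The complement is the image of the idempotent \<open>1 - j r\<close>.\<close>

lemma complement:
  assumes A: "A \<in> Obj K" and B: "B \<in> Obj K" and j: "j \<in> Hom K B A" and r: "r \<in> Hom K A B"
    and rj: "Comp K B A B r j = Ident K B"
  obtains B' j' r' where "B' \<in> Obj K" "j' \<in> Hom K B' A" "r' \<in> Hom K A B'"
    "Comp K B' A B' r' j' = Ident K B'" "Comp K B' A B r j' = 0" "Comp K B A B' r' j = 0"
    "Comp K A B A j r + Comp K A B' A j' r' = Ident K A"
proof -
  note [simp] = A B j r rj
  have rj': "Comp K W A B r (Comp K W B A j h) = h" if "W \<in> Obj K" "h \<in> Hom K W B" for W h
    using that by (simp flip: Comp_assoc)
  let ?e = "Ident K A - Comp K A B A j r"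
  have e: "?e \<in> Hom K A A" by simp
  have "Comp K A A A ?e ?e = ?e" by (simp add: Comp_diff_left Comp_diff_right Comp_assoc rj')
  then obtain B' j' r' where B': "B' \<in> Obj K" "j' \<in> Hom K B' A" "r' \<in> Hom K A B'"
    "Comp K B' A B' r' j' = Ident K B'" "Comp K A B' A j' r' = ?e"
    using splittings e A unfolding has_splittings_def by blast
  note [simp] = B'(1-4)
  \<comment> \<open>Inserting \<open>r' j' = 1\<close> turns \<open>r j'\<close> into
    \<open>r (1 - j r) j'\<close>, which vanishes because \<open>r j = 1\<close>.\<close>
  have "Comp K B' A B r j' = Comp K B' A B r (Comp K B' B' A j' (Comp K B' A B' r' j'))" by simp
  also have "\<dots> = Comp K B' A B r (Comp K B' A A ?e j')" by (simp add: Comp_assoc flip: B'(5))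
  also have "\<dots> = 0" by (simp add: Comp_diff_left Comp_diff_right Comp_assoc rj')
  finally have 1: "Comp K B' A B r j' = 0" .
  have "Comp K B A B' r' j = Comp K B B' B' (Comp K B' A B' r' j') (Comp K B A B' r' j)" by simp
  also have "\<dots> = Comp K B A B' r' (Comp K B A A ?e j)" by (simp add: Comp_assoc del: B'(4) flip: B'(5))
  also have "\<dots> = 0" by (simp add: Comp_diff_left Comp_assoc)
  finally have 2: "Comp K B A B' r' j = 0" .
  show ?thesis by (rule that[OF B'(1-4) 1 2]) (simp add: B'(5))
qed

text \<open>The kernel is the image of the idempotent \<open>1 - g f\<close>: \<open>f\<close> kills
  it because \<open>f g f = f\<close>, and it fixes every \<open>h\<close> with
  \<open>f h = 0\<close>.\<close>

lemma has_kernel: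
  assumes X: "X \<in> Obj K" and Y: "Y \<in> Obj K" and f: "f \<in> Hom K X Y"
  shows "\<exists>A i. is_kernel K X Y f A i"
proof -
  obtain g where g: "g \<in> Hom K Y X" "Comp K X X Y f (Comp K X Y X g f) = f"
    using von_Neumann_regular[OF assms] by blast
  note [simp] = X Y f g
  let ?e = "Ident K X - Comp K X Y X g f"
  have e: "?e \<in> Hom K X X" by simp
  have "Comp K X X X ?e ?e = ?e" by (simp add: Comp_diff_left Comp_diff_right Comp_assoc)
  then obtain A i p where A: "A \<in> Obj K" "i \<in> Hom K A X" "p \<in> Hom K X A"
    "Comp K A X A p i = Ident K A" "Comp K X A X i p = ?e"
    using splittings e X unfolding has_splittings_def by blast
  note [simp] = A(1-4)
  have pi: "Comp K W X A p (Comp K W A X i k) = k" if "W \<in> Obj K" "k \<in> Hom K W A" for W k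
    using that by (simp flip: Comp_assoc)
  have fgf: "Comp K W X Y f (Comp K W Y X g (Comp K W X Y f k)) = Comp K W X Y f k"
    if "W \<in> Obj K" "k \<in> Hom K W X" for W k
    using that g by (metis (no_types, lifting) Comp_assoc Comp_in X Y f)
  have "is_kernel K X Y f A i" unfolding is_kernel_def
  proof (intro conjI ballI impI)
    have "Comp K A X Y f i = Comp K A X Y f (Comp K A A X i (Comp K A X A p i))" by simp
    also have "\<dots> = Comp K A X Y f (Comp K A X X ?e i)" by (simp add: Comp_assoc del: A(4) flip: A(5))
    also have "\<dots> = 0" by (simp add: Comp_diff_left Comp_diff_right Comp_assoc fgf)
    finally show "Comp K A X Y f i = 0" .
    fix W h assume W: "W \<in> Obj K" "h \<in> Hom K W X" "Comp K W X Y f h = 0"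
    have "Comp K W A X i (Comp K W X A p h) = Comp K W X X ?e h"
      using W by (simp add: Comp_assoc flip: A(5))
    also have "\<dots> = h" using W by (simp add: Comp_diff_left Comp_assoc)
    finally show "\<exists>!k. k \<in> Hom K W A \<and> Comp K W A X i k = h"
      using W pi by (intro ex1I[of _ "Comp K W X A p h"]) auto
  qed auto
  then show ?thesis by blast
qed

text \<open>Dually, the cokernel is the projection onto the image of the idempotent
  \<open>1 - f g\<close>.\<close>

lemma has_cokernel:
  assumes X: "X \<in> Obj K" and Y: "Y \<in> Obj K" and f: "f \<in> Hom K X Y"
  shows "\<exists>B c. is_cokernel K X Y f B c"
proof -
  obtain g where g: "g \<in> Hom K Y X" "Comp K X X Y f (Comp K X Y X g f) = f"
    using von_Neumann_regular[OF assms] by blast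
  note [simp] = X Y f g
  let ?e = "Ident K Y - Comp K Y X Y f g"
  have e: "?e \<in> Hom K Y Y" by simp
  have fgf: "Comp K W X Y f (Comp K W Y X g (Comp K W X Y f k)) = Comp K W X Y f k"
    if "W \<in> Obj K" "k \<in> Hom K W X" for W k
    using that g by (metis (no_types, lifting) Comp_assoc Comp_in X Y f)
  have "Comp K Y Y Y ?e ?e = ?e" by (simp add: Comp_diff_left Comp_diff_right Comp_assoc fgf)
  then obtain A i p where A: "A \<in> Obj K" "i \<in> Hom K A Y" "p \<in> Hom K Y A"
    "Comp K A Y A p i = Ident K A" "Comp K Y A Y i p = ?e"
    using splittings e Y unfolding has_splittings_def by blast
  note [simp] = A(1-4)
  have pi: "Comp K A Y W (Comp K Y A W k p) i = k" if "W \<in> Obj K" "k \<in> Hom K A W" for W k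
    using that by (simp add: Comp_assoc)
  have "is_cokernel K X Y f A p" unfolding is_cokernel_def
  proof (intro conjI ballI impI)
    have "Comp K X Y A p f = Comp K X A A (Comp K A Y A p i) (Comp K X Y A p f)" by simp
    also have "\<dots> = Comp K X Y A p (Comp K X Y Y ?e f)" by (simp add: Comp_assoc del: A(4) flip: A(5))
    also have "\<dots> = 0" by (simp add: Comp_diff_left Comp_assoc)
    finally show "Comp K X Y A p f = 0" .
    fix W h assume W: "W \<in> Obj K" "h \<in> Hom K Y W" "Comp K X Y W h f = 0"
    have "Comp K Y A W (Comp K A Y W h i) p = Comp K Y Y W h ?e"
      using W by (simp add: Comp_assoc flip: A(5))
    also have "\<dots> = h" using W by (simp add: Comp_diff_right flip: Comp_assoc)
    finally show "\<exists>!k. k \<in> Hom K A W \<and> Comp K Y A W k p = h"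
      using W pi by (intro ex1I[of _ "Comp K A Y W h i"]) auto
  qed auto
  then show ?thesis by blast
qed

text \<open>The corner algebra \<open>e End(X) e\<close>, a copy of the endomorphism algebra of the
  image of \<open>e\<close>. Its dimension measures the size of a summand; since all corners lie in
  one space \<open>End(X)\<close>, they can be compared by inclusion.\<close>

definition corner :: "'o \<Rightarrow> 'm \<Rightarrow> 'm set" where
  "corner X e = {x \<in> Hom K X X. Comp K X X X e x = x \<and> Comp K X X X x e = x}"

text \<open>The idempotent of the smaller summand is absorbed on both sides by that of
  \<open>A\<close>, so the corners are nested. The idempotent \<open>i p\<close> of \<open>A\<close>
  lies in the larger corner; if it lay in the smaller one, the two idempotents would agree and
  \<open>j r\<close> would be the identity.\<close>

lemma dim_corner_less:
  assumes X: "X \<in> Obj K" and A: "A \<in> Obj K" and i: "i \<in> Hom K A X" and p: "p \<in> Hom K X A"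
    and pi: "Comp K A X A p i = Ident K A"
    and B: "B \<in> Obj K" and j: "j \<in> Hom K B A" and r: "r \<in> Hom K A B"
    and jr: "Comp K A B A j r \<noteq> Ident K A"
  shows "vs.dim (corner X (Comp K X B X (Comp K B A X i j) (Comp K X A B r p)))
    < vs.dim (corner X (Comp K X A X i p))"
proof (rule dim_less)
  note [simp] = X A i p pi B j r
  have pi': "Comp K W X A p (Comp K W A X i h) = h" if "W \<in> Obj K" "h \<in> Hom K W A" for W h
    using that by (simp flip: Comp_assoc)
  let ?e = "Comp K X A X i p" and ?e1 = "Comp K X B X (Comp K B A X i j) (Comp K X A B r p)"
  have ee1: "Comp K X X X ?e ?e1 = ?e1" by (simp add: Comp_assoc pi')
  have e1e: "Comp K X X X ?e1 ?e = ?e1" by (simp add: Comp_assoc pi')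
  show "X \<in> Obj K" by simp
  show "vs.subspace (corner X ?e1)" unfolding vs.subspace_def corner_def
    by (auto simp: Comp_add_left Comp_add_right Comp_scale_left Comp_scale_right)
  show "corner X ?e \<subseteq> Hom K X X" by (auto simp: corner_def)
  have "corner X ?e1 \<subseteq> corner X ?e"
  proof
    fix x assume "x \<in> corner X ?e1"
    then have x: "x \<in> Hom K X X" "Comp K X X X ?e1 x = x" "Comp K X X X x ?e1 = x"
      by (auto simp: corner_def)
    have "Comp K X X X ?e x = Comp K X X X (Comp K X X X ?e ?e1) x"
      using Comp_assoc[of X X X X x ?e1 ?e] x by simp
    moreover have "Comp K X X X x ?e = Comp K X X X x (Comp K X X X ?e1 ?e)"
      using Comp_assoc[of X X X X ?e ?e1 x] x by simp
    ultimately show "x \<in> corner X ?e" unfolding ee1 e1e corner_def using x by simp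
  qed
  moreover have "?e \<in> corner X ?e" by (simp add: corner_def Comp_assoc pi')
  moreover have "?e \<notin> corner X ?e1"
  proof
    assume "?e \<in> corner X ?e1"
    then have e: "?e1 = ?e" using e1e by (simp add: corner_def)
    have "Comp K A B A j r = Comp K A X A p (Comp K A X X ?e1 i)" by (simp add: Comp_assoc pi')
    also have "\<dots> = Ident K A" unfolding e by (simp add: Comp_assoc)
    finally show False using jr by simp
  qed
  ultimately show "corner X ?e1 \<subset> corner X ?e" by blast
qed

text \<open>The induction runs over the summands \<open>A\<close> of a fixed \<open>X\<close>,
  relative to which the corner dimension is taken. If \<open>A\<close> is neither zero nor simple,
  it splits into two summands with strictly smaller corners.\<close>

lemma summand_is_sum_of_simples:
  assumes X: "X \<in> Obj K" and "A \<in> Obj K" "i \<in> Hom K A X" "p \<in> Hom K X A" "Comp K A X A p i = Ident K A"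
  shows "\<exists>Xs. (\<forall>Y\<in>set Xs. simple_object K Y) \<and> is_direct_sum K Xs A"
  using assms(2-)
proof (induction "vs.dim (corner X (Comp K X A X i p))" arbitrary: A i p rule: less_induct)
  case less
  note [simp] = X less.prems
  consider "is_zero_object K A" | "simple_object K A" | "\<not> is_zero_object K A" "\<not> simple_object K A"
    by blast
  then show ?case
  proof cases
    case 1
    then show ?thesis using is_direct_sum_Nil by (intro exI[of _ "[]"]) auto
  next
    case 2
    then show ?thesis using is_direct_sum_single[of A] by (intro exI[of _ "[A]"]) auto
  next
    case 3
    obtain B j r where B: "B \<in> Obj K" "j \<in> Hom K B A" "r \<in> Hom K A B" "Comp K B A B r j = Ident K B"
      "Comp K A B A j r \<noteq> Ident K A" "Ident K B \<noteq> 0"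
      using simple_object_or_split[OF less.prems(1) 3] by metis
    obtain B' j' r' where B': "B' \<in> Obj K" "j' \<in> Hom K B' A" "r' \<in> Hom K A B'"
      "Comp K B' A B' r' j' = Ident K B'" "Comp K B' A B r j' = 0" "Comp K B A B' r' j = 0"
      "Comp K A B A j r + Comp K A B' A j' r' = Ident K A"
      using complement[OF less.prems(1) B(1-4)] by metis
    \<comment> \<open>Otherwise \<open>j r = 0\<close>, and \<open>B\<close> would be a zero
      object.\<close>
    have jr': "Comp K A B' A j' r' \<noteq> Ident K A"
    proof
      assume "Comp K A B' A j' r' = Ident K A"
      then have "Comp K A B A j r = 0" using B'(7) by simp
      then have "Comp K B A B r (Comp K B A A (Comp K A B A j r) j) = 0" using B by simp
      moreover have "Comp K B A B r (Comp K B A A (Comp K A B A j r) j) = Ident K B"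
        using B(1-4) by (simp add: Comp_assoc)
      ultimately show False using B(6) by simp
    qed
    have sub: "\<exists>Xs. (\<forall>Y\<in>set Xs. simple_object K Y) \<and> is_direct_sum K Xs D"
      if D: "D \<in> Obj K" "k \<in> Hom K D A" "s \<in> Hom K A D" "Comp K D A D s k = Ident K D"
        "Comp K A D A k s \<noteq> Ident K A" for D k s
    proof (rule less.hyps[OF dim_corner_less[OF X less.prems D(1,2,3,5)]])
      have "Comp K D X A p (Comp K D A X i k) = k" using D by (simp flip: Comp_assoc)
      then show "Comp K D X D (Comp K X A D s p) (Comp K D A X i k) = Ident K D"
        using D(1-4) by (simp add: Comp_assoc)
    qed (use D in simp_all)
    obtain Xs where Xs: "\<forall>Y\<in>set Xs. simple_object K Y" "is_direct_sum K Xs B"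
      using sub[OF B(1-5)] by blast
    obtain Ys where Ys: "\<forall>Y\<in>set Ys. simple_object K Y" "is_direct_sum K Ys B'"
      using sub[OF B'(1-4) jr'] by blast
    have "is_direct_sum K (Xs @ Ys) A"
      by (rule is_direct_sum_append[OF Xs(2) Ys(2) less.prems(1) B(2-4) B'(2-7)])
    then show ?thesis using Xs(1) Ys(1) by (intro exI[of _ "Xs @ Ys"]) auto
  qed
qed

theorem semisimple:
  assumes "\<exists>Z. is_zero_object K Z" and "\<forall>X\<in>Obj K. \<forall>Y\<in>Obj K. \<exists>S. is_direct_sum K [X, Y] S"
  shows "semisimple_category K"
  unfolding semisimple_category_def abelian_category_def
  using linear assms has_kernel has_cokernel mono_is_kernel epi_is_cokernel
    summand_is_sum_of_simples[of X X "Ident K X" "Ident K X" for X]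
  by (intro conjI ballI allI impI) simp_all

end

section \<open>Additive and idempotent completion\<close>

lemma sum_only:
  assumes "finite A" "a \<in> A" "\<And>x. x \<in> A \<Longrightarrow> x \<noteq> a \<Longrightarrow> f x = 0"
  shows "sum f A = (f a :: 'a::comm_monoid_add)"
  using assms by (simp add: sum.remove[of A a])

lemma sum_fun_app: "(\<Sum>i\<in>I. f i) x = (\<Sum>i\<in>I. f i x :: 'a::comm_monoid_add)"
  by (induction I rule: infinite_finite_induct) simp_all

context lin_cat
begin

section \<open>Additive completion\<close>

lemma additive_Obj [simp]: "Xs \<in> Obj (additive_completion K) \<longleftrightarrow> set Xs \<subseteq> Obj K"
  by (auto simp: additive_completion_def)

lemma additive_Hom:
  "F \<in> Hom (additive_completion K) Xs Ys \<longleftrightarrow>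
    (\<forall>i j. i < length Ys \<longrightarrow> j < length Xs \<longrightarrow> F i j \<in> Hom K (Xs ! j) (Ys ! i)) \<and>
    (\<forall>i j. \<not> (i < length Ys \<and> j < length Xs) \<longrightarrow> F i j = 0)"
  by (auto simp: additive_completion_def)

lemma additive_Comp:
  "Comp (additive_completion K) Xs Ys Zs G F i j = (if i < length Zs \<and> j < length Xs
    then \<Sum>k<length Ys. Comp K (Xs ! j) (Ys ! k) (Zs ! i) (G i k) (F k j) else 0)"
  by (simp add: additive_completion_def)

lemma additive_Ident:
  "Ident (additive_completion K) Xs i j = (if i = j \<and> i < length Xs then Ident K (Xs ! i) else 0)"
  by (simp add: additive_completion_def)

lemma additive_Scale: "Scale (additive_completion K) a F i j = Scale K a (F i j)"
  by (simp add: additive_completion_def)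

lemma linear_additive_completion: "linear_category (additive_completion K)"
  unfolding linear_category_def
proof (intro conjI ballI allI)
  let ?A = "additive_completion K"
  show V: "vector_space (Scale ?A)"
    by unfold_locales (auto simp: fun_eq_iff additive_Scale vs.scale_right_distrib vs.scale_left_distrib)
  interpret A: vector_space "Scale ?A" by (rule V)
  fix Xs Ys assume "Xs \<in> Obj ?A" "Ys \<in> Obj ?A"
  then have Xs [simp]: "i < length Xs \<Longrightarrow> Xs ! i \<in> Obj K"
    and Ys [simp]: "i < length Ys \<Longrightarrow> Ys ! i \<in> Obj K" for i by auto
  show "A.subspace (Hom ?A Xs Ys)"
    unfolding A.subspace_def by (auto simp: additive_Hom additive_Scale)
  show "Ident ?A Xs \<in> Hom ?A Xs Xs" by (auto simp: additive_Hom additive_Ident)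
  {
    fix F assume F: "F \<in> Hom ?A Xs Ys"
    then have [simp]: "i < length Ys \<Longrightarrow> j < length Xs \<Longrightarrow> F i j \<in> Hom K (Xs ! j) (Ys ! i)"
      and F0: "\<not> (i < length Ys \<and> j < length Xs) \<Longrightarrow> F i j = 0" for i j
      by (auto simp: additive_Hom)
    show "Comp ?A Xs Ys Ys (Ident ?A Ys) F = F"
    proof (intro ext)
      fix i j show "Comp ?A Xs Ys Ys (Ident ?A Ys) F i j = F i j"
      proof (cases "i < length Ys \<and> j < length Xs")
        case True
        then have "(\<Sum>k<length Ys. Comp K (Xs ! j) (Ys ! k) (Ys ! i) (Ident ?A Ys i k) (F k j))
          = Comp K (Xs ! j) (Ys ! i) (Ys ! i) (Ident ?A Ys i i) (F i j)"
          by (intro sum_only) (auto simp: additive_Ident)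
        with True show ?thesis by (simp add: additive_Comp additive_Ident)
      qed (use F0 in \<open>auto simp: additive_Comp\<close>)
    qed
    show "Comp ?A Xs Xs Ys F (Ident ?A Xs) = F"
    proof (intro ext)
      fix i j show "Comp ?A Xs Xs Ys F (Ident ?A Xs) i j = F i j"
      proof (cases "i < length Ys \<and> j < length Xs")
        case True
        then have "(\<Sum>k<length Xs. Comp K (Xs ! j) (Xs ! k) (Ys ! i) (F i k) (Ident ?A Xs k j))
          = Comp K (Xs ! j) (Xs ! j) (Ys ! i) (F i j) (Ident ?A Xs j j)"
          by (intro sum_only) (auto simp: additive_Ident)
        with True show ?thesis by (simp add: additive_Comp additive_Ident)
      qed (use F0 in \<open>auto simp: additive_Comp\<close>)
    qed
  }
  fix Zs assume "Zs \<in> Obj ?A"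
  then have Zs [simp]: "i < length Zs \<Longrightarrow> Zs ! i \<in> Obj K" for i by auto
  {
    fix F G assume "F \<in> Hom ?A Xs Ys" "G \<in> Hom ?A Ys Zs"
    then show "Comp ?A Xs Ys Zs G F \<in> Hom ?A Xs Zs"
      by (auto simp: additive_Hom additive_Comp intro!: Hom_sum)
  }
  {
    fix F F' G G' a
    assume F: "F \<in> Hom ?A Xs Ys" "F' \<in> Hom ?A Xs Ys" and G: "G \<in> Hom ?A Ys Zs" "G' \<in> Hom ?A Ys Zs"
    have [simp]: "i < length Ys \<Longrightarrow> j < length Xs \<Longrightarrow> F i j \<in> Hom K (Xs ! j) (Ys ! i)"
        "i < length Ys \<Longrightarrow> j < length Xs \<Longrightarrow> F' i j \<in> Hom K (Xs ! j) (Ys ! i)"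
        "i < length Zs \<Longrightarrow> j < length Ys \<Longrightarrow> G i j \<in> Hom K (Ys ! j) (Zs ! i)"
        "i < length Zs \<Longrightarrow> j < length Ys \<Longrightarrow> G' i j \<in> Hom K (Ys ! j) (Zs ! i)" for i j
      using F G by (auto simp: additive_Hom)
    show "Comp ?A Xs Ys Zs G (F + F') = Comp ?A Xs Ys Zs G F + Comp ?A Xs Ys Zs G F'"
      by (auto simp: fun_eq_iff additive_Comp Comp_add_right simp flip: sum.distrib)
    show "Comp ?A Xs Ys Zs (G + G') F = Comp ?A Xs Ys Zs G F + Comp ?A Xs Ys Zs G' F"
      by (auto simp: fun_eq_iff additive_Comp Comp_add_left simp flip: sum.distrib)
    show "Comp ?A Xs Ys Zs G (Scale ?A a F) = Scale ?A a (Comp ?A Xs Ys Zs G F)"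
      by (auto simp: fun_eq_iff additive_Comp additive_Scale Comp_scale_right vs.scale_sum_right)
    show "Comp ?A Xs Ys Zs (Scale ?A a G) F = Scale ?A a (Comp ?A Xs Ys Zs G F)"
      by (auto simp: fun_eq_iff additive_Comp additive_Scale Comp_scale_left vs.scale_sum_right)
  }
  fix Ws assume "Ws \<in> Obj ?A"
  then have Ws [simp]: "i < length Ws \<Longrightarrow> Ws ! i \<in> Obj K" for i by auto
  fix F G H assume F: "F \<in> Hom ?A Xs Ys" and G: "G \<in> Hom ?A Ys Zs" and H: "H \<in> Hom ?A Zs Ws"
  have [simp]: "i < length Ys \<Longrightarrow> j < length Xs \<Longrightarrow> F i j \<in> Hom K (Xs ! j) (Ys ! i)"
      "i < length Zs \<Longrightarrow> j < length Ys \<Longrightarrow> G i j \<in> Hom K (Ys ! j) (Zs ! i)"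
      "i < length Ws \<Longrightarrow> j < length Zs \<Longrightarrow> H i j \<in> Hom K (Zs ! j) (Ws ! i)" for i j
    using F G H by (auto simp: additive_Hom)
  have "(\<Sum>k<length Ys. Comp K (Xs ! j) (Ys ! k) (Ws ! i)
        (\<Sum>l<length Zs. Comp K (Ys ! k) (Zs ! l) (Ws ! i) (H i l) (G l k)) (F k j))
      = (\<Sum>l<length Zs. Comp K (Xs ! j) (Zs ! l) (Ws ! i) (H i l)
        (\<Sum>k<length Ys. Comp K (Xs ! j) (Ys ! k) (Zs ! l) (G l k) (F k j)))" (is "?L = ?R")
    if "i < length Ws" "j < length Xs" for i j
  proof -
    have "?L = (\<Sum>k<length Ys. \<Sum>l<length Zs. Comp K (Xs ! j) (Zs ! l) (Ws ! i) (H i l)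
        (Comp K (Xs ! j) (Ys ! k) (Zs ! l) (G l k) (F k j)))"
      using that by (simp add: Comp_sum_left Comp_assoc cong: sum.cong_simp)
    also have "\<dots> = ?R" using that by (subst sum.swap) (simp add: Comp_sum_right cong: sum.cong_simp)
    finally show ?thesis .
  qed
  then show "Comp ?A Xs Ys Ws (Comp ?A Ys Zs Ws H G) F = Comp ?A Xs Zs Ws H (Comp ?A Xs Ys Zs G F)"
    by (auto simp: fun_eq_iff additive_Comp)
qed

definition matrix_unit :: "nat \<Rightarrow> nat \<Rightarrow> 'm \<Rightarrow> nat \<Rightarrow> nat \<Rightarrow> 'm" where
  "matrix_unit i j f = (\<lambda>k l. if k = i \<and> l = j then f else 0)"

text \<open>If the entry \<open>u\<close> of \<open>U\<close> at \<open>(i,j)\<close> is nonzero,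
  choose \<open>h\<close> for \<open>u\<close> and let \<open>H\<close> have the single entry
  \<open>h\<close> at \<open>(j,i)\<close>. The entry of \<open>U H U\<close> at
  \<open>(i,j)\<close> is then \<open>u h u\<close>.\<close>

lemma semiprime_additive_completion:
  assumes "semiprime_category K"
  shows "semiprime_category (additive_completion K)"
  unfolding semiprime_category_def
proof (intro ballI impI)
  let ?A = "additive_completion K"
  fix Xs Ys U assume X: "Xs \<in> Obj ?A" "Ys \<in> Obj ?A" and U: "U \<in> Hom ?A Xs Ys" "U \<noteq> 0"
  obtain i j where U0: "U i j \<noteq> 0" using U(2) by (auto simp: fun_eq_iff)
  then have ij: "i < length Ys" "j < length Xs" using U(1) by (auto simp: additive_Hom)
  have O [simp]: "k < length Xs \<Longrightarrow> Xs ! k \<in> Obj K" "k < length Ys \<Longrightarrow> Ys ! k \<in> Obj K" for k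
    using X by auto
  have [simp]: "k < length Ys \<Longrightarrow> l < length Xs \<Longrightarrow> U k l \<in> Hom K (Xs ! l) (Ys ! k)" for k l
    using U by (auto simp: additive_Hom)
  obtain h where h: "h \<in> Hom K (Ys ! i) (Xs ! j)"
    "Comp K (Xs ! j) (Xs ! j) (Ys ! i) (U i j) (Comp K (Xs ! j) (Ys ! i) (Xs ! j) h (U i j)) \<noteq> 0"
    using assms ij U0 unfolding semiprime_category_def by (metis O additive_Hom U(1))
  let ?H = "matrix_unit j i h"
  have H: "?H \<in> Hom ?A Ys Xs" using h ij by (auto simp: additive_Hom matrix_unit_def)
  have HU: "Comp ?A Xs Ys Xs ?H U k j = (if k = j then Comp K (Xs ! j) (Ys ! i) (Xs ! j) h (U i j) else 0)"
    if "k < length Xs" for k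
  proof -
    have "(\<Sum>l<length Ys. Comp K (Xs ! j) (Ys ! l) (Xs ! k) (?H k l) (U l j))
        = Comp K (Xs ! j) (Ys ! i) (Xs ! k) (?H k i) (U i j)"
      using that ij by (intro sum_only) (auto simp: matrix_unit_def)
    then show ?thesis using that ij by (auto simp: additive_Comp matrix_unit_def)
  qed
  have "(\<Sum>k<length Xs. Comp K (Xs ! j) (Xs ! k) (Ys ! i) (U i k) (Comp ?A Xs Ys Xs ?H U k j))
      = Comp K (Xs ! j) (Xs ! j) (Ys ! i) (U i j) (Comp ?A Xs Ys Xs ?H U j j)"
    using ij by (intro sum_only) (auto simp: HU)
  then have "Comp ?A Xs Xs Ys U (Comp ?A Xs Ys Xs ?H U) i j \<noteq> 0"
    using ij h(2) by (simp add: additive_Comp[of Xs Xs] HU)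
  then show "\<exists>H\<in>Hom ?A Ys Xs. Comp ?A Xs Xs Ys U (Comp ?A Xs Ys Xs H U) \<noteq> 0"
    using H by (metis zero_fun_apply)
qed

lemma finite_dim_additive_completion:
  assumes "finite_dim_homs K"
  shows "finite_dim_homs (additive_completion K)"
  unfolding finite_dim_homs_def
proof (intro ballI)
  let ?A = "additive_completion K"
  interpret A: lin_cat ?A by (rule lin_cat.intro[OF linear_additive_completion])
  fix Xs Ys assume X: "Xs \<in> Obj ?A" "Ys \<in> Obj ?A"
  have O: "k < length Xs \<Longrightarrow> Xs ! k \<in> Obj K" "k < length Ys \<Longrightarrow> Ys ! k \<in> Obj K" for k
    using X by auto
  have "\<forall>i j. \<exists>B. i < length Ys \<longrightarrow> j < length Xs \<longrightarrow> finite B \<and> Hom K (Xs ! j) (Ys ! i) \<subseteq> vs.span B"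
    using assms O unfolding finite_dim_homs_def by blast
  then obtain B where B: "\<And>i j. i < length Ys \<Longrightarrow> j < length Xs \<Longrightarrow>
      finite (B i j) \<and> Hom K (Xs ! j) (Ys ! i) \<subseteq> vs.span (B i j)"
    by metis
  let ?B = "\<Union>i<length Ys. \<Union>j<length Xs. matrix_unit i j ` B i j"
  have unit: "matrix_unit i j f \<in> A.vs.span ?B"
    if ij: "i < length Ys" "j < length Xs" and "f \<in> vs.span (B i j)" for i j f
    using that(3)
  proof (induction f rule: vs.span_induct_alt)
    case base
    have eq: "matrix_unit i j 0 = 0" by (auto simp: matrix_unit_def fun_eq_iff)
    show ?case unfolding eq by (rule A.vs.span_zero)
  next
    case (step c x y)
    have "matrix_unit i j (Scale K c x + y) = Scale ?A c (matrix_unit i j x) + matrix_unit i j y"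
      by (auto simp: matrix_unit_def fun_eq_iff additive_Scale)
    moreover have "matrix_unit i j x \<in> ?B" using ij step by blast
    ultimately show ?case
      using step(2) by (simp only: A.vs.span_add[OF A.vs.span_scale[OF A.vs.span_base]])
  qed
  have "Hom ?A Xs Ys \<subseteq> A.vs.span ?B"
  proof
    fix F assume F: "F \<in> Hom ?A Xs Ys"
    have "F = (\<Sum>i<length Ys. \<Sum>j<length Xs. matrix_unit i j (F i j))"
    proof (intro ext)
      fix k l
      have "(\<Sum>i<length Ys. \<Sum>j<length Xs. matrix_unit i j (F i j)) k l
          = (\<Sum>i<length Ys. \<Sum>j<length Xs. matrix_unit i j (F i j) k l)"
        by (simp add: sum_fun_app)
      also have "\<dots> = (\<Sum>i<length Ys. if i = k then \<Sum>j<length Xs. if j = l then F i j else 0 else 0)"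
        by (intro sum.cong refl) (auto simp: matrix_unit_def intro!: sum.cong)
      also have "\<dots> = F k l" using F by (auto simp: additive_Hom)
      finally show "F k l = (\<Sum>i<length Ys. \<Sum>j<length Xs. matrix_unit i j (F i j)) k l" by simp
    qed
    also have "\<dots> \<in> A.vs.span ?B"
      using F B by (intro A.vs.span_sum unit) (auto simp: additive_Hom subset_iff)
    finally show "F \<in> A.vs.span ?B" .
  qed
  moreover have "finite ?B" using B by auto
  ultimately show "\<exists>B. finite B \<and> Hom ?A Xs Ys \<subseteq> A.vs.span B" by blast
qed

lemma additive_zero_object: "is_zero_object (additive_completion K) []"
proof -
  interpret A: lin_cat "additive_completion K" by (rule lin_cat.intro[OF linear_additive_completion])
  show ?thesis by (auto simp: A.is_zero_object_iff additive_Ident fun_eq_iff)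
qed

lemma additive_direct_sum:
  assumes X: "Xs \<in> Obj (additive_completion K)" and Y: "Ys \<in> Obj (additive_completion K)"
  shows "is_direct_sum (additive_completion K) [Xs, Ys] (Xs @ Ys)"
proof -
  let ?A = "additive_completion K"
  interpret A: lin_cat ?A by (rule lin_cat.intro[OF linear_additive_completion])
  let ?n = "length Xs" and ?S = "Xs @ Ys"
  have O [simp]: "k < length Xs \<Longrightarrow> Xs ! k \<in> Obj K" "k < length Ys \<Longrightarrow> Ys ! k \<in> Obj K" for k
    using X Y by auto
  \<comment> \<open>Padded identity matrices: \<open>a\<close> is both the inclusion of
    \<open>Xs\<close> and the projection onto it, while \<open>b\<close> and \<open>c\<close> are
    the inclusion and projection of \<open>Ys\<close>, offset by \<open>?n\<close>.\<close>
  define a where "a k l = (if k = l \<and> l < ?n then Ident K (Xs ! l) else 0)" for k l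
  define b where "b k l = (if k = ?n + l \<and> l < length Ys then Ident K (Ys ! l) else 0)" for k l
  define c where "c k l = (if l = ?n + k \<and> k < length Ys then Ident K (Ys ! k) else 0)" for k l
  have S: "?S \<in> Obj ?A" using X Y by simp
  have SO [simp]: "?S ! k \<in> Obj K" if "k < length ?S" for k using that by (auto simp: nth_append)
  have aH: "a \<in> Hom ?A Xs ?S" "a \<in> Hom ?A ?S Xs"
    by (auto simp: additive_Hom a_def nth_append)
  have bH: "b \<in> Hom ?A Ys ?S" and cH: "c \<in> Hom ?A ?S Ys"
    by (auto simp: additive_Hom b_def c_def nth_append)
  have aa: "Comp ?A Xs ?S Xs a a = Ident ?A Xs"
  proof (intro ext)
    fix i j
    have "(\<Sum>k<length ?S. Comp K (Xs ! j) (?S ! k) (Xs ! i) (a i k) (a k j))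
        = Comp K (Xs ! j) (?S ! i) (Xs ! i) (a i i) (a i j)" if "i < ?n" "j < ?n"
      using that by (intro sum_only) (auto simp: a_def nth_append)
    then show "Comp ?A Xs ?S Xs a a i j = Ident ?A Xs i j"
      by (auto simp: additive_Comp additive_Ident a_def nth_append)
  qed
  have cb: "Comp ?A Ys ?S Ys c b = Ident ?A Ys"
  proof (intro ext)
    fix i j
    have "(\<Sum>k<length ?S. Comp K (Ys ! j) (?S ! k) (Ys ! i) (c i k) (b k j))
        = Comp K (Ys ! j) (?S ! (?n + i)) (Ys ! i) (c i (?n + i)) (b (?n + i) j)"
      if "i < length Ys" "j < length Ys"
      using that by (intro sum_only) (auto simp: b_def c_def nth_append)
    then show "Comp ?A Ys ?S Ys c b i j = Ident ?A Ys i j"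
      by (auto simp: additive_Comp additive_Ident b_def c_def nth_append)
  qed
  have ab: "Comp ?A Ys ?S Xs a b = 0"
    by (auto simp: fun_eq_iff additive_Comp a_def b_def nth_append intro!: sum.neutral)
  have ca: "Comp ?A Xs ?S Ys c a = 0"
    by (auto simp: fun_eq_iff additive_Comp a_def c_def nth_append intro!: sum.neutral)
  have sum: "Comp ?A ?S Xs ?S a a + Comp ?A ?S Ys ?S b c = Ident ?A ?S"
  proof (intro ext)
    fix i j
    have 1: "(\<Sum>k<?n. Comp K (?S ! j) (Xs ! k) (?S ! i) (a i k) (a k j))
        = (if i = j \<and> i < ?n then Ident K (?S ! i) else 0)" if "i < length ?S" "j < length ?S"
    proof (cases "i < ?n")
      case True
      then have "(\<Sum>k<?n. Comp K (?S ! j) (Xs ! k) (?S ! i) (a i k) (a k j))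
        = Comp K (?S ! j) (Xs ! i) (?S ! i) (a i i) (a i j)"
        using that by (intro sum_only) (auto simp: a_def nth_append)
      then show ?thesis using True that by (auto simp: a_def nth_append)
    next
      case False
      then show ?thesis using that SO[of i] SO[of j] by (auto simp: a_def nth_append intro!: sum.neutral)
    qed
    have 2: "(\<Sum>k<length Ys. Comp K (?S ! j) (Ys ! k) (?S ! i) (b i k) (c k j))
        = (if i = j \<and> \<not> i < ?n then Ident K (?S ! i) else 0)" if "i < length ?S" "j < length ?S"
    proof (cases "i < ?n")
      case False
      then have "(\<Sum>k<length Ys. Comp K (?S ! j) (Ys ! k) (?S ! i) (b i k) (c k j))
        = Comp K (?S ! j) (Ys ! (i - ?n)) (?S ! i) (b i (i - ?n)) (c (i - ?n) j)"
        using that by (intro sum_only) (auto simp: b_def c_def nth_append)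
      then show ?thesis using False that by (auto simp: b_def c_def nth_append)
    next
      case True
      then show ?thesis using that SO[of i] SO[of j] by (auto simp: b_def c_def nth_append intro!: sum.neutral)
    qed
    show "(Comp ?A ?S Xs ?S a a + Comp ?A ?S Ys ?S b c) i j = Ident ?A ?S i j"
      using 1 2 by (auto simp: additive_Comp additive_Ident)
  qed
  show ?thesis
    using A.is_direct_sum_append[OF A.is_direct_sum_single[OF X] A.is_direct_sum_single[OF Y] S
      aH aa bH cH cb ab ca sum] by simp
qed

section \<open>Idempotent completion\<close>

lemma idempotent_Obj [simp]:
  "(X, e) \<in> Obj (idempotent_completion K) \<longleftrightarrow> X \<in> Obj K \<and> e \<in> Hom K X X \<and> Comp K X X X e e = e"
  by (simp add: idempotent_completion_def)

text \<open>By idempotency, \<open>e' f e = f\<close> amounts to two one-sided absorption laws,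
  which suit rewriting.\<close>

lemma idempotent_Hom:
  assumes "(X, e) \<in> Obj (idempotent_completion K)" "(Y, e') \<in> Obj (idempotent_completion K)"
  shows "f \<in> Hom (idempotent_completion K) (X, e) (Y, e') \<longleftrightarrow>
    f \<in> Hom K X Y \<and> Comp K X Y Y e' f = f \<and> Comp K X X Y f e = f"
proof -
  note [simp] = assms[unfolded idempotent_Obj]
  have "Comp K X Y Y e' f = f \<and> Comp K X X Y f e = f"
    if f: "f \<in> Hom K X Y" "Comp K X Y Y e' (Comp K X X Y f e) = f"
  proof
    have "Comp K X Y Y e' (Comp K X Y Y e' (Comp K X X Y f e)) = Comp K X Y Y e' (Comp K X X Y f e)"
      using f(1) by (simp flip: Comp_assoc)
    then show "Comp K X Y Y e' f = f" using f(2) by simp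
    have "Comp K X X Y (Comp K X Y Y e' (Comp K X X Y f e)) e = Comp K X Y Y e' (Comp K X X Y f e)"
      using f(1) by (simp add: Comp_assoc)
    then show "Comp K X X Y f e = f" using f(2) by simp
  qed
  then show ?thesis by (auto simp: idempotent_completion_def)
qed

lemma idempotent_Comp [simp]: "Comp (idempotent_completion K) (X, a) (Y, b) (Z, c) = Comp K X Y Z"
  and idempotent_Ident [simp]: "Ident (idempotent_completion K) (X, a) = a"
  and idempotent_Scale [simp]: "Scale (idempotent_completion K) = Scale K"
  by (simp_all add: idempotent_completion_def)

lemma linear_idempotent_completion: "linear_category (idempotent_completion K)"
  unfolding linear_category_def
proof (intro conjI ballI allI)
  let ?A = "idempotent_completion K"
  show "vector_space (Scale ?A)" using vs.vector_space_axioms by simp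
  fix X' Y' assume X': "X' \<in> Obj ?A" and Y': "Y' \<in> Obj ?A"
  obtain X x Y y where XY: "X' = (X, x)" "Y' = (Y, y)" by (cases X'; cases Y') auto
  note [simp] = XY X'[unfolded XY idempotent_Obj] Y'[unfolded XY idempotent_Obj]
  note H = idempotent_Hom[OF X'[unfolded XY] Y'[unfolded XY]]
  show "module.subspace (Scale ?A) (Hom ?A X' Y')"
    unfolding idempotent_Scale vs.subspace_def
    by (auto simp: H Comp_add_left Comp_add_right Comp_scale_left Comp_scale_right)
  show "Ident ?A X' \<in> Hom ?A X' X'" 
    using idempotent_Hom[OF X'[unfolded XY] X'[unfolded XY]] by simp
  {
    fix f assume "f \<in> Hom ?A X' Y'"
    then show "Comp ?A X' Y' Y' (Ident ?A Y') f = f" "Comp ?A X' X' Y' f (Ident ?A X') = f"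
      using H by auto
  }
  fix Z' assume Z': "Z' \<in> Obj ?A"
  obtain Z z where Z: "Z' = (Z, z)" by (cases Z') auto
  note [simp] = Z Z'[unfolded Z idempotent_Obj]
  note HYZ = idempotent_Hom[OF Y'[unfolded XY] Z'[unfolded Z]]
  note HXZ = idempotent_Hom[OF X'[unfolded XY] Z'[unfolded Z]]
  {
    fix f g assume "f \<in> Hom ?A X' Y'" "g \<in> Hom ?A Y' Z'"
    then have "f \<in> Hom K X Y" "Comp K X X Y f x = f" "g \<in> Hom K Y Z" "Comp K Y Z Z z g = g"
      using H HYZ by auto
    then show "Comp ?A X' Y' Z' g f \<in> Hom ?A X' Z'"
      by (simp add: HXZ Comp_assoc) (simp flip: Comp_assoc)
  }
  {
    fix f f' g g' a
    assume "f \<in> Hom ?A X' Y'" "f' \<in> Hom ?A X' Y'" "g \<in> Hom ?A Y' Z'" "g' \<in> Hom ?A Y' Z'"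
    then have [simp]: "f \<in> Hom K X Y" "f' \<in> Hom K X Y" "g \<in> Hom K Y Z" "g' \<in> Hom K Y Z"
      using H HYZ by auto
    show "Comp ?A X' Y' Z' g (f + f') = Comp ?A X' Y' Z' g f + Comp ?A X' Y' Z' g f'"
      "Comp ?A X' Y' Z' (g + g') f = Comp ?A X' Y' Z' g f + Comp ?A X' Y' Z' g' f"
      "Comp ?A X' Y' Z' g (Scale ?A a f) = Scale ?A a (Comp ?A X' Y' Z' g f)"
      "Comp ?A X' Y' Z' (Scale ?A a g) f = Scale ?A a (Comp ?A X' Y' Z' g f)"
      by (simp_all add: Comp_add_left Comp_add_right Comp_scale_left Comp_scale_right)
  }
  fix W' assume W': "W' \<in> Obj ?A"
  obtain W w where W: "W' = (W, w)" by (cases W') auto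
  note [simp] = W W'[unfolded W idempotent_Obj]
  fix f g h assume "f \<in> Hom ?A X' Y'" "g \<in> Hom ?A Y' Z'" "h \<in> Hom ?A Z' W'"
  then show "Comp ?A X' Y' W' (Comp ?A Y' Z' W' h g) f = Comp ?A X' Z' W' h (Comp ?A X' Y' Z' g f)"
    using H HYZ idempotent_Hom[OF Z'[unfolded Z] W'[unfolded W]] by (simp add: Comp_assoc)
qed

text \<open>A witness \<open>h\<close> for \<open>u\<close> in \<open>K\<close> is cut down to
  \<open>x h y\<close>. As \<open>u x = u\<close> and \<open>y u = u\<close>, this leaves
  \<open>u h u\<close> unchanged.\<close>

lemma semiprime_idempotent_completion:
  assumes "semiprime_category K"
  shows "semiprime_category (idempotent_completion K)"
  unfolding semiprime_category_def
proof (intro ballI impI)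
  let ?A = "idempotent_completion K"
  fix X' Y' u assume X': "X' \<in> Obj ?A" and Y': "Y' \<in> Obj ?A" and u': "u \<in> Hom ?A X' Y'" "u \<noteq> 0"
  obtain X x Y y where XY: "X' = (X, x)" "Y' = (Y, y)" by (cases X'; cases Y') auto
  note [simp] = XY X'[unfolded XY idempotent_Obj] Y'[unfolded XY idempotent_Obj]
  have u [simp]: "u \<in> Hom K X Y" "Comp K X Y Y y u = u" "Comp K X X Y u x = u"
    using u' idempotent_Hom[OF X'[unfolded XY] Y'[unfolded XY]] by auto
  have ux: "Comp K W X Y u (Comp K W X X x k) = Comp K W X Y u k" if "W \<in> Obj K" "k \<in> Hom K W X" for W k
    using that by (simp flip: Comp_assoc)
  obtain h where h [simp]: "h \<in> Hom K Y X" and h0: "Comp K X X Y u (Comp K X Y X h u) \<noteq> 0"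
    using assms u'(2) u(1) unfolding semiprime_category_def
    by (metis X'[unfolded XY idempotent_Obj] Y'[unfolded XY idempotent_Obj])
  let ?h = "Comp K Y X X x (Comp K Y Y X h y)"
  have "Comp K Y X X x ?h = ?h" by (simp flip: Comp_assoc)
  moreover have "Comp K Y Y X ?h y = ?h" by (simp add: Comp_assoc)
  ultimately have "?h \<in> Hom ?A Y' X'"
    using idempotent_Hom[OF Y'[unfolded XY] X'[unfolded XY]] by simp
  moreover have "Comp ?A X' X' Y' u (Comp ?A X' Y' X' ?h u) \<noteq> 0" using h0 by (simp add: Comp_assoc ux)
  ultimately show "\<exists>h\<in>Hom ?A Y' X'. Comp ?A X' X' Y' u (Comp ?A X' Y' X' h u) \<noteq> 0" by blast
qed

lemma finite_dim_idempotent_completion: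
  assumes "finite_dim_homs K"
  shows "finite_dim_homs (idempotent_completion K)"
  unfolding finite_dim_homs_def
proof (intro ballI)
  let ?A = "idempotent_completion K"
  fix X' Y' assume X': "X' \<in> Obj ?A" and Y': "Y' \<in> Obj ?A"
  obtain X x Y y where XY: "X' = (X, x)" "Y' = (Y, y)" by (cases X'; cases Y') auto
  have "Hom ?A X' Y' \<subseteq> Hom K X Y" using XY by (auto simp: idempotent_completion_def)
  moreover have "X \<in> Obj K" "Y \<in> Obj K" using X' Y' XY by auto
  ultimately show "\<exists>B. finite B \<and> Hom ?A X' Y' \<subseteq> module.span (Scale ?A) B"
    using assms unfolding finite_dim_homs_def idempotent_Scale by (meson subset_trans)
qed

text \<open>An idempotent \<open>e\<close> of \<open>(X, x)\<close> splits through
  \<open>(X, e)\<close>, with \<open>e\<close> itself as inclusion and as projection.\<close>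

lemma idempotent_splittings: "has_splittings (idempotent_completion K)"
  unfolding has_splittings_def
proof (intro ballI impI)
  let ?A = "idempotent_completion K"
  fix X' e assume X': "X' \<in> Obj ?A" and e': "e \<in> Hom ?A X' X'" "Comp ?A X' X' X' e e = e"
  obtain X x where X: "X' = (X, x)" by (cases X') auto
  note [simp] = X X'[unfolded X idempotent_Obj]
  have e [simp]: "e \<in> Hom K X X" "Comp K X X X x e = e" "Comp K X X X e x = e" "Comp K X X X e e = e"
    using e' idempotent_Hom[OF X'[unfolded X] X'[unfolded X]] by auto
  have E: "(X, e) \<in> Obj ?A" by simp
  show "\<exists>A\<in>Obj ?A. \<exists>i\<in>Hom ?A A X'. \<exists>p\<in>Hom ?A X' A. Comp ?A A X' A p i = Ident ?A A \<and> Comp ?A X' A X' i p = e"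
    using idempotent_Hom[OF X'[unfolded X] E] idempotent_Hom[OF E X'[unfolded X]]
    by (intro bexI[of _ "(X, e)"] bexI[of _ e] E) auto
qed

lemma idempotent_zero_object:
  assumes "is_zero_object K Z"
  shows "is_zero_object (idempotent_completion K) (Z, 0)"
proof -
  interpret A: lin_cat "idempotent_completion K" by (rule lin_cat.intro[OF linear_idempotent_completion])
  show ?thesis using assms unfolding A.is_zero_object_iff by (auto simp: is_zero_object_def)
qed

lemma idempotent_direct_sum:
  assumes X': "(X, x) \<in> Obj (idempotent_completion K)" and Y': "(Y, y) \<in> Obj (idempotent_completion K)"
    and S: "is_direct_sum K [X, Y] S"
  shows "\<exists>s. is_direct_sum (idempotent_completion K) [(X, x), (Y, y)] (S, s)"
proof -
  let ?A = "idempotent_completion K"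
  interpret A: lin_cat ?A by (rule lin_cat.intro[OF linear_idempotent_completion])
  obtain \<iota> \<pi> where "\<forall>i<2. \<iota> i \<in> Hom K ([X, Y] ! i) S \<and> \<pi> i \<in> Hom K S ([X, Y] ! i)"
    and "\<forall>i<2. \<forall>j<2. Comp K ([X, Y] ! j) S ([X, Y] ! i) (\<pi> i) (\<iota> j)
      = (if i = j then Ident K ([X, Y] ! i) else 0)"
    using S unfolding is_direct_sum_def by (auto simp: numeral_2_eq_2)
  then have 1 [simp]: "\<iota> 0 \<in> Hom K X S" "\<iota> 1 \<in> Hom K Y S" "\<pi> 0 \<in> Hom K S X" "\<pi> 1 \<in> Hom K S Y"
    "Comp K X S X (\<pi> 0) (\<iota> 0) = Ident K X" "Comp K Y S X (\<pi> 0) (\<iota> 1) = 0"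
    "Comp K X S Y (\<pi> 1) (\<iota> 0) = 0" "Comp K Y S Y (\<pi> 1) (\<iota> 1) = Ident K Y"
    by (auto simp: numeral_2_eq_2 All_less_Suc)
  note [simp del] = One_nat_def
  note [simp] = X'[unfolded idempotent_Obj] Y'[unfolded idempotent_Obj]
  have [simp]: "S \<in> Obj K" using S by (simp add: is_direct_sum_def)
  have pre: "Comp K W S X (\<pi> 0) (Comp K W X S (\<iota> 0) h) = h" "Comp K W S Y (\<pi> 1) (Comp K W X S (\<iota> 0) h) = 0"
    if "W \<in> Obj K" "h \<in> Hom K W X" for W h using that by (simp_all flip: Comp_assoc)
  have pre': "Comp K W S X (\<pi> 0) (Comp K W Y S (\<iota> 1) h) = 0" "Comp K W S Y (\<pi> 1) (Comp K W Y S (\<iota> 1) h) = h"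
    if "W \<in> Obj K" "h \<in> Hom K W Y" for W h using that by (simp_all flip: Comp_assoc)
  have xx: "Comp K W X X x (Comp K W X X x h) = Comp K W X X x h" if "W \<in> Obj K" "h \<in> Hom K W X" for W h
    using that by (simp flip: Comp_assoc)
  have yy: "Comp K W Y Y y (Comp K W Y Y y h) = Comp K W Y Y y h" if "W \<in> Obj K" "h \<in> Hom K W Y" for W h
    using that by (simp flip: Comp_assoc)
  let ?i = "Comp K X X S (\<iota> 0) x" and ?p = "Comp K S X X x (\<pi> 0)"
  let ?j = "Comp K Y Y S (\<iota> 1) y" and ?q = "Comp K S Y Y y (\<pi> 1)"
  \<comment> \<open>The block diagonal idempotent of \<open>S\<close> with blocks \<open>x\<close>
    and \<open>y\<close>.\<close>
  let ?s = "Comp K S X S ?i ?p + Comp K S Y S ?j ?q"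
  note rules = Comp_assoc pre pre' xx yy Comp_add_left Comp_add_right
  have S': "(S, ?s) \<in> Obj ?A" by (simp add: rules)
  note H = idempotent_Hom[OF X' S'] idempotent_Hom[OF S' X'] idempotent_Hom[OF Y' S'] idempotent_Hom[OF S' Y']
  have i: "?i \<in> Hom ?A (X, x) (S, ?s)" and p: "?p \<in> Hom ?A (S, ?s) (X, x)"
    and j: "?j \<in> Hom ?A (Y, y) (S, ?s)" and q: "?q \<in> Hom ?A (S, ?s) (Y, y)"
    unfolding H by (simp_all add: rules)
  have "is_direct_sum ?A ([(X, x)] @ [(Y, y)]) (S, ?s)"
    by (rule A.is_direct_sum_append[OF A.is_direct_sum_single[OF X'] A.is_direct_sum_single[OF Y'] S'
          i p _ j q]) (simp_all add: rules)
  then show ?thesis by auto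
qed

end

theorem semisimple_karoubi_envelope:
  assumes "linear_category K" "finite_dim_homs K" "semiprime_category K"
  shows "semisimple_category (karoubi_envelope K)"
proof -
  interpret K: lin_cat K by (rule lin_cat.intro[OF assms(1)])
  let ?A = "additive_completion K"
  interpret A: lin_cat ?A by (rule lin_cat.intro[OF K.linear_additive_completion])
  interpret E: split_semiprime_cat "idempotent_completion ?A"
    by unfold_locales (use assms K.finite_dim_additive_completion K.semiprime_additive_completion
      A.linear_idempotent_completion A.finite_dim_idempotent_completion
      A.semiprime_idempotent_completion A.idempotent_splittings in auto)
  show ?thesis unfolding karoubi_envelope_def
  proof (rule E.semisimple)
    show "\<exists>Z. is_zero_object (idempotent_completion ?A) Z"
      using A.idempotent_zero_object[OF K.additive_zero_object] by blast
    show "\<forall>X\<in>Obj (idempotent_completion ?A). \<forall>Y\<in>Obj (idempotent_completion ?A).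
        \<exists>S. is_direct_sum (idempotent_completion ?A) [X, Y] S"
    proof (intro ballI)
      fix X Y assume X: "X \<in> Obj (idempotent_completion ?A)" and Y: "Y \<in> Obj (idempotent_completion ?A)"
      obtain Xs x Ys y where XY: "X = (Xs, x)" "Y = (Ys, y)" by (cases X; cases Y) auto
      show "\<exists>S. is_direct_sum (idempotent_completion ?A) [X, Y] S"
        using A.idempotent_direct_sum[OF _ _ K.additive_direct_sum, of Xs x Ys y] X Y XY by auto
    qed
  qed
qed

section \<open>Colourings of partitions\<close>

fun pt_colour :: "(nat \<Rightarrow> nat) \<Rightarrow> (nat \<Rightarrow> nat) \<Rightarrow> point \<Rightarrow> nat" where
  "pt_colour x y (Upper i) = x i"
| "pt_colour x y (Lower j) = y j"

definition compatible :: "parti \<Rightarrow> (nat \<Rightarrow> nat) \<Rightarrow> (nat \<Rightarrow> nat) \<Rightarrow> bool" where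
  "compatible p x y \<longleftrightarrow> (\<forall>b\<in>p. \<forall>a\<in>b. \<forall>a'\<in>b. pt_colour x y a = pt_colour x y a')"

text \<open>The matrix of the linear map \<open>T\<^sub>p : (\<complex>\<^sup>n)\<^sup>\<otimes>\<^sup>k \<rightarrow> (\<complex>\<^sup>n)\<^sup>\<otimes>\<^sup>l\<close> attached to \<open>p \<in> P(k,l)\<close>.\<close>

definition tensor_entry :: "parti \<Rightarrow> (nat \<Rightarrow> nat) \<Rightarrow> (nat \<Rightarrow> nat) \<Rightarrow> real" where
  "tensor_entry p x y = of_bool (compatible p x y)"

abbreviation colourings :: "nat \<Rightarrow> nat \<Rightarrow> (nat \<Rightarrow> nat) set" where
  "colourings n k \<equiv> {1..k} \<rightarrow>\<^sub>E {..<n}"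

lemma finite_colourings [simp]: "finite ({a..b::nat} \<rightarrow>\<^sub>E {..<n::nat})"
  by (simp add: finite_PiE)

fun stack_colour :: "(nat \<Rightarrow> nat) \<Rightarrow> (nat \<Rightarrow> nat) \<Rightarrow> (nat \<Rightarrow> nat) \<Rightarrow> stack_point \<Rightarrow> nat" where
  "stack_colour x y z (Outer a) = pt_colour x z a"
| "stack_colour x y z (Middle j) = y j"

lemma stack_colour_above: "stack_colour x y z (stack_above a) = pt_colour x y a"
  by (cases a) auto

lemma stack_colour_below: "stack_colour x y z (stack_below a) = pt_colour y z a"
  by (cases a) auto

section \<open>Counting the colourings of a stack\<close>

lemma points_iff [simp]:
  "Upper i \<in> points k l \<longleftrightarrow> i \<in> {1..k}" "Lower j \<in> points k l \<longleftrightarrow> j \<in> {1..l}"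
  by (auto simp: points_def)

lemma finite_points: "finite (points k l)"
  by (simp add: points_def)

lemma finite_partitions: "finite (partitions k l)"
proof (rule finite_subset)
  show "partitions k l \<subseteq> Pow (Pow (points k l))"
    by (auto simp: partitions_def partition_on_def)
qed (simp add: finite_points)

text \<open>A middle colouring is compatible with both partitions exactly if the colouring of the
  whole stack is constant on connected components. A component with outer points has its colour
  forced by \<open>x\<close> and \<open>z\<close>, consistently if and only if
  \<open>pcomp q p\<close> is compatible with them; each component inside the middle row has a free
  colour, which gives the factor \<open>n ^ loops q p\<close>.\<close>

lemma card_compatible_stack:
  assumes p: "p \<in> partitions k l" and q: "q \<in> partitions l m"
    and x: "x \<in> colourings n k" and z: "z \<in> colourings n m"
  shows "card {y \<in> colourings n l. compatible p x y \<and> compatible q y z}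
    = (if compatible (pcomp q p) x z then n ^ loops q p else 0)"
proof -
  let ?S = "{y \<in> colourings n l. compatible p x y \<and> compatible q y z}"
  let ?B = "stack_blocks q p"
  let ?U = "\<Union>?B" and ?E = "(\<Union>b\<in>?B. b \<times> b)\<^sup>+"
  let ?C = "stack_components q p"
  let ?M = "{c \<in> ?C. c \<subseteq> range Middle}"
  have pU: "\<Union>p = points k l" and qU: "\<Union>q = points l m"
    using p q by (auto simp: partitions_def partition_on_def)
  have U: "?U = stack_above ` points k l \<union> stack_below ` points l m"
    by (auto simp: stack_blocks_def simp flip: pU qU)
  have middle: "Middle j \<in> ?U \<longleftrightarrow> j \<in> {1..l}" for j
    unfolding U points_def by (auto simp: image_Un image_image)
  have outer: "Outer a \<in> ?U \<longleftrightarrow> a \<in> points k m" for a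
    unfolding U points_def by (cases a) (auto simp: image_Un image_image)
  have equiv: "equiv ?U ?E"
  proof (rule equivI)
    let ?R = "\<Union>b\<in>?B. b \<times> b"
    have "?R \<subseteq> ?U \<times> ?U" by blast
    then show "?E \<subseteq> ?U \<times> ?U" by (rule trancl_subset_Sigma)
    show "refl_on ?U ?E" by (rule refl_onI) (blast intro: r_into_trancl)
    show "sym ?E" by (rule sym_trancl) (auto simp: sym_def)
    show "trans ?E" by (rule trans_trancl)
  qed
  have C: "?C = ?U // ?E" by (simp add: stack_components_def)
  have disj: "c = c'" if "c \<in> ?C" "c' \<in> ?C" "w \<in> c" "w \<in> c'" for c c' w
    using quotient_disj[OF equiv] that unfolding C by blast
  have cls: "?E `` {w} \<in> ?C" "w \<in> ?E `` {w}" if "w \<in> ?U" for w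
    using that equiv_class_self[OF equiv that] unfolding C by (auto intro: quotientI)
  have subU: "c \<subseteq> ?U" if "c \<in> ?C" for c
    using that in_quotient_imp_subset[OF equiv] unfolding C by blast
  have nonempty: "c \<noteq> {}" if "c \<in> ?C" for c
    using that in_quotient_imp_non_empty[OF equiv] unfolding C by blast
  \<comment> \<open>The components are the classes of the equivalence relation generated by the
    blocks, so constancy on the blocks propagates to them.\<close>
  have blocks: "(\<forall>b\<in>?B. \<forall>w\<in>b. \<forall>w'\<in>b. f w = f w') \<longleftrightarrow> (\<forall>c\<in>?C. \<forall>w\<in>c. \<forall>w'\<in>c. f w = f w')"
    for f :: "stack_point \<Rightarrow> nat"
  proof
    assume *: "\<forall>b\<in>?B. \<forall>w\<in>b. \<forall>w'\<in>b. f w = f w'"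
    have E: "f w = f w'" if "(w, w') \<in> ?E" for w w'
      using that
    proof (induction rule: trancl_induct)
      case (base w')
      then show ?case using * by blast
    next
      case (step w' w'')
      then have "f w' = f w''" using * by blast
      then show ?case using step.IH by simp
    qed
    show "\<forall>c\<in>?C. \<forall>w\<in>c. \<forall>w'\<in>c. f w = f w'"
      using E in_quotient_imp_in_rel[OF equiv] unfolding C by blast
  next
    assume *: "\<forall>c\<in>?C. \<forall>w\<in>c. \<forall>w'\<in>c. f w = f w'"
    show "\<forall>b\<in>?B. \<forall>w\<in>b. \<forall>w'\<in>b. f w = f w'"
    proof (intro ballI)
      fix b w w' assume b: "b \<in> ?B" "w \<in> b" "w' \<in> b"
      then have "w' \<in> ?E `` {w}" by blast
      then show "f w = f w'" using * cls[of w] b by blast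
    qed
  qed
  have S: "compatible p x y \<and> compatible q y z \<longleftrightarrow>
      (\<forall>c\<in>?C. \<forall>w\<in>c. \<forall>w'\<in>c. stack_colour x y z w = stack_colour x y z w')" for y
    unfolding blocks[symmetric] compatible_def stack_blocks_def
    by (simp add: ball_Un stack_colour_above stack_colour_below)
  have pc: "compatible (pcomp q p) x z \<longleftrightarrow>
      (\<forall>c\<in>?C. \<forall>a a'. Outer a \<in> c \<longrightarrow> Outer a' \<in> c \<longrightarrow> pt_colour x z a = pt_colour x z a')"
  proof -
    have "compatible (pcomp q p) x z \<longleftrightarrow>
      (\<forall>c\<in>?C. \<forall>a\<in>Outer -` c. \<forall>a'\<in>Outer -` c. pt_colour x z a = pt_colour x z a')"
    proof
      assume comp: "compatible (pcomp q p) x z"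
      show "\<forall>c\<in>?C. \<forall>a\<in>Outer -` c. \<forall>a'\<in>Outer -` c. pt_colour x z a = pt_colour x z a'"
      proof (intro ballI)
        fix c a a' assume c: "c \<in> ?C" "a \<in> Outer -` c" "a' \<in> Outer -` c"
        then have "Outer -` c \<in> pcomp q p" unfolding pcomp_def by auto
        with comp have "\<forall>a\<in>Outer -` c. \<forall>a'\<in>Outer -` c. pt_colour x z a = pt_colour x z a'"
          unfolding compatible_def by (rule bspec)
        then show "pt_colour x z a = pt_colour x z a'" using c(2,3) by (meson bspec)
      qed
    next
      assume *: "\<forall>c\<in>?C. \<forall>a\<in>Outer -` c. \<forall>a'\<in>Outer -` c. pt_colour x z a = pt_colour x z a'"
      show "compatible (pcomp q p) x z" unfolding compatible_def
      proof
        fix b assume "b \<in> pcomp q p"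
        then obtain c where c: "c \<in> ?C" and b: "b = Outer -` c" unfolding pcomp_def by auto
        show "\<forall>a\<in>b. \<forall>a'\<in>b. pt_colour x z a = pt_colour x z a'"
          unfolding b by (rule bspec[OF * c])
      qed
    qed
    then show ?thesis by (simp add: Ball_def)
  qed
  show ?thesis
  proof (cases "compatible (pcomp q p) x z")
    case False
    have "\<not> (compatible p x y \<and> compatible q y z)" for y
      using False unfolding S pc by (metis stack_colour.simps(1))
    then show ?thesis using False by simp
  next
    case True
    \<comment> \<open>A representative of each component, taken among the outer points unless the
      component lies in the middle row.\<close>
    define r where "r c = (if c \<in> ?M then SOME w. w \<in> c else SOME w. w \<in> c \<and> w \<notin> range Middle)" for c
    have r: "r c \<in> c" if "c \<in> ?C" for c
      using that nonempty[OF that] unfolding r_def by (auto intro: someI2 simp: some_in_eq)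
    have rout: "\<exists>a. r c = Outer a" if "c \<in> ?C" "c \<notin> ?M" for c
    proof -
      have "\<exists>w. w \<in> c \<and> w \<notin> range Middle" using that by blast
      moreover have "r c = (SOME w. w \<in> c \<and> w \<notin> range Middle)"
        unfolding r_def by (rule if_not_P[OF that(2)])
      ultimately have "r c \<notin> range Middle" by (metis (mono_tags, lifting) someI_ex)
      then show ?thesis by (cases "r c") auto
    qed
    \<comment> \<open>The forced colour of a component with outer points. Its representative is
      outer, so the middle colouring \<open>undefined\<close> is never consulted there.\<close>
    define val where "val c = stack_colour x undefined z (r c)" for c
    define cm where "cm j = ?E `` {Middle j}" for j
    have cm: "cm j \<in> ?C" "Middle j \<in> cm j" if "j \<in> {1..l}" for j
      unfolding cm_def using cls[OF middle[THEN iffD2, OF that]] by simp_all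
    have cm_eq: "cm j = c" if "c \<in> ?C" "Middle j \<in> c" for c j
    proof -
      have "j \<in> {1..l}" using subsetD[OF subU[OF that(1)] that(2)] middle[of j] by simp
      then show ?thesis using disj[OF cm(1) that(1) cm(2) that(2)] by simp
    qed
    \<comment> \<open>\<open>\<phi>\<close> reads off the free colours of the components in the
      middle row, and \<open>\<psi>\<close> rebuilds the middle colouring from these and the forced
      colours.\<close>
    define \<phi> where "\<phi> y = restrict (\<lambda>c. stack_colour x y z (r c)) ?M" for y
    define \<psi> where "\<psi> g = restrict (\<lambda>j. if cm j \<in> ?M then g (cm j) else val (cm j)) {1..l}" for g
    have \<psi>: "\<psi> g j = (if cm j \<in> ?M then g (cm j) else val (cm j))" if "j \<in> {1..l}" for g j
      using that by (simp add: \<psi>_def)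
    have colour_bound: "pt_colour x z a < n" if "a \<in> points k m" for a
      using x z that by (cases a) (auto simp: PiE_iff)
    have val: "val c = stack_colour x y z (r c)" if "c \<in> ?C" "c \<notin> ?M" for c y
      using rout[OF that] by (auto simp: val_def)
    have const: "stack_colour x (\<psi> g) z w = (if c \<in> ?M then g c else val c)"
      if c: "c \<in> ?C" "w \<in> c" for g c w
    proof (cases w)
      case (Middle j)
      then have "j \<in> {1..l}" "cm j = c" using c subU middle cm_eq by blast+
      then show ?thesis using Middle by (auto simp: \<psi>_def)
    next
      case (Outer a)
      then have cM: "c \<notin> ?M" using c by auto
      then obtain a' where "r c = Outer a'" using rout c by blast
      then have "val c = pt_colour x z a" 
        using True r[OF c(1)] c Outer unfolding pc val_def by (metis stack_colour.simps(1))
      then show ?thesis using Outer cM by auto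
    qed
    have "bij_betw \<phi> ?S (?M \<rightarrow>\<^sub>E {..<n})"
    proof (rule bij_betw_byWitness[where f' = \<psi>])
      show "\<forall>y\<in>?S. \<psi> (\<phi> y) = y"
      proof
        fix y assume y: "y \<in> ?S"
        show "\<psi> (\<phi> y) = y"
        proof
          fix j
          show "\<psi> (\<phi> y) j = y j"
          proof (cases "j \<in> {1..l}")
            case True
            have "stack_colour x y z (r (cm j)) = stack_colour x y z (Middle j)"
              using y cm[OF True] r unfolding mem_Collect_eq S by blast
            moreover have "\<psi> (\<phi> y) j = stack_colour x y z (r (cm j))"
            proof (cases "cm j \<in> ?M")
              case in_M: True
              then have "\<psi> (\<phi> y) j = \<phi> y (cm j)" unfolding \<psi>[OF True] by (rule if_P)
              also have "\<dots> = stack_colour x y z (r (cm j))" using in_M by (simp add: \<phi>_def)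
              finally show ?thesis .
            next
              case False
              then have "\<psi> (\<phi> y) j = val (cm j)" unfolding \<psi>[OF True] by (rule if_not_P)
              then show ?thesis using val[OF cm(1)[OF True] False] by simp
            qed
            ultimately show ?thesis by simp
          next
            case False
            then have "y j = undefined" using y by (auto simp: PiE_iff extensional_def)
            then show ?thesis using False by (auto simp: \<psi>_def)
          qed
        qed
      qed
      show "\<forall>g\<in>?M \<rightarrow>\<^sub>E {..<n}. \<phi> (\<psi> g) = g"
      proof
        fix g assume g: "g \<in> ?M \<rightarrow>\<^sub>E {..<n}"
        show "\<phi> (\<psi> g) = g"
        proof
          fix c show "\<phi> (\<psi> g) c = g c"
            using const[of c "r c" g] r[of c] g by (auto simp: \<phi>_def PiE_iff extensional_def)
        qed
      qed
      show "\<phi> ` ?S \<subseteq> ?M \<rightarrow>\<^sub>E {..<n}"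
      proof (rule image_subsetI)
        fix y assume y: "y \<in> ?S"
        have "stack_colour x y z (r c) < n" if c: "c \<in> ?M" for c
        proof -
          obtain j where j: "r c = Middle j" using c r by blast
          then have "j \<in> {1..l}" using c r[of c] subU[of c] middle[of j] by auto
          then show ?thesis using y j by (auto simp: PiE_iff)
        qed
        then show "\<phi> y \<in> ?M \<rightarrow>\<^sub>E {..<n}" by (auto simp: \<phi>_def)
      qed
      show "\<psi> ` (?M \<rightarrow>\<^sub>E {..<n}) \<subseteq> ?S"
      proof (rule image_subsetI)
        fix g assume g: "g \<in> ?M \<rightarrow>\<^sub>E {..<n}"
        have "val c < n" if c: "c \<in> ?C" "c \<notin> ?M" for c
        proof -
          obtain a where a: "r c = Outer a" using rout[OF c] by blast
          then have "a \<in> points k m" using r[OF c(1)] subU[OF c(1)] outer[of a] by auto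
          then show ?thesis using a colour_bound by (simp add: val_def)
        qed
        then have "\<psi> g \<in> colourings n l" using g cm by (auto simp: \<psi>_def PiE_iff)
        then show "\<psi> g \<in> ?S" unfolding mem_Collect_eq S using const by simp
      qed
    qed
    then have "card ?S = card (?M \<rightarrow>\<^sub>E {..<n})" by (rule bij_betw_same_card)
    also have "\<dots> = n ^ card ?M"
    proof -
      have "finite ?U" unfolding U by (simp add: finite_points)
      then have "finite ?C" unfolding C quotient_def by (rule finite_UN_I) simp
      then show ?thesis by (simp add: card_PiE)
    qed
    finally show ?thesis using True by (simp add: loops_def)
  qed
qed

text \<open>Matrix multiplication realizes the composition rule of \<open>Rep0\<close> at
  \<open>t = n\<close>. The first argument of an entry indexes the source, so the factor for
  \<open>p\<close> stands on the left.\<close>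

lemma tensor_entry_pcomp:
  assumes "p \<in> partitions k l" "q \<in> partitions l m" "x \<in> colourings n k" "z \<in> colourings n m"
  shows "(\<Sum>y\<in>colourings n l. tensor_entry p x y * tensor_entry q y z)
    = real n ^ loops q p * tensor_entry (pcomp q p) x z"
proof -
  have "(\<Sum>y\<in>colourings n l. tensor_entry p x y * tensor_entry q y z)
    = real (card {y \<in> colourings n l. compatible p x y \<and> compatible q y z})"
    by (simp add: tensor_entry_def sum_of_bool_eq Int_def flip: of_bool_conj)
  then show ?thesis unfolding card_compatible_stack[OF assms] by (simp add: tensor_entry_def)
qed

text \<open>Involution is transposition of real matrices, the source of all positivity at
  \<open>t = n\<close>.\<close>

lemma tensor_entry_invol: "tensor_entry (invol p) y x = tensor_entry p x y"
proof -
  have "pt_colour y x (flip a) = pt_colour x y a" for a by (cases a) auto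
  then show ?thesis by (simp add: tensor_entry_def compatible_def invol_def)
qed

section \<open>Independence of the matrices and the laws of composition\<close>

lemma id_parti_image: "id_parti k = (\<lambda>i. {Upper i, Lower i}) ` {1..k}"
  by (auto simp: id_parti_def)

lemma tensor_entry_id:
  assumes "x \<in> colourings n k" "y \<in> colourings n k"
  shows "tensor_entry (id_parti k) x y = of_bool (x = y)"
proof -
  have "compatible (id_parti k) x y \<longleftrightarrow> (\<forall>i\<in>{1..k}. x i = y i)"
    by (auto simp: compatible_def id_parti_image)
  also have "\<dots> \<longleftrightarrow> x = y" using assms by (auto intro: PiE_ext)
  finally show ?thesis by (simp add: tensor_entry_def)
qed

lemma id_parti_partition: "id_parti k \<in> partitions k k"
  unfolding partitions_def mem_Collect_eq
  by (rule partition_onI) (auto simp: id_parti_image points_def disjnt_def)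

text \<open>Sending each block of the refinement \<open>q\<close> to the block of \<open>p\<close>
  around it is surjective. If \<open>q\<close> has no more blocks than \<open>p\<close>, this map is
  also injective, so every block of \<open>p\<close> is filled by a single block of
  \<open>q\<close>.\<close>

lemma refinement_eq:
  assumes p: "partition_on A p" and q: "partition_on A q" and A: "finite A"
    and ref: "\<forall>b\<in>q. \<exists>c\<in>p. b \<subseteq> c" and card: "card q \<le> card p"
  shows "q = p"
proof -
  obtain f where f: "\<And>b. b \<in> q \<Longrightarrow> f b \<in> p \<and> b \<subseteq> f b" using ref by metis
  have fin: "finite p" "finite q" using p q A finite_elements by blast+
  have f_eq: "f b = c" if "b \<in> q" "c \<in> p" "a \<in> b" "a \<in> c" for a b c
    using f[OF that(1)] partition_onD2[OF p] that by (auto simp: disjoint_def)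
  have cover: "\<exists>b\<in>q. a \<in> b" if "c \<in> p" "a \<in> c" for a c
    using that partition_onD1[OF p] partition_onD1[OF q] by blast
  have surj: "f ` q = p"
  proof
    show "f ` q \<subseteq> p" using f by blast
    show "p \<subseteq> f ` q"
    proof
      fix c assume c: "c \<in> p"
      then obtain a where "a \<in> c" using partition_onD3[OF p] by (metis ex_in_conv)
      with cover[OF c] f_eq[OF _ c] show "c \<in> f ` q" by blast
    qed
  qed
  have "card q = card (f ` q)" using surj card card_image_le[OF fin(2), of f] by simp
  then have inj: "inj_on f q" using fin(2) by (simp add: eq_card_imp_inj_on)
  have "f b = b" if b: "b \<in> q" for b
  proof
    show "b \<subseteq> f b" using f b by blast
    show "f b \<subseteq> b"
    proof
      fix a assume a: "a \<in> f b"
      obtain b' where b': "b' \<in> q" "a \<in> b'" using cover a f[OF b] by blast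
      then have "f b' = f b" using f_eq a f[OF b] by blast
      then show "a \<in> b" using inj b b' by (auto dest: inj_onD)
    qed
  qed
  then have "f ` q = q" by simp
  then show ?thesis using surj by simp
qed

text \<open>A colouring whose colour classes are exactly the blocks of \<open>p\<close> is compatible only with the
  refinements of \<open>p\<close>, so the family \<open>T\<^sub>p\<close> is triangular.\<close>

lemma tensor_entry_independent:
  assumes P: "P \<subseteq> partitions k l" and n: "\<forall>p\<in>P. card p \<le> n"
    and zero: "\<And>x y. x \<in> colourings n k \<Longrightarrow> y \<in> colourings n l \<Longrightarrow> (\<Sum>p\<in>P. u p * tensor_entry p x y) = 0"
    and "p \<in> P"
  shows "u p = 0"
proof (rule ccontr)
  assume "u p \<noteq> 0"
  let ?A = "{p \<in> P. u p \<noteq> 0}"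
  have finP: "finite P" using P finite_partitions by (rule finite_subset)
  have A: "finite ?A" "?A \<noteq> {}" using finP assms(4) \<open>u p \<noteq> 0\<close> by auto
  \<comment> \<open>A partition in the support of \<open>u\<close> with the most blocks: a proper
    refinement of it has more blocks and so lies outside the support.\<close>
  obtain p0 where p0: "p0 \<in> ?A" "\<And>q. q \<in> ?A \<Longrightarrow> card q \<le> card p0"
  proof -
    have "Max (card ` ?A) \<in> card ` ?A" using A by (intro Max_in) auto
    then obtain p0 where "p0 \<in> ?A" "card p0 = Max (card ` ?A)" by auto
    moreover have "card q \<le> Max (card ` ?A)" if "q \<in> ?A" for q using A that by (intro Max_ge) auto
    ultimately show ?thesis using that by simp
  qed
  have part: "partition_on (points k l) q" if "q \<in> P" for q
    using that P by (auto simp: partitions_def)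
  have p0P: "p0 \<in> P" using p0 by simp
  note part0 = part[OF p0P]
  have "finite p0" using part0 finite_points finite_elements by blast
  \<comment> \<open>As \<open>n\<close> is at least the number of blocks, distinct blocks can
    receive distinct colours.\<close>
  then obtain h where h: "inj_on h p0" "h ` p0 \<subseteq> {..<n}"
    using n p0P inj_on_iff_card_le[of p0 "{..<n}"] by auto
  define colour where "colour a = h (THE b. b \<in> p0 \<and> a \<in> b)" for a
  have colour: "colour a = h b" if "b \<in> p0" "a \<in> b" for a b
  proof -
    have "(THE b. b \<in> p0 \<and> a \<in> b) = b"
      using that partition_onD2[OF part0] by (intro the_equality) (auto simp: disjoint_def)
    then show ?thesis by (simp add: colour_def)
  qed
  have cover: "\<exists>b\<in>p0. a \<in> b" if "a \<in> points k l" for a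
    using that partition_onD1[OF part0] by blast
  define x where "x = restrict (\<lambda>i. colour (Upper i)) {1..k}"
  define y where "y = restrict (\<lambda>i. colour (Lower i)) {1..l}"
  have bound: "colour a < n" if "a \<in> points k l" for a
    using cover[OF that] colour h by fastforce
  have xy: "x \<in> colourings n k" "y \<in> colourings n l"
    by (auto simp: x_def y_def intro!: bound)
  have pt: "pt_colour x y a = colour a" if "a \<in> points k l" for a
    using that by (cases a) (auto simp: x_def y_def)
  have "u q * tensor_entry q x y = 0" if q: "q \<in> P" "q \<noteq> p0" for q
  proof (rule ccontr)
    assume "u q * tensor_entry q x y \<noteq> 0"
    then have uq: "u q \<noteq> 0" and comp: "compatible q x y" by (auto simp: tensor_entry_def)
    have sub: "a \<in> points k l" if "b \<in> q" "a \<in> b" for a b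
      using that partition_onD1[OF part[OF q(1)]] by blast
    have "\<exists>c\<in>p0. b \<subseteq> c" if b: "b \<in> q" for b
    proof -
      obtain a where a: "a \<in> b" using b partition_onD3[OF part[OF q(1)]] by (metis ex_in_conv)
      obtain c where c: "c \<in> p0" "a \<in> c" using cover sub a b by blast
      have "a' \<in> c" if a': "a' \<in> b" for a'
      proof -
        obtain c' where c': "c' \<in> p0" "a' \<in> c'" using cover sub a' b by blast
        have "colour a = colour a'" using comp a a' b pt sub unfolding compatible_def by metis
        then have "h c = h c'" using colour c c' by simp
        then show ?thesis using h(1) c c' by (auto dest: inj_onD)
      qed
      then show ?thesis using c by blast
    qed
    then have "q = p0"
      using refinement_eq[OF part0 part[OF q(1)] finite_points] p0(2) q uq by simp
    then show False using q by simp
  qed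
  then have "(\<Sum>q\<in>P. u q * tensor_entry q x y) = u p0 * tensor_entry p0 x y"
    using finP p0P by (intro sum_only)
  moreover have "compatible p0 x y" unfolding compatible_def
  proof (intro ballI)
    fix b a a' assume b: "b \<in> p0" "a \<in> b" "a' \<in> b"
    then have "a \<in> points k l" "a' \<in> points k l" using partition_onD1[OF part0] by blast+
    then show "pt_colour x y a = pt_colour x y a'" using pt colour[OF b(1)] b by simp
  qed
  ultimately show False using zero[OF xy] p0(1) by (simp add: tensor_entry_def)
qed

text \<open>This transfers identities from matrices, known for all \<open>n\<close>, to partitions
  and loop numbers. Distinct partitions would contradict independence; a constant colouring,
  compatible with every partition, then compares the powers of \<open>n\<close>.\<close>

lemma partition_eqI:
  assumes p: "p \<in> partitions k l" and q: "q \<in> partitions k l"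
    and eq: "\<And>n x y. x \<in> colourings n k \<Longrightarrow> y \<in> colourings n l \<Longrightarrow>
      real n ^ a * tensor_entry p x y = real n ^ b * tensor_entry q x y"
  shows "p = q \<and> a = b"
proof
  \<comment> \<open>Large enough for the independence of both matrices, and at least 2 so that
    exponents can be compared.\<close>
  define n where "n = card p + card q + 2"
  show pq: "p = q"
  proof (rule ccontr)
    assume "p \<noteq> q"
    let ?u = "\<lambda>r. if r = p then real n ^ a else - (real n ^ b)"
    have "?u p = 0"
    proof (rule tensor_entry_independent[where u = ?u and P = "{p, q}" and n = n])
      fix x y assume "x \<in> colourings n k" "y \<in> colourings n l"
      then show "(\<Sum>r\<in>{p, q}. ?u r * tensor_entry r x y) = 0" using \<open>p \<noteq> q\<close> eq by simp
    qed (use p q in \<open>auto simp: n_def\<close>)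
    then show False by (simp add: n_def)
  qed
  let ?x = "restrict (\<lambda>_. 0) {1..k}" and ?y = "restrict (\<lambda>_. 0) {1..l}"
  have "pt_colour ?x ?y c = 0" if "c \<in> points k l" for c
    using that by (cases c) auto
  moreover have "c \<in> points k l" if "b \<in> p" "c \<in> b" for b c
    using p that unfolding partitions_def partition_on_def by blast
  ultimately have "compatible p ?x ?y" unfolding compatible_def by metis
  then have "real n ^ a = real n ^ b"
    using eq[of ?x n ?y] pq by (auto simp: tensor_entry_def n_def)
  then show "a = b" by (simp add: n_def)
qed

text \<open>Both bracketings give the same triple matrix product for every \<open>n\<close>.
  Comparing the powers of \<open>n\<close> yields the loop identity together with associativity,
  with no path chasing in a three-storey stack. That the composites are partitions will come from
  the closure of \<open>C\<close>.\<close>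

lemma pcomp_assoc:
  assumes p: "p \<in> partitions k l" and q: "q \<in> partitions l m" and r: "r \<in> partitions m j"
    and qp: "pcomp q p \<in> partitions k m" and rq: "pcomp r q \<in> partitions l j"
    and parts: "pcomp r (pcomp q p) \<in> partitions k j" "pcomp (pcomp r q) p \<in> partitions k j"
  shows "pcomp r (pcomp q p) = pcomp (pcomp r q) p"
    and "loops q p + loops r (pcomp q p) = loops r q + loops (pcomp r q) p"
proof -
  have "pcomp r (pcomp q p) = pcomp (pcomp r q) p \<and>
    loops q p + loops r (pcomp q p) = loops r q + loops (pcomp r q) p"
  proof (rule partition_eqI[OF parts])
    fix n x w assume xw: "x \<in> colourings n k" "w \<in> colourings n j"
    have "real n ^ (loops q p + loops r (pcomp q p)) * tensor_entry (pcomp r (pcomp q p)) x w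
      = real n ^ loops q p * (\<Sum>z\<in>colourings n m. tensor_entry (pcomp q p) x z * tensor_entry r z w)"
      using tensor_entry_pcomp[OF qp r xw] by (simp add: power_add)
    also have "\<dots> = (\<Sum>z\<in>colourings n m. (\<Sum>y\<in>colourings n l. tensor_entry p x y * tensor_entry q y z) * tensor_entry r z w)"
      using tensor_entry_pcomp[OF p q xw(1)] by (simp add: sum_distrib_left mult.assoc)
    also have "\<dots> = (\<Sum>y\<in>colourings n l. tensor_entry p x y * (\<Sum>z\<in>colourings n m. tensor_entry q y z * tensor_entry r z w))"
      by (simp add: sum_distrib_left sum_distrib_right mult.assoc) (rule sum.swap)
    also have "\<dots> = real n ^ loops r q * (\<Sum>y\<in>colourings n l. tensor_entry p x y * tensor_entry (pcomp r q) y w)"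
      using tensor_entry_pcomp[OF q r _ xw(2)] by (simp add: sum_distrib_left mult_ac)
    also have "\<dots> = real n ^ (loops r q + loops (pcomp r q) p) * tensor_entry (pcomp (pcomp r q) p) x w"
      using tensor_entry_pcomp[OF p rq xw] by (simp add: power_add)
    finally show "real n ^ (loops q p + loops r (pcomp q p)) * tensor_entry (pcomp r (pcomp q p)) x w
      = real n ^ (loops r q + loops (pcomp r q) p) * tensor_entry (pcomp (pcomp r q) p) x w" .
  qed
  then show "pcomp r (pcomp q p) = pcomp (pcomp r q) p"
    and "loops q p + loops r (pcomp q p) = loops r q + loops (pcomp r q) p" by auto
qed

lemma pcomp_id:
  assumes p: "p \<in> partitions k l"
  shows "pcomp (id_parti l) p \<in> partitions k l \<Longrightarrow> pcomp (id_parti l) p = p \<and> loops (id_parti l) p = 0"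
    and "pcomp p (id_parti k) \<in> partitions k l \<Longrightarrow> pcomp p (id_parti k) = p \<and> loops p (id_parti k) = 0"
proof -
  assume a: "pcomp (id_parti l) p \<in> partitions k l"
  show "pcomp (id_parti l) p = p \<and> loops (id_parti l) p = 0"
  proof (rule partition_eqI[OF a p])
    fix n x y assume xy: "x \<in> colourings n k" "y \<in> colourings n l"
    have "(\<Sum>z\<in>colourings n l. tensor_entry p x z * tensor_entry (id_parti l) z y)
      = (\<Sum>z\<in>colourings n l. if z = y then tensor_entry p x z else 0)"
      by (rule sum.cong) (auto simp: tensor_entry_id[OF _ xy(2)])
    then show "real n ^ loops (id_parti l) p * tensor_entry (pcomp (id_parti l) p) x y
        = real n ^ 0 * tensor_entry p x y"
      using tensor_entry_pcomp[OF p id_parti_partition xy] xy by simp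
  qed
next
  assume a: "pcomp p (id_parti k) \<in> partitions k l"
  show "pcomp p (id_parti k) = p \<and> loops p (id_parti k) = 0"
  proof (rule partition_eqI[OF a p])
    fix n x y assume xy: "x \<in> colourings n k" "y \<in> colourings n l"
    have "(\<Sum>z\<in>colourings n k. tensor_entry (id_parti k) x z * tensor_entry p z y)
      = (\<Sum>z\<in>colourings n k. if z = x then tensor_entry p z y else 0)"
      by (rule sum.cong) (auto simp: tensor_entry_id[OF xy(1)])
    then show "real n ^ loops p (id_parti k) * tensor_entry (pcomp p (id_parti k)) x y
        = real n ^ 0 * tensor_entry p x y"
      using tensor_entry_pcomp[OF id_parti_partition p xy] xy by simp
  qed
qed

lemma id_parti_in_category:
  assumes "category_of_partitions C"
  shows "id_parti k \<in> C k k"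
proof (induction k)
  case 0
  \<comment> \<open>The axioms do not list the empty partition. The pair partition composed with its
    involution lies in \<open>C 0 0\<close>, and the empty partition is the only one of no
    points.\<close>
  let ?cap = "{{Upper 1, Upper 2}} :: parti"
  have "?cap \<in> C 2 0" "invol ?cap \<in> C 0 2"
    using assms unfolding category_of_partitions_def by blast+
  then have "pcomp ?cap (invol ?cap) \<in> C 0 0" "C 0 0 \<subseteq> partitions 0 0"
    using assms unfolding category_of_partitions_def by blast+
  moreover have "partitions 0 0 = {{}}" by (auto simp: partitions_def points_def partition_on_def)
  ultimately show ?case by (auto simp: id_parti_def)
next
  case (Suc k)
  have "tensor k k (id_parti k) {{Upper 1, Lower 1}} \<in> C (k + 1) (k + 1)"
    using assms Suc unfolding category_of_partitions_def by blast
  moreover have "tensor k k (id_parti k) {{Upper 1, Lower 1}} = id_parti (Suc k)"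
    by (auto simp: tensor_def id_parti_def atLeastAtMostSuc_conv)
  ultimately show ?case by simp
qed

section \<open>Trace forms\<close>

lemma sum_swap3: "(\<Sum>x\<in>X. \<Sum>y\<in>Y. \<Sum>p\<in>P. f x y p) = (\<Sum>p\<in>P. \<Sum>x\<in>X. \<Sum>y\<in>Y. f x y p)"
proof -
  have "(\<Sum>x\<in>X. \<Sum>y\<in>Y. \<Sum>p\<in>P. f x y p) = (\<Sum>x\<in>X. \<Sum>p\<in>P. \<Sum>y\<in>Y. f x y p)"
    by (rule sum.cong[OF refl], rule sum.swap)
  also have "\<dots> = (\<Sum>p\<in>P. \<Sum>x\<in>X. \<Sum>y\<in>Y. f x y p)" by (rule sum.swap)
  finally show ?thesis .
qed

lemma sum_swap4:
  "(\<Sum>x\<in>X. \<Sum>y\<in>Y. \<Sum>p\<in>P. \<Sum>q\<in>Q. f x y p q) = (\<Sum>p\<in>P. \<Sum>q\<in>Q. \<Sum>x\<in>X. \<Sum>y\<in>Y. f x y p q)"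
  unfolding sum_swap3[where P = P] sum_swap3[where P = Q] ..

section \<open>Linear algebra: traces, determinants and Gram-Schmidt\<close>

lemma trace_mult_commute_aux:
  "(\<Sum>i\<in>I. \<Sum>j\<in>J. f i j * g j i) = (\<Sum>j\<in>J. \<Sum>i\<in>I. g j i * f i j :: 'a::comm_semiring_0)"
  by (rule trans[OF sum.swap]) (intro sum.cong refl mult.commute)

lemma trace_mult_commute:
  assumes "A \<in> carrier_mat n m" "B \<in> carrier_mat m n"
  shows "(\<Sum>i<n. (A * B) $$ (i, i)) = (\<Sum>j<m. (B * A) $$ (j, j) :: 'a::comm_semiring_0)"
  using assms by (simp add: scalar_prod_def atLeast0LessThan) (rule trace_mult_commute_aux)

text \<open>By Schur decomposition \<open>A\<close> is similar to an upper triangular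
  \<open>B\<close>, and \<open>B * B = 0\<close>. The diagonal of \<open>B * B\<close> consists of
  the squares of the diagonal entries of \<open>B\<close>, so these vanish, and the trace is
  invariant under similarity.\<close>

lemma square_zero_trace_mat:
  fixes A :: "complex mat"
  assumes A: "A \<in> carrier_mat n n" and sq: "A * A = 0\<^sub>m n n"
  shows "(\<Sum>i<n. A $$ (i, i)) = 0"
proof -
  obtain es where "char_poly A = (\<Prod>a\<leftarrow>es. [:- a, 1:])" using char_poly_factorized[OF A] by blast
  then obtain B where B: "B \<in> carrier_mat n n" "upper_triangular B" "similar_mat A B"
    using schur_decomposition_exists[OF A] by blast
  then obtain P Q where "similar_mat_wit A B P Q" unfolding similar_mat_def by blast
  then have PQ: "P \<in> carrier_mat n n" "Q \<in> carrier_mat n n" "P * Q = 1\<^sub>m n" "Q * P = 1\<^sub>m n" "A = P * B * Q"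
    using A unfolding similar_mat_wit_def by (auto simp: Let_def)
  note C = A B(1) PQ(1,2)
  have "Q * A * P = Q * (P * B * Q) * P" using PQ(5) by simp
  also have "\<dots> = (Q * P) * B * (Q * P)" using C by (simp add: assoc_mult_mat[of _ n n _ n _ n])
  finally have QAP: "Q * A * P = B" using C PQ by simp
  have "B * B = Q * A * (P * Q) * A * P" 
    unfolding QAP[symmetric] using C by (simp add: assoc_mult_mat[of _ n n _ n _ n])
  also have "\<dots> = Q * (A * A) * P" using C PQ by (simp add: assoc_mult_mat[of _ n n _ n _ n])
  finally have BB: "B * B = 0\<^sub>m n n" using C sq by simp
  have diag: "B $$ (i, i) = 0" if i: "i < n" for i
  proof -
    have "0 = (B * B) $$ (i, i)" using BB i by simp
    also have "\<dots> = (\<Sum>k<n. B $$ (i, k) * B $$ (k, i))"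
      using B(1) i by (simp add: scalar_prod_def atLeast0LessThan)
    also have "\<dots> = B $$ (i, i) * B $$ (i, i)"
    proof (rule sum_only)
      fix k assume "k \<in> {..<n}" "k \<noteq> i"
      then consider "k < i" | "i < k" "k < n" by force
      then show "B $$ (i, k) * B $$ (k, i) = 0"
        by cases (use B i in \<open>auto simp: upper_triangular_def\<close>)
    qed (use i in auto)
    finally show ?thesis by simp
  qed
  have "(\<Sum>i<n. A $$ (i, i)) = (\<Sum>i<n. (Q * (P * B)) $$ (i, i))"
    unfolding PQ(5) using C by (intro trace_mult_commute) auto
  also have "Q * (P * B) = Q * P * B" using C by (simp add: assoc_mult_mat[of _ n n _ n _ n])
  also have "\<dots> = B" using C PQ by simp
  finally show ?thesis using diag by simp
qed

lemma square_zero_trace: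
  fixes N :: "'p \<Rightarrow> 'p \<Rightarrow> complex"
  assumes P: "finite P" and sq: "\<And>i j. i \<in> P \<Longrightarrow> j \<in> P \<Longrightarrow> (\<Sum>k\<in>P. N i k * N k j) = 0"
  shows "(\<Sum>i\<in>P. N i i) = 0"
proof -
  define d where "d = card P"
  obtain f where f: "bij_betw f {..<d} P"
    using ex_bij_betw_nat_finite[OF P] by (auto simp: d_def atLeast0LessThan)
  have f_in: "f i \<in> P" if "i < d" for i using f that by (auto simp: bij_betw_def)
  define A where "A = mat d d (\<lambda>(i, j). N (f i) (f j))"
  have A: "A \<in> carrier_mat d d" by (simp add: A_def)
  have "A * A = 0\<^sub>m d d"
  proof (rule eq_matI)
    fix i j assume "i < dim_row (0\<^sub>m d d :: complex mat)" "j < dim_col (0\<^sub>m d d :: complex mat)"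
    then have ij: "i < d" "j < d" by auto
    then have "(A * A) $$ (i, j) = (\<Sum>k<d. N (f i) (f k) * N (f k) (f j))"
      by (simp add: A_def scalar_prod_def atLeast0LessThan)
    also have "\<dots> = (\<Sum>k\<in>P. N (f i) k * N k (f j))" by (rule sum.reindex_bij_betw[OF f])
    finally show "(A * A) $$ (i, j) = 0\<^sub>m d d $$ (i, j)" using sq f_in ij by simp
  qed (simp_all add: A_def)
  then have "0 = (\<Sum>i<d. A $$ (i, i))" using square_zero_trace_mat[OF A] by simp
  also have "\<dots> = (\<Sum>i<d. N (f i) (f i))" by (simp add: A_def)
  also have "\<dots> = (\<Sum>i\<in>P. N i i)" by (rule sum.reindex_bij_betw[OF f])
  finally show ?thesis by simp
qed

text \<open>A ring homomorphism commutes with \<open>det\<close>, so nondegeneracy after applying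
  \<open>h\<close> is read off from one determinant formed beforehand. The indices are swapped in
  the matrix because \<open>u\<close> enters through the first argument of \<open>b\<close>.\<close>

lemma nonsingular_iff_det:
  fixes h :: "'a::comm_ring_1 \<Rightarrow> 'b::field"
  assumes h: "comm_ring_hom h" and f: "bij_betw f {..<d} P"
  shows "(\<forall>u. (\<forall>r\<in>P. (\<Sum>q\<in>P. u q * h (b q r)) = 0) \<longrightarrow> (\<forall>q\<in>P. u q = 0)) \<longleftrightarrow>
    h (det (mat d d (\<lambda>(i, j). b (f j) (f i)))) \<noteq> 0"
proof -
  define M where "M = mat d d (\<lambda>(i, j). h (b (f j) (f i)))"
  have M: "M \<in> carrier_mat d d" by (simp add: M_def)
  have f_in: "f i \<in> P" if "i < d" for i using f that by (auto simp: bij_betw_def)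
  define f' where "f' = the_inv_into {..<d} f"
  have f': "f' q < d" "f (f' q) = q" if "q \<in> P" for q
    using f that f_the_inv_into_f_bij_betw[OF f] the_inv_into_into[of f "{..<d}" q "{..<d}"]
    by (auto simp: f'_def bij_betw_def)
  have f'f: "f' (f i) = i" if "i < d" for i
    using f that by (simp add: f'_def bij_betw_def the_inv_into_f_f)
  have "M = map_mat h (mat d d (\<lambda>(i, j). b (f j) (f i)))" by (auto simp: M_def)
  then have "h (det (mat d d (\<lambda>(i, j). b (f j) (f i)))) = det M"
    using comm_ring_hom.hom_det[OF h] by metis
  also have "det M = 0 \<longleftrightarrow> (\<exists>v. v \<in> carrier_vec d \<and> v \<noteq> 0\<^sub>v d \<and> M *\<^sub>v v = 0\<^sub>v d)"
    by (rule det_0_iff_vec_prod_zero[OF M])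
  also have "\<dots> \<longleftrightarrow> (\<exists>u. (\<forall>r\<in>P. (\<Sum>q\<in>P. u q * h (b q r)) = 0) \<and> (\<exists>q\<in>P. u q \<noteq> 0))"
  proof (intro iffI; elim exE conjE)
    fix v assume v: "v \<in> carrier_vec d" "v \<noteq> 0\<^sub>v d" "M *\<^sub>v v = 0\<^sub>v d"
    define u where "u q = v $ f' q" for q
    have "(\<Sum>q\<in>P. u q * h (b q r)) = 0" if r: "r \<in> P" for r
    proof -
      have "(\<Sum>q\<in>P. u q * h (b q r)) = (\<Sum>i<d. u (f i) * h (b (f i) r))"
        by (rule sum.reindex_bij_betw[OF f, symmetric])
      also have "\<dots> = (\<Sum>i<d. M $$ (f' r, i) * v $ i)"
        using f'[OF r] f'f by (intro sum.cong) (auto simp: M_def u_def)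
      also have "\<dots> = (M *\<^sub>v v) $ f' r"
        using M v(1) f'[OF r] by (simp add: scalar_prod_def atLeast0LessThan)
      finally show ?thesis using v(3) f'[OF r] by simp
    qed
    moreover obtain i where "i < d" "v $ i \<noteq> 0" using v(1,2) by (metis carrier_vecD dim_vec eq_vecI index_zero_vec)
    then have "f i \<in> P" "u (f i) \<noteq> 0" using f_in f'f by (auto simp: u_def)
    ultimately show "\<exists>u. (\<forall>r\<in>P. (\<Sum>q\<in>P. u q * h (b q r)) = 0) \<and> (\<exists>q\<in>P. u q \<noteq> 0)" by blast
  next
    fix u assume u: "\<forall>r\<in>P. (\<Sum>q\<in>P. u q * h (b q r)) = 0" "\<exists>q\<in>P. u q \<noteq> 0"
    define v where "v = vec d (\<lambda>i. u (f i))"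
    have "M *\<^sub>v v = 0\<^sub>v d"
    proof (rule eq_vecI)
      fix i assume "i < dim_vec (0\<^sub>v d :: 'b vec)"
      then have i: "i < d" by simp
      then have "(M *\<^sub>v v) $ i = (\<Sum>j<d. u (f j) * h (b (f j) (f i)))"
        by (simp add: M_def v_def scalar_prod_def atLeast0LessThan mult.commute)
      also have "\<dots> = (\<Sum>q\<in>P. u q * h (b q (f i)))" by (rule sum.reindex_bij_betw[OF f])
      finally show "(M *\<^sub>v v) $ i = 0\<^sub>v d $ i" using u(1) f_in i by simp
    qed (simp add: M_def)
    moreover obtain q where "q \<in> P" "u q \<noteq> 0" using u(2) by blast
    then have "v $ f' q \<noteq> 0\<^sub>v d $ f' q" using f' by (simp add: v_def)
    then have "v \<noteq> 0\<^sub>v d" by metis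
    ultimately show "\<exists>v. v \<in> carrier_vec d \<and> v \<noteq> 0\<^sub>v d \<and> M *\<^sub>v v = 0\<^sub>v d"
      by (intro exI[of _ v]) (simp add: v_def)
  qed
  finally show ?thesis by blast
qed

text \<open>The evaluations at \<open>n\<close> and at \<open>t\<close> land in different fields,
  the reals and the complex numbers. The determinant over the integer polynomials is the object that
  maps to both.\<close>

lemma nonsingular_at_transcendental:
  fixes b :: "'p \<Rightarrow> 'p \<Rightarrow> int poly" and n :: int and t :: complex
  assumes P: "finite P"
    and n: "\<forall>u::'p \<Rightarrow> real. (\<forall>r\<in>P. (\<Sum>q\<in>P. u q * of_int (poly (b q r) n)) = 0) \<longrightarrow> (\<forall>q\<in>P. u q = 0)"
    and t: "\<not> algebraic t"
    and u: "\<forall>r\<in>P. (\<Sum>q\<in>P. u q * poly (of_int_poly (b q r)) t) = 0"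
    and q: "q \<in> P"
  shows "u q = 0"
proof -
  obtain f where f: "bij_betw f {..<card P} P"
    using ex_bij_betw_nat_finite[OF P] by (auto simp: atLeast0LessThan)
  define D where "D = det (mat (card P) (card P) (\<lambda>(i, j). b (f j) (f i)))"
  have h1: "comm_ring_hom (\<lambda>p. real_of_int (poly p n))"
    by unfold_locales auto
  have h2: "comm_ring_hom (\<lambda>p. poly (of_int_poly p) t)"
    by unfold_locales (auto simp: of_int_poly_hom.hom_add of_int_poly_hom.hom_mult)
  have "D \<noteq> 0" using n nonsingular_iff_det[OF h1 f, of b] by (auto simp: D_def)
  then have "poly (of_int_poly D) t \<noteq> 0" using t algebraicI[of "of_int_poly D" t] by auto
  then show ?thesis using nonsingular_iff_det[OF h2 f, of b] u q unfolding D_def by blast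
qed

text \<open>The \<open>e i\<close> are the Gram-Schmidt basis; \<open>w\<close> below is the component of the new vector orthogonal to
  the old ones.\<close>

lemma inverse_gram_sum_of_squares:
  fixes G :: "'p \<Rightarrow> 'p \<Rightarrow> real"
  assumes "finite P" and "\<And>p q. G p q = G q p"
    and "\<And>u. (\<Sum>p\<in>P. \<Sum>q\<in>P. u p * u q * G p q) \<le> 0 \<Longrightarrow> \<forall>p\<in>P. u p = 0"
  shows "\<exists>e. \<forall>p\<in>P. \<forall>p'\<in>P. (\<Sum>i\<in>P. e i p * (\<Sum>q\<in>P. e i q * G p' q)) = of_bool (p = p')"
  using assms(1,3)
proof (induction P rule: finite_induct)
  case empty
  then show ?case by simp
next
  case (insert a P)
  note [simp] = insert.hyps
  have "\<forall>p\<in>P. u p = 0" if "(\<Sum>p\<in>P. \<Sum>q\<in>P. u p * u q * G p q) \<le> 0" for u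
  proof -
    let ?u = "u(a := 0)"
    have eq: "(\<Sum>p\<in>P. \<Sum>q\<in>P. ?u p * ?u q * G p q) = (\<Sum>p\<in>P. \<Sum>q\<in>P. u p * u q * G p q)"
      using insert.hyps by (intro sum.cong) auto
    have "(\<Sum>p\<in>insert a P. \<Sum>q\<in>insert a P. ?u p * ?u q * G p q) \<le> 0"
      using that eq by simp
    from insert.prems[OF this] have "?u p = 0" if "p \<in> P" for p using that by blast
    moreover have "?u p = u p" if "p \<in> P" for p using that insert.hyps(2) by auto
    ultimately show ?thesis by simp
  qed
  then obtain e where e: "\<And>p p'. p \<in> P \<Longrightarrow> p' \<in> P \<Longrightarrow>
      (\<Sum>i\<in>P. e i p * (\<Sum>q\<in>P. e i q * G p' q)) = of_bool (p = p')"
    using insert.IH by blast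
  \<comment> \<open>With \<open>G\<close> as inner product, \<open>B i p\<close> is the product of
    \<open>e i\<close> with the basis vector \<open>p\<close>; likewise \<open>L p\<close> below is
    the product of \<open>w\<close> with \<open>p\<close>.\<close>
  define B where "B i p = (\<Sum>q\<in>P. e i q * G p q)" for i p
  define w where "w p = (if p = a then 1 else - (\<Sum>i\<in>P. B i a * e i p))" for p
  define L where "L p = (\<Sum>q\<in>insert a P. w q * G p q)" for p
  have eB: "(\<Sum>i\<in>P. e i p * B i p') = of_bool (p = p')" if "p \<in> P" "p' \<in> P" for p p'
    using e[OF that] by (simp add: B_def)
  have L: "L p = G p a - (\<Sum>i\<in>P. B i a * B i p)" for p
  proof -
    have "(\<Sum>q\<in>P. w q * G p q) = (\<Sum>q\<in>P. \<Sum>i\<in>P. - (B i a * e i q * G p q))"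
      using insert.hyps(2) by (intro sum.cong) (auto simp: w_def sum_distrib_right sum_negf)
    also have "\<dots> = - (\<Sum>i\<in>P. B i a * B i p)"
      by (subst sum.swap) (simp add: B_def sum_distrib_left sum_negf mult.assoc)
    finally show ?thesis by (simp add: L_def w_def)
  qed
  have LP: "L p = 0" if "p \<in> P" for p
  proof -
    have "(\<Sum>i\<in>P. B i a * B i p) = (\<Sum>i\<in>P. \<Sum>q\<in>P. (e i q * B i p) * G a q)"
      by (simp add: B_def[of _ a] sum_distrib_left sum_distrib_right mult_ac)
    also have "\<dots> = (\<Sum>q\<in>P. (\<Sum>i\<in>P. e i q * B i p) * G a q)"
      by (subst sum.swap) (simp add: sum_distrib_right)
    also have "\<dots> = (\<Sum>q\<in>P. if q = p then G a q else 0)"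
      using that by (intro sum.cong) (auto simp: eB)
    finally show ?thesis using that assms(2)[of p a] by (simp add: L)
  qed
  \<comment> \<open>The squared length of \<open>w\<close>. It reduces to \<open>L a\<close> because
    \<open>w\<close> is orthogonal to \<open>P\<close> and has coefficient 1 at \<open>a\<close>;
    that coefficient also makes \<open>w\<close> nonzero, so the length is positive and
    \<open>w\<close> can be normalized.\<close>
  have "(\<Sum>p\<in>insert a P. \<Sum>q\<in>insert a P. w p * w q * G p q) = (\<Sum>p\<in>insert a P. w p * L p)"
    unfolding L_def sum_distrib_left by (intro sum.cong refl) simp
  also have "\<dots> = L a" using LP by (simp add: w_def)
  finally have La: "L a > 0" using insert.prems[of w] by (force simp: w_def not_le[symmetric])
  define e' where "e' i p = (if i = a then w p / sqrt (L a) else if p = a then 0 else e i p)" for i p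
  have e'P: "(\<Sum>q\<in>insert a P. e' i q * G p q) = B i p" if "i \<in> P" for i p
    using that insert.hyps(2) by (auto simp: e'_def B_def intro!: sum.cong)
  have e'a: "(\<Sum>q\<in>insert a P. e' a q * G p q) = L p / sqrt (L a)" for p
    unfolding L_def[of p] sum_divide_distrib by (intro sum.cong refl) (simp add: e'_def)
  have "(\<Sum>i\<in>insert a P. e' i p * (\<Sum>q\<in>insert a P. e' i q * G p' q)) = of_bool (p = p')"
    if p: "p \<in> insert a P" and p': "p' \<in> insert a P" for p p'
  proof -
    have "(\<Sum>i\<in>insert a P. e' i p * (\<Sum>q\<in>insert a P. e' i q * G p' q))
      = e' a p * (\<Sum>q\<in>insert a P. e' a q * G p' q)
        + (\<Sum>i\<in>P. e' i p * (\<Sum>q\<in>insert a P. e' i q * G p' q))"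
      by (rule sum.insert[OF insert.hyps])
    also have "(\<Sum>i\<in>P. e' i p * (\<Sum>q\<in>insert a P. e' i q * G p' q)) = (\<Sum>i\<in>P. e' i p * B i p')"
      by (intro sum.cong refl) (simp only: e'P)
    finally have 1: "(\<Sum>i\<in>insert a P. e' i p * (\<Sum>q\<in>insert a P. e' i q * G p' q))
      = e' a p * (L p' / sqrt (L a)) + (\<Sum>i\<in>P. e' i p * B i p')" by (simp only: e'a)
    have 2: "e' a p * (L p' / sqrt (L a)) = w p * L p' / L a" using La by (simp add: e'_def)
    have 3: "(\<Sum>i\<in>P. e' i p * B i p') = (if p = a then 0 else \<Sum>i\<in>P. e i p * B i p')"
      using insert.hyps(2) by (auto simp: e'_def intro!: sum.cong sum.neutral)
    show ?thesis
    proof (cases "p' = a")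
      case False
      then have "p' \<in> P" using p' by simp
      then show ?thesis unfolding 1 2 3 using p LP[of p'] eB[of p p'] False by (cases "p = a") auto
    next
      case True
      have "(\<Sum>i\<in>P. e i p * B i a) = - w p" if "p \<noteq> a"
        using that by (simp add: w_def mult.commute)
      then show ?thesis unfolding 1 2 3 unfolding True using La by (cases "p = a") (simp_all add: w_def[of a])
    qed
  qed
  then show ?case by blast
qed

text \<open>If \<open>T\<^sub>p\<close> is linearly independent and \<open>T\<^sub>q T\<^sub>r\<^sup>T T\<^sub>p = c T\<^sub>m\<close>, the form below is
  \<open>(u, v) \<mapsto> tr (x \<mapsto> u v\<^sup>T x)\<close> on the span of the \<open>T\<^sub>p\<close>. In an orthonormal basis \<open>F\<^sub>i\<close> its value at
  \<open>(u, u)\<close> is \<open>\<Sum>\<^sub>i \<parallel>u\<^sup>T F\<^sub>i\<parallel>\<^sup>2\<close>.\<close>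

lemma trace_form_nondegenerate:
  fixes T :: "'p \<Rightarrow> 'x \<Rightarrow> 'y \<Rightarrow> real" and c :: "'p \<Rightarrow> 'p \<Rightarrow> 'p \<Rightarrow> real"
  assumes P: "finite P" and X: "finite X" and Y: "finite Y"
    and ind: "\<And>u. (\<And>x y. x \<in> X \<Longrightarrow> y \<in> Y \<Longrightarrow> (\<Sum>p\<in>P. u p * T p x y) = 0) \<Longrightarrow> \<forall>p\<in>P. u p = 0"
    and m: "\<And>q r p. q \<in> P \<Longrightarrow> r \<in> P \<Longrightarrow> p \<in> P \<Longrightarrow> m q r p \<in> P"
    and c: "\<And>q r p x y. q \<in> P \<Longrightarrow> r \<in> P \<Longrightarrow> p \<in> P \<Longrightarrow> x \<in> X \<Longrightarrow> y \<in> Y \<Longrightarrow>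
      c q r p * T (m q r p) x y = (\<Sum>y'\<in>Y. \<Sum>x'\<in>X. T p x y' * T r x' y' * T q x' y)"
    and u: "\<And>r. r \<in> P \<Longrightarrow> (\<Sum>q\<in>P. u q * (\<Sum>p\<in>P. if m q r p = p then c q r p else 0)) = 0"
  shows "\<forall>q\<in>P. u q = 0"
proof -
  define G where "G p q = (\<Sum>x\<in>X. \<Sum>y\<in>Y. T p x y * T q x y)" for p q
  define V where "V v x y = (\<Sum>p\<in>P. v p * T p x y)" for v x y
  have V_zero: "\<forall>p\<in>P. v p = 0" if "(\<Sum>x\<in>X. \<Sum>y\<in>Y. (V v x y)\<^sup>2) \<le> 0" for v
  proof (rule ind)
    fix x y assume xy: "x \<in> X" "y \<in> Y"
    have "(\<Sum>x\<in>X. \<Sum>y\<in>Y. (V v x y)\<^sup>2) = 0" using that by (intro antisym sum_nonneg) auto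
    then have "(V v x y)\<^sup>2 = 0" using X Y xy by (simp add: sum_nonneg_eq_0_iff sum_nonneg)
    then show "(\<Sum>p\<in>P. v p * T p x y) = 0" by (simp add: V_def)
  qed
  have VV: "(\<Sum>x\<in>X. \<Sum>y\<in>Y. V v x y * V w x y) = (\<Sum>p\<in>P. \<Sum>q\<in>P. v p * w q * G p q)" for v w
  proof -
    have "(\<Sum>x\<in>X. \<Sum>y\<in>Y. V v x y * V w x y)
      = (\<Sum>x\<in>X. \<Sum>y\<in>Y. \<Sum>p\<in>P. \<Sum>q\<in>P. v p * w q * (T p x y * T q x y))"
      by (simp add: V_def sum_product mult_ac)
    also have "\<dots> = (\<Sum>p\<in>P. \<Sum>q\<in>P. \<Sum>x\<in>X. \<Sum>y\<in>Y. v p * w q * (T p x y * T q x y))"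
      by (rule sum_swap4)
    finally show ?thesis by (simp add: G_def sum_distrib_left)
  qed
  have "\<exists>e. \<forall>p\<in>P. \<forall>p'\<in>P. (\<Sum>i\<in>P. e i p * (\<Sum>q\<in>P. e i q * G p' q)) = of_bool (p = p')"
  proof (rule inverse_gram_sum_of_squares[OF P])
    show "G p q = G q p" for p q by (simp add: G_def mult.commute)
    show "\<forall>p\<in>P. v p = 0" if "(\<Sum>p\<in>P. \<Sum>q\<in>P. v p * v q * G p q) \<le> 0" for v
      using V_zero[of v] that by (simp add: VV[symmetric] power2_eq_square)
  qed
  then obtain e where e: "\<And>p p'. p \<in> P \<Longrightarrow> p' \<in> P \<Longrightarrow>
      (\<Sum>i\<in>P. e i p * (\<Sum>q\<in>P. e i q * G p' q)) = of_bool (p = p')" by blast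
  define F where "F i = V (e i)" for i
  define U where "U = V u"
  \<comment> \<open>The matrix of \<open>x \<mapsto> u u\<^sup>T x\<close> in the basis
    \<open>T p\<close>. The hypothesis on \<open>u\<close>, weighted by \<open>u r\<close> and
    summed over \<open>r\<close>, says that its trace is 0.\<close>
  define N where "N p' p = (\<Sum>q\<in>P. \<Sum>r\<in>P. if m q r p = p' then u q * u r * c q r p else 0)" for p' p
  have trN: "(\<Sum>p\<in>P. N p p) = 0"
  proof -
    have "(\<Sum>p\<in>P. N p p) = (\<Sum>q\<in>P. \<Sum>r\<in>P. \<Sum>p\<in>P. if m q r p = p then u q * u r * c q r p else 0)"
      unfolding N_def by (rule sum_swap3[symmetric])
    also have "\<dots> = (\<Sum>r\<in>P. \<Sum>q\<in>P. \<Sum>p\<in>P. if m q r p = p then u q * u r * c q r p else 0)"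
      by (rule sum.swap)
    also have "\<dots> = (\<Sum>r\<in>P. u r * (\<Sum>q\<in>P. u q * (\<Sum>p\<in>P. if m q r p = p then c q r p else 0)))"
      unfolding sum_distrib_left by (intro sum.cong refl) simp
    finally show ?thesis using u by simp
  qed
  define H where "H p x y = (\<Sum>p'\<in>P. N p' p * T p' x y)" for p x y
  have H: "H p x y = (\<Sum>y'\<in>Y. \<Sum>x'\<in>X. T p x y' * (U x' y' * U x' y))"
    if "p \<in> P" "x \<in> X" "y \<in> Y" for p x y
  proof -
    have "H p x y = (\<Sum>p'\<in>P. \<Sum>q\<in>P. \<Sum>r\<in>P. if m q r p = p' then u q * u r * (c q r p * T p' x y) else 0)"
      unfolding H_def N_def sum_distrib_right by (intro sum.cong refl) simp
    also have "\<dots> = (\<Sum>q\<in>P. \<Sum>r\<in>P. \<Sum>p'\<in>P. if m q r p = p' then u q * u r * (c q r p * T p' x y) else 0)"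
      by (rule sum_swap3[symmetric])
    also have "\<dots> = (\<Sum>q\<in>P. \<Sum>r\<in>P. u q * u r * (c q r p * T (m q r p) x y))"
      using P m that by (intro sum.cong refl) simp
    also have "\<dots> = (\<Sum>q\<in>P. \<Sum>r\<in>P. \<Sum>y'\<in>Y. \<Sum>x'\<in>X. u q * u r * (T p x y' * T r x' y' * T q x' y))"
      using that by (intro sum.cong refl) (simp add: c sum_distrib_left)
    also have "\<dots> = (\<Sum>y'\<in>Y. \<Sum>x'\<in>X. \<Sum>q\<in>P. \<Sum>r\<in>P. u q * u r * (T p x y' * T r x' y' * T q x' y))"
      by (rule sum_swap4)
    also have "\<dots> = (\<Sum>y'\<in>Y. \<Sum>x'\<in>X. T p x y' * (U x' y' * U x' y))"
    proof (rule sum.cong[OF refl], rule sum.cong[OF refl])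
      fix y' x'
      have "T p x y' * (U x' y * U x' y') = (\<Sum>q\<in>P. \<Sum>r\<in>P. u q * u r * (T p x y' * T r x' y' * T q x' y))"
        unfolding U_def V_def sum_product unfolding sum_distrib_left by (intro sum.cong refl) simp
      then show "(\<Sum>q\<in>P. \<Sum>r\<in>P. u q * u r * (T p x y' * T r x' y' * T q x' y))
        = T p x y' * (U x' y' * U x' y)" by (simp add: mult.commute)
    qed
    finally show ?thesis .
  qed
  \<comment> \<open>The coordinates of \<open>T p\<close> in the basis \<open>F\<close>, as inner
    products; they form the matrix inverse to \<open>e\<close>.\<close>
  define a where "a p i = (\<Sum>x\<in>X. \<Sum>y\<in>Y. T p x y * F i x y)" for p i
  have a: "(\<Sum>i\<in>P. e i p * a p' i) = of_bool (p = p')" if "p \<in> P" "p' \<in> P" for p p'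
  proof -
    have "a p' i = (\<Sum>q\<in>P. e i q * G p' q)" for i
    proof -
      have "a p' i = (\<Sum>x\<in>X. \<Sum>y\<in>Y. \<Sum>q\<in>P. e i q * (T p' x y * T q x y))"
        unfolding a_def F_def V_def sum_distrib_left by (intro sum.cong refl) simp
      also have "\<dots> = (\<Sum>q\<in>P. \<Sum>x\<in>X. \<Sum>y\<in>Y. e i q * (T p' x y * T q x y))" by (rule sum_swap3)
      finally show ?thesis by (simp add: G_def sum_distrib_left)
    qed
    then show ?thesis using e[OF that] by simp
  qed
  \<comment> \<open>Inserting the relation between \<open>e\<close> and \<open>a\<close> rewrites
    the diagonal entries through inner products with \<open>F i\<close>, where the trace becomes a
    sum of squares.\<close>
  have trN_p: "N p p = (\<Sum>i\<in>P. e i p * (\<Sum>x\<in>X. \<Sum>y\<in>Y. H p x y * F i x y))" if p: "p \<in> P" for p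
  proof -
    have "N p p = (\<Sum>p'\<in>P. if p' = p then N p' p else 0)" using P p by simp
    also have "\<dots> = (\<Sum>p'\<in>P. N p' p * (\<Sum>i\<in>P. e i p * a p' i))"
      using p by (intro sum.cong refl) (auto simp: a)
    also have "\<dots> = (\<Sum>p'\<in>P. \<Sum>i\<in>P. e i p * (N p' p * a p' i))"
      unfolding sum_distrib_left by (intro sum.cong refl) simp
    also have "\<dots> = (\<Sum>i\<in>P. e i p * (\<Sum>p'\<in>P. N p' p * a p' i))"
      by (subst sum.swap) (simp add: sum_distrib_left)
    finally have 1: "N p p = (\<Sum>i\<in>P. e i p * (\<Sum>p'\<in>P. N p' p * a p' i))" .
    have "(\<Sum>p'\<in>P. N p' p * a p' i) = (\<Sum>x\<in>X. \<Sum>y\<in>Y. H p x y * F i x y)" for i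
    proof -
      have "(\<Sum>p'\<in>P. N p' p * a p' i) = (\<Sum>p'\<in>P. \<Sum>x\<in>X. \<Sum>y\<in>Y. N p' p * T p' x y * F i x y)"
        by (simp add: a_def sum_distrib_left mult.assoc)
      also have "\<dots> = (\<Sum>x\<in>X. \<Sum>y\<in>Y. \<Sum>p'\<in>P. N p' p * T p' x y * F i x y)"
        by (rule sum_swap3[symmetric])
      finally show ?thesis by (simp add: H_def sum_distrib_right)
    qed
    then show ?thesis using 1 by simp
  qed
  have "0 = (\<Sum>p\<in>P. \<Sum>i\<in>P. e i p * (\<Sum>x\<in>X. \<Sum>y\<in>Y. H p x y * F i x y))" using trN trN_p by simp
  also have "\<dots> = (\<Sum>i\<in>P. \<Sum>p\<in>P. \<Sum>x\<in>X. \<Sum>y\<in>Y. e i p * H p x y * F i x y)"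
    by (subst sum.swap) (simp add: sum_distrib_left mult.assoc)
  also have "\<dots> = (\<Sum>i\<in>P. \<Sum>x\<in>X. \<Sum>x'\<in>X. (\<Sum>y\<in>Y. F i x y * U x' y)\<^sup>2)"
  proof (intro sum.cong refl)
    fix i assume "i \<in> P"
    have "(\<Sum>p\<in>P. \<Sum>x\<in>X. \<Sum>y\<in>Y. e i p * H p x y * F i x y)
        = (\<Sum>x\<in>X. \<Sum>y\<in>Y. \<Sum>p\<in>P. e i p * H p x y * F i x y)" by (rule sum_swap3[symmetric])
    also have "\<dots> = (\<Sum>x\<in>X. \<Sum>x'\<in>X. (\<Sum>y\<in>Y. F i x y * U x' y)\<^sup>2)"
    proof (intro sum.cong refl)
      fix x assume x: "x \<in> X"
      have "(\<Sum>p\<in>P. e i p * H p x y * F i x y) = (\<Sum>y'\<in>Y. \<Sum>x'\<in>X. F i x y * U x' y * (F i x y' * U x' y'))"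
        if y: "y \<in> Y" for y
      proof -
        have "(\<Sum>p\<in>P. e i p * H p x y * F i x y)
          = (\<Sum>p\<in>P. \<Sum>y'\<in>Y. \<Sum>x'\<in>X. F i x y * U x' y * (e i p * T p x y' * U x' y'))"
          using x y by (intro sum.cong refl) (simp add: H sum_distrib_left sum_distrib_right mult_ac)
        also have "\<dots> = (\<Sum>y'\<in>Y. \<Sum>x'\<in>X. \<Sum>p\<in>P. F i x y * U x' y * (e i p * T p x y' * U x' y'))"
          by (rule sum_swap3[symmetric])
        finally show ?thesis by (simp add: F_def V_def sum_distrib_left sum_distrib_right)
      qed
      then have "(\<Sum>y\<in>Y. \<Sum>p\<in>P. e i p * H p x y * F i x y)
        = (\<Sum>y\<in>Y. \<Sum>y'\<in>Y. \<Sum>x'\<in>X. F i x y * U x' y * (F i x y' * U x' y'))" by simp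
      also have "\<dots> = (\<Sum>x'\<in>X. \<Sum>y\<in>Y. \<Sum>y'\<in>Y. F i x y * U x' y * (F i x y' * U x' y'))"
        by (rule sum_swap3)
      finally show "(\<Sum>y\<in>Y. \<Sum>p\<in>P. e i p * H p x y * F i x y) = (\<Sum>x'\<in>X. (\<Sum>y\<in>Y. F i x y * U x' y)\<^sup>2)"
        by (simp add: power2_eq_square sum_product)
    qed
    finally show "(\<Sum>p\<in>P. \<Sum>x\<in>X. \<Sum>y\<in>Y. e i p * H p x y * F i x y)
        = (\<Sum>x\<in>X. \<Sum>x'\<in>X. (\<Sum>y\<in>Y. F i x y * U x' y)\<^sup>2)" .
  qed
  finally have "(\<Sum>i\<in>P. \<Sum>x\<in>X. \<Sum>x'\<in>X. (\<Sum>y\<in>Y. F i x y * U x' y)\<^sup>2) = 0" by simp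
  then have FU: "(\<Sum>y\<in>Y. F i x y * U x' y) = 0" if "i \<in> P" "x \<in> X" "x' \<in> X" for i x x'
    using that P X by (simp add: sum_nonneg_eq_0_iff sum_nonneg)
  \<comment> \<open>The expansion of \<open>T p\<close> in the orthonormal basis, which carries the
    vanishing of \<open>u\<^sup>T F i\<close> over to \<open>u\<^sup>T T p\<close>.\<close>
  have TF: "T p x y = (\<Sum>i\<in>P. a p i * F i x y)" if p: "p \<in> P" for p x y
  proof -
    have "(\<Sum>i\<in>P. a p i * F i x y) = (\<Sum>i\<in>P. \<Sum>p'\<in>P. e i p' * a p i * T p' x y)"
      unfolding F_def V_def sum_distrib_left by (intro sum.cong refl) simp
    also have "\<dots> = (\<Sum>p'\<in>P. (\<Sum>i\<in>P. e i p' * a p i) * T p' x y)"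
      by (subst sum.swap) (simp add: sum_distrib_right)
    also have "\<dots> = (\<Sum>p'\<in>P. if p' = p then T p' x y else 0)"
      using p by (intro sum.cong refl) (auto simp: a)
    finally show ?thesis using P p by simp
  qed
  have TU: "(\<Sum>y\<in>Y. T p x y * U x' y) = 0" if "p \<in> P" "x \<in> X" "x' \<in> X" for p x x'
  proof -
    have "(\<Sum>y\<in>Y. T p x y * U x' y) = (\<Sum>y\<in>Y. \<Sum>i\<in>P. a p i * (F i x y * U x' y))"
      using that(1) by (simp add: TF sum_distrib_right mult.assoc)
    also have "\<dots> = (\<Sum>i\<in>P. a p i * (\<Sum>y\<in>Y. F i x y * U x' y))"
      by (subst sum.swap) (simp add: sum_distrib_left)
    finally show ?thesis using FU that by simp
  qed
  \<comment> \<open>As \<open>U\<close> is itself a combination of the \<open>T p\<close>, its rows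
    are orthogonal to themselves.\<close>
  have "(\<Sum>y\<in>Y. (U x y)\<^sup>2) = 0" if "x \<in> X" for x
  proof -
    have "(\<Sum>y\<in>Y. (U x y)\<^sup>2) = (\<Sum>y\<in>Y. \<Sum>p\<in>P. u p * (T p x y * U x y))"
      unfolding power2_eq_square by (subst (1) U_def) (simp add: V_def sum_distrib_right mult.assoc)
    also have "\<dots> = (\<Sum>p\<in>P. u p * (\<Sum>y\<in>Y. T p x y * U x y))"
      by (subst sum.swap) (simp add: sum_distrib_left)
    finally show ?thesis using TU that by simp
  qed
  then show ?thesis using V_zero[of u] by (simp add: U_def)
qed

section \<open>Interpolating partition categories\<close>

text \<open>Composition in \<open>Rep0\<close> does not consult its object arguments. Dropping them
  gives a product that is bilinear on the whole ambient space.\<close>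

definition partition_product :: "complex \<Rightarrow> (parti \<Rightarrow>\<^sub>0 complex) \<Rightarrow> (parti \<Rightarrow>\<^sub>0 complex) \<Rightarrow> parti \<Rightarrow>\<^sub>0 complex" where
  "partition_product t g f = (\<Sum>q\<in>Poly_Mapping.keys g. \<Sum>p\<in>Poly_Mapping.keys f.
    Poly_Mapping.single (pcomp q p)
      (Poly_Mapping.lookup g q * Poly_Mapping.lookup f p * t ^ loops q p))"

section \<open>The linear category \<open>Rep0\<close>\<close>

lemma lookup_map_times [simp]:
  "Poly_Mapping.lookup (Poly_Mapping.map ((*) a) f) p = a * Poly_Mapping.lookup f (p :: 'a)"
  for a :: complex
  by (simp add: Poly_Mapping.map.rep_eq when_def)

lemma sum_single_lookup:
  assumes "finite A" "Poly_Mapping.keys f \<subseteq> A"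
  shows "(\<Sum>p\<in>A. Poly_Mapping.single p (Poly_Mapping.lookup f p)) = f"
proof (rule poly_mapping_eqI)
  fix k
  have "Poly_Mapping.lookup (\<Sum>p\<in>A. Poly_Mapping.single p (Poly_Mapping.lookup f p)) k
      = (\<Sum>p\<in>A. if p = k then Poly_Mapping.lookup f k else 0)"
    unfolding lookup_sum by (intro sum.cong refl) (simp add: lookup_single when_def)
  also have "\<dots> = Poly_Mapping.lookup f k"
    using assms by (auto simp: in_keys_iff)
  finally show "Poly_Mapping.lookup (\<Sum>p\<in>A. Poly_Mapping.single p (Poly_Mapping.lookup f p)) k
    = Poly_Mapping.lookup f k" .
qed

text \<open>The supports summed over in the definition vary with the arguments. Over fixed larger
  index sets bilinearity can be checked term by term.\<close>

lemma partition_product_superset: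
  assumes "finite A" "Poly_Mapping.keys g \<subseteq> A" "finite B" "Poly_Mapping.keys f \<subseteq> B"
  shows "partition_product t g f = (\<Sum>q\<in>A. \<Sum>p\<in>B. Poly_Mapping.single (pcomp q p)
    (Poly_Mapping.lookup g q * Poly_Mapping.lookup f p * t ^ loops q p))"
proof -
  have "partition_product t g f = (\<Sum>q\<in>Poly_Mapping.keys g. \<Sum>p\<in>B. Poly_Mapping.single (pcomp q p)
    (Poly_Mapping.lookup g q * Poly_Mapping.lookup f p * t ^ loops q p))"
    unfolding partition_product_def using assms
    by (intro sum.cong refl sum.mono_neutral_left) (auto simp: in_keys_iff)
  also have "\<dots> = (\<Sum>q\<in>A. \<Sum>p\<in>B. Poly_Mapping.single (pcomp q p)
    (Poly_Mapping.lookup g q * Poly_Mapping.lookup f p * t ^ loops q p))"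
    using assms by (intro sum.mono_neutral_left) (auto simp: in_keys_iff)
  finally show ?thesis .
qed

lemma partition_product_add_left:
  "partition_product t (g + g') f = partition_product t g f + partition_product t g' f"
proof -
  let ?A = "Poly_Mapping.keys g \<union> Poly_Mapping.keys g'" and ?B = "Poly_Mapping.keys f"
  have "Poly_Mapping.keys (g + g') \<subseteq> ?A" by (rule Poly_Mapping.keys_add)
  then show ?thesis
    by (subst (1 2 3) partition_product_superset[where A = ?A and B = ?B])
      (auto simp: lookup_add ring_distribs single_add sum.distrib)
qed

lemma partition_product_add_right:
  "partition_product t g (f + f') = partition_product t g f + partition_product t g f'"
proof -
  let ?A = "Poly_Mapping.keys g" and ?B = "Poly_Mapping.keys f \<union> Poly_Mapping.keys f'"
  have "Poly_Mapping.keys (f + f') \<subseteq> ?B" by (rule Poly_Mapping.keys_add)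
  then show ?thesis
    by (subst (1 2 3) partition_product_superset[where A = ?A and B = ?B])
      (auto simp: lookup_add ring_distribs single_add sum.distrib)
qed

lemma map_times_single: "Poly_Mapping.map ((*) a) (Poly_Mapping.single p b) = Poly_Mapping.single p (a * b :: complex)"
  by (rule poly_mapping_eqI) (simp add: lookup_single when_def)

lemma map_times_sum:
  "Poly_Mapping.map ((*) (a :: complex)) (\<Sum>i\<in>I. f i) = (\<Sum>i\<in>I. Poly_Mapping.map ((*) a) (f i))"
  by (rule poly_mapping_eqI) (simp add: lookup_sum sum_distrib_left)

lemma keys_map_times: "Poly_Mapping.keys (Poly_Mapping.map ((*) (a :: complex)) f) \<subseteq> Poly_Mapping.keys f"
  by (auto simp: in_keys_iff)

lemma partition_product_scale:
  "partition_product t (Poly_Mapping.map ((*) a) g) f = Poly_Mapping.map ((*) a) (partition_product t g f)"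
  "partition_product t g (Poly_Mapping.map ((*) a) f) = Poly_Mapping.map ((*) a) (partition_product t g f)"
proof -
  show "partition_product t (Poly_Mapping.map ((*) a) g) f = Poly_Mapping.map ((*) a) (partition_product t g f)"
    by (subst (1 2) partition_product_superset[where A = "Poly_Mapping.keys g" and B = "Poly_Mapping.keys f"])
      (auto simp: keys_map_times map_times_sum map_times_single mult_ac)
  show "partition_product t g (Poly_Mapping.map ((*) a) f) = Poly_Mapping.map ((*) a) (partition_product t g f)"
    by (subst (1 2) partition_product_superset[where A = "Poly_Mapping.keys g" and B = "Poly_Mapping.keys f"])
      (auto simp: keys_map_times map_times_sum map_times_single mult_ac)
qed

lemma partition_product_0 [simp]: "partition_product t 0 f = 0" "partition_product t g 0 = 0"
  by (simp_all add: partition_product_def)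

lemma partition_product_sum_left: "partition_product t (\<Sum>i\<in>I. g i) f = (\<Sum>i\<in>I. partition_product t (g i) f)"
  by (induction I rule: infinite_finite_induct) (simp_all add: partition_product_add_left)

lemma partition_product_sum_right: "partition_product t g (\<Sum>i\<in>I. f i) = (\<Sum>i\<in>I. partition_product t g (f i))"
  by (induction I rule: infinite_finite_induct) (simp_all add: partition_product_add_right)

lemma partition_product_single:
  "partition_product t (Poly_Mapping.single q b) (Poly_Mapping.single p a)
    = Poly_Mapping.single (pcomp q p) (b * a * t ^ loops q p)"
  by (subst partition_product_superset[of "{q}" _ "{p}"]) auto

lemma Rep0_simps [simp]:
  "Obj (Rep0 C t) = UNIV"
  "f \<in> Hom (Rep0 C t) k l \<longleftrightarrow> Poly_Mapping.keys f \<subseteq> C k l"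
  "Comp (Rep0 C t) k l m g f = partition_product t g f"
  "Ident (Rep0 C t) k = Poly_Mapping.single (id_parti k) 1"
  "Scale (Rep0 C t) a = Poly_Mapping.map ((*) a)"
  by (simp_all add: Rep0_def partition_product_def)

locale partition_category =
  fixes C :: "nat \<Rightarrow> nat \<Rightarrow> parti set" and t :: complex
  assumes category: "category_of_partitions C"
begin

lemma C_partitions: "p \<in> C k l \<Longrightarrow> p \<in> partitions k l"
  using category unfolding category_of_partitions_def by blast

lemma C_pcomp: "p \<in> C k l \<Longrightarrow> q \<in> C l m \<Longrightarrow> pcomp q p \<in> C k m"
  using category unfolding category_of_partitions_def by blast

lemma C_invol: "p \<in> C k l \<Longrightarrow> invol p \<in> C l k"
  using category unfolding category_of_partitions_def by blast

lemma finite_C: "finite (C k l)"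
  by (rule finite_subset[OF _ finite_partitions]) (auto dest: C_partitions)

lemma keys_partition_product:
  assumes "Poly_Mapping.keys f \<subseteq> C k l" "Poly_Mapping.keys g \<subseteq> C l m"
  shows "Poly_Mapping.keys (partition_product t g f) \<subseteq> C k m"
proof -
  have "Poly_Mapping.lookup (partition_product t g f) r = 0" if r: "r \<notin> C k m" for r
    unfolding partition_product_def lookup_sum
  proof (intro sum.neutral ballI)
    fix q p assume "q \<in> Poly_Mapping.keys g" "p \<in> Poly_Mapping.keys f"
    then have "pcomp q p \<in> C k m" using assms C_pcomp by (meson subsetD)
    then have "pcomp q p \<noteq> r" using r by metis
    then show "Poly_Mapping.lookup (Poly_Mapping.single (pcomp q p)
      (Poly_Mapping.lookup g q * Poly_Mapping.lookup f p * t ^ loops q p)) r = 0"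
      by (simp add: lookup_single_not_eq)
  qed
  then show ?thesis by (auto simp: in_keys_iff)
qed

text \<open>Trilinearity reduces this to single partitions, where the two powers of \<open>t\<close>
  agree by the loop identity.\<close>

lemma partition_product_assoc:
  assumes f: "Poly_Mapping.keys f \<subseteq> C k l" and g: "Poly_Mapping.keys g \<subseteq> C l m" and h: "Poly_Mapping.keys h \<subseteq> C m j"
  shows "partition_product t (partition_product t h g) f = partition_product t h (partition_product t g f)"
proof -
  let ?s = Poly_Mapping.single and ?l = Poly_Mapping.lookup
  have 1: "partition_product t (partition_product t (?s r c) (?s q b)) (?s p a)
      = partition_product t (?s r c) (partition_product t (?s q b) (?s p a))"
    if "p \<in> C k l" "q \<in> C l m" "r \<in> C m j" for p q r a b c
  proof -
    note assoc = pcomp_assoc[OF C_partitions[OF that(1)] C_partitions[OF that(2)] C_partitions[OF that(3)]]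
    have "pcomp r (pcomp q p) = pcomp (pcomp r q) p"
      "loops q p + loops r (pcomp q p) = loops r q + loops (pcomp r q) p"
      using assoc that by (blast intro: C_partitions C_pcomp)+
    then show ?thesis by (simp add: partition_product_single mult_ac flip: power_add)
  qed
  have F: "f = (\<Sum>p\<in>C k l. ?s p (?l f p))" and G: "g = (\<Sum>q\<in>C l m. ?s q (?l g q))"
    and H: "h = (\<Sum>r\<in>C m j. ?s r (?l h r))"
    using sum_single_lookup[OF finite_C] f g h by metis+
  show ?thesis
    by (subst (1 2) F, subst (1 2) G, subst (1 2) H)
      (simp add: partition_product_sum_left partition_product_sum_right 1)
qed

lemma linear_Rep0: "linear_category (Rep0 C t)"
  unfolding linear_category_def
proof (intro conjI ballI allI)
  show V: "vector_space (Scale (Rep0 C t))"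
    by unfold_locales (auto intro!: poly_mapping_eqI simp: lookup_add algebra_simps)
  interpret vector_space "Scale (Rep0 C t)" by (rule V)
  fix k l :: nat
  show "subspace (Hom (Rep0 C t) k l)"
    unfolding subspace_def
  proof (intro conjI ballI allI)
    fix f g a assume "f \<in> Hom (Rep0 C t) k l"
    then have f: "Poly_Mapping.keys f \<subseteq> C k l" by simp
    show "Scale (Rep0 C t) a f \<in> Hom (Rep0 C t) k l"
      using subset_trans[OF keys_map_times f] by simp
    assume "g \<in> Hom (Rep0 C t) k l"
    then show "f + g \<in> Hom (Rep0 C t) k l"
      using f subset_trans[OF Poly_Mapping.keys_add[of f g]] by simp
  qed simp
  show "Ident (Rep0 C t) k \<in> Hom (Rep0 C t) k k"
    using id_parti_in_category[OF category] by simp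
  {
    fix f assume "f \<in> Hom (Rep0 C t) k l"
    then have f: "Poly_Mapping.keys f \<subseteq> C k l" by simp
    note F = sum_single_lookup[OF finite_C f]
    have 1: "partition_product t (Poly_Mapping.single (id_parti l) 1) (Poly_Mapping.single p a) = Poly_Mapping.single p a"
      and 2: "partition_product t (Poly_Mapping.single p a) (Poly_Mapping.single (id_parti k) 1) = Poly_Mapping.single p a"
      if "p \<in> C k l" for p a
      using pcomp_id[OF C_partitions[OF that]] C_partitions[OF C_pcomp[OF that id_parti_in_category[OF category]]]
        C_partitions[OF C_pcomp[OF id_parti_in_category[OF category] that]]
      by (simp_all add: partition_product_single)
    show "Comp (Rep0 C t) k l l (Ident (Rep0 C t) l) f = f" "Comp (Rep0 C t) k k l f (Ident (Rep0 C t) k) = f"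
      unfolding Rep0_simps
      by (subst (1 2) F[symmetric], simp add: partition_product_sum_right partition_product_sum_left 1 2)+
  }
  fix m :: nat
  {
    fix f g assume "f \<in> Hom (Rep0 C t) k l" "g \<in> Hom (Rep0 C t) l m"
    then show "Comp (Rep0 C t) k l m g f \<in> Hom (Rep0 C t) k m"
      using keys_partition_product by simp
  }
  {
    fix f f' g g' a
    show "Comp (Rep0 C t) k l m g (f + f') = Comp (Rep0 C t) k l m g f + Comp (Rep0 C t) k l m g f'"
      "Comp (Rep0 C t) k l m (g + g') f = Comp (Rep0 C t) k l m g f + Comp (Rep0 C t) k l m g' f"
      "Comp (Rep0 C t) k l m g (Scale (Rep0 C t) a f) = Scale (Rep0 C t) a (Comp (Rep0 C t) k l m g f)"
      "Comp (Rep0 C t) k l m (Scale (Rep0 C t) a g) f = Scale (Rep0 C t) a (Comp (Rep0 C t) k l m g f)"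
      by (simp_all add: partition_product_add_left partition_product_add_right partition_product_scale)
  }
  fix j f g h assume "f \<in> Hom (Rep0 C t) k l" "g \<in> Hom (Rep0 C t) l m" "h \<in> Hom (Rep0 C t) m j"
  then show "Comp (Rep0 C t) k l j (Comp (Rep0 C t) l m j h g) f
      = Comp (Rep0 C t) k m j h (Comp (Rep0 C t) k l m g f)"
    using partition_product_assoc by simp
qed

lemma finite_dim_Rep0: "finite_dim_homs (Rep0 C t)"
  unfolding finite_dim_homs_def
proof (intro ballI)
  fix k l :: nat
  interpret lin_cat "Rep0 C t" by (rule lin_cat.intro[OF linear_Rep0])
  let ?B = "(\<lambda>p. Poly_Mapping.single p 1) ` C k l"
  have "f \<in> vs.span ?B" if f: "Poly_Mapping.keys f \<subseteq> C k l" for f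
  proof -
    have "(\<Sum>p\<in>C k l. Scale (Rep0 C t) (Poly_Mapping.lookup f p) (Poly_Mapping.single p 1)) \<in> vs.span ?B"
      by (intro vs.span_sum vs.span_scale vs.span_base) simp
    then show ?thesis using sum_single_lookup[OF finite_C f] by (simp add: map_times_single)
  qed
  then show "\<exists>B. finite B \<and> Hom (Rep0 C t) k l \<subseteq> vs.span B"
    using finite_C by (intro exI[of _ ?B]) auto
qed

section \<open>Trace polynomials and semiprimeness of \<open>Rep0\<close>\<close>

definition sandwich :: "parti \<Rightarrow> parti \<Rightarrow> parti \<Rightarrow> parti" where
  "sandwich q r p = pcomp q (pcomp (invol r) p)"

text \<open>In \<open>Rep0\<close>, the product of \<open>q\<close>, \<open>invol r\<close> and
  \<open>p\<close> is \<open>sandwich q r p\<close> times this power of \<open>t\<close>.\<close>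

definition sandwich_loops :: "parti \<Rightarrow> parti \<Rightarrow> parti \<Rightarrow> nat" where
  "sandwich_loops q r p = loops (invol r) p + loops q (pcomp (invol r) p)"

text \<open>The trace of \<open>x \<mapsto> q r\<^sup>* x\<close> on \<open>Hom([k],[l])\<close>, as a polynomial in \<open>t\<close>.\<close>

definition trace_poly :: "nat \<Rightarrow> nat \<Rightarrow> parti \<Rightarrow> parti \<Rightarrow> int poly" where
  "trace_poly k l q r = (\<Sum>p\<in>C k l. if sandwich q r p = p then monom 1 (sandwich_loops q r p) else 0)"

lemma sandwich_in: "q \<in> C k l \<Longrightarrow> r \<in> C k l \<Longrightarrow> p \<in> C k l \<Longrightarrow> sandwich q r p \<in> C k l"
  unfolding sandwich_def by (blast intro: C_pcomp C_invol)

lemma trace_poly_nonsingular: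
  obtains n :: nat where "\<forall>u::parti \<Rightarrow> real. (\<forall>r\<in>C k l. (\<Sum>q\<in>C k l. u q * of_int (poly (trace_poly k l q r) (int n))) = 0)
    \<longrightarrow> (\<forall>q\<in>C k l. u q = 0)"
proof -
  \<comment> \<open>A common bound for the numbers of blocks of all partitions in
    \<open>C k l\<close>, as their independence requires.\<close>
  define n where "n = (\<Sum>p\<in>C k l. card p)"
  have "\<forall>q\<in>C k l. u q = 0"
    if u: "\<forall>r\<in>C k l. (\<Sum>q\<in>C k l. u q * of_int (poly (trace_poly k l q r) (int n))) = 0" for u :: "parti \<Rightarrow> real"
  proof (rule trace_form_nondegenerate[where X = "colourings n k" and Y = "colourings n l" and T = tensor_entry
        and m = sandwich and c = "\<lambda>q r p. real n ^ sandwich_loops q r p"])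
    show "\<forall>p\<in>C k l. v p = 0"
      if "\<And>x y. x \<in> colourings n k \<Longrightarrow> y \<in> colourings n l \<Longrightarrow> (\<Sum>p\<in>C k l. v p * tensor_entry p x y) = 0" for v
    proof
      fix p assume "p \<in> C k l"
      show "v p = 0"
      proof (rule tensor_entry_independent[OF _ _ that])
        show "\<forall>p\<in>C k l. card p \<le> n"
          unfolding n_def using finite_C by (auto intro: member_le_sum)
      qed (use \<open>p \<in> C k l\<close> C_partitions in auto)
    qed
    show "real n ^ sandwich_loops q r p * tensor_entry (sandwich q r p) x y
        = (\<Sum>y'\<in>colourings n l. \<Sum>x'\<in>colourings n k. tensor_entry p x y' * tensor_entry r x' y' * tensor_entry q x' y)"
      if qrp: "q \<in> C k l" "r \<in> C k l" "p \<in> C k l" and xy: "x \<in> colourings n k" "y \<in> colourings n l" for q r p x y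
    proof -
      have r': "invol r \<in> C l k" using C_invol qrp by blast
      have "real n ^ sandwich_loops q r p * tensor_entry (sandwich q r p) x y
        = real n ^ loops (invol r) p * (\<Sum>x'\<in>colourings n k. tensor_entry (pcomp (invol r) p) x x' * tensor_entry q x' y)"
        using tensor_entry_pcomp[OF C_partitions[OF C_pcomp[OF qrp(3) r']] C_partitions[OF qrp(1)] xy]
        by (simp add: sandwich_def sandwich_loops_def power_add)
      also have "\<dots> = (\<Sum>x'\<in>colourings n k. (\<Sum>y'\<in>colourings n l. tensor_entry p x y' * tensor_entry (invol r) y' x') * tensor_entry q x' y)"
        unfolding sum_distrib_left
        using tensor_entry_pcomp[OF C_partitions[OF qrp(3)] C_partitions[OF r'] xy(1)]
        by (intro sum.cong refl) simp
      also have "\<dots> = (\<Sum>x'\<in>colourings n k. \<Sum>y'\<in>colourings n l. tensor_entry p x y' * tensor_entry r x' y' * tensor_entry q x' y)"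
        by (simp add: tensor_entry_invol sum_distrib_right)
      also have "\<dots> = (\<Sum>y'\<in>colourings n l. \<Sum>x'\<in>colourings n k. tensor_entry p x y' * tensor_entry r x' y' * tensor_entry q x' y)"
        by (rule sum.swap)
      finally show ?thesis .
    qed
    have "real_of_int (poly (trace_poly k l q r) (int n))
        = (\<Sum>p\<in>C k l. if sandwich q r p = p then real n ^ sandwich_loops q r p else 0)" for q r
      unfolding trace_poly_def poly_sum of_int_sum by (intro sum.cong refl) (simp add: poly_monom)
    then show "(\<Sum>q\<in>C k l. u q * (\<Sum>p\<in>C k l. if sandwich q r p = p then real n ^ sandwich_loops q r p else 0)) = 0"
      if "r \<in> C k l" for r
      using u that by simp
  qed (use finite_C sandwich_in in auto)
  then show ?thesis using that by blast
qed

text \<open>If \<open>u h u = 0\<close> for all \<open>h\<close>, then \<open>x \<mapsto> u r\<^sup>* x\<close> squares to zero, so its trace vanishes.\<close>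

lemma trace_poly_vanishes:
  assumes u: "Poly_Mapping.keys u \<subseteq> C k l"
    and nil: "\<And>h. Poly_Mapping.keys h \<subseteq> C l k \<Longrightarrow> partition_product t u (partition_product t h u) = 0"
    and r: "r \<in> C k l"
  shows "(\<Sum>q\<in>C k l. Poly_Mapping.lookup u q * poly (of_int_poly (trace_poly k l q r)) t) = 0"
proof -
  let ?P = "C k l" and ?l = Poly_Mapping.lookup
  define h where "h = Poly_Mapping.single (invol r) (1::complex)"
  have h: "Poly_Mapping.keys h \<subseteq> C l k" using C_invol[OF r] by (simp add: h_def)
  define L where "L x = partition_product t u (partition_product t h x)" for x
  have L_keys: "Poly_Mapping.keys (L x) \<subseteq> ?P" if "Poly_Mapping.keys x \<subseteq> ?P" for x
    unfolding L_def using keys_partition_product[OF keys_partition_product[OF that h] u] .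
  have LL: "L (L x) = 0" if x: "Poly_Mapping.keys x \<subseteq> ?P" for x
  proof -
    have hx: "Poly_Mapping.keys (partition_product t h x) \<subseteq> C k k"
      by (rule keys_partition_product[OF x h])
    have hu: "Poly_Mapping.keys (partition_product t h u) \<subseteq> C k k"
      by (rule keys_partition_product[OF u h])
    \<comment> \<open>Reassociated, \<open>L (L x)\<close> is \<open>u h u\<close> applied to
      \<open>h x\<close>, and \<open>u h u = 0\<close> by hypothesis.\<close>
    have "L (L x) = partition_product t u (partition_product t (partition_product t h u) (partition_product t h x))"
      unfolding L_def by (simp add: partition_product_assoc[OF hx u h])
    also have "\<dots> = partition_product t (partition_product t u (partition_product t h u)) (partition_product t h x)"
      by (rule partition_product_assoc[OF hx hu u, symmetric])
    also have "\<dots> = 0" using nil[OF h] by simp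
    finally show ?thesis .
  qed
  \<comment> \<open>The matrix of \<open>L\<close> in the basis of partitions. The image of a basis
    partition under each term of \<open>u\<close> is again one partition up to a power of
    \<open>t\<close>, so only fixed partitions contribute to the trace.\<close>
  define N where "N p' p = ?l (L (Poly_Mapping.single p 1)) p'" for p' p
  have N: "N p' p = (\<Sum>q\<in>?P. if sandwich q r p = p' then ?l u q * t ^ sandwich_loops q r p else 0)" for p' p
  proof -
    have "L (Poly_Mapping.single p 1) = (\<Sum>q\<in>?P. Poly_Mapping.single (sandwich q r p) (?l u q * t ^ sandwich_loops q r p))"
      unfolding L_def h_def
      by (subst sum_single_lookup[OF finite_C u, symmetric])
        (simp add: partition_product_sum_left partition_product_single sandwich_def sandwich_loops_def power_add mult_ac)
    then show ?thesis
      unfolding N_def by (simp add: lookup_sum lookup_single when_def)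
  qed
  have "(\<Sum>p\<in>?P. N p p) = 0"
  proof (rule square_zero_trace[where N = N, OF finite_C])
    fix p'' p assume p: "p'' \<in> ?P" "p \<in> ?P"
    let ?v = "L (Poly_Mapping.single p 1)"
    have v: "Poly_Mapping.keys ?v \<subseteq> ?P" using L_keys p by simp
    have "?v = (\<Sum>p'\<in>?P. Poly_Mapping.map ((*) (N p' p)) (Poly_Mapping.single p' 1))"
      using sum_single_lookup[OF finite_C v] by (simp add: map_times_single N_def)
    then have "L ?v = L (\<Sum>p'\<in>?P. Poly_Mapping.map ((*) (N p' p)) (Poly_Mapping.single p' 1))" by simp
    also have "\<dots> = (\<Sum>p'\<in>?P. Poly_Mapping.map ((*) (N p' p)) (L (Poly_Mapping.single p' 1)))"
      unfolding L_def by (simp only: partition_product_sum_right partition_product_scale)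
    finally have "(\<Sum>p'\<in>?P. N p' p * N p'' p') = ?l (L ?v) p''"
      by (simp add: lookup_sum N_def)
    also have "\<dots> = 0" using LL[of "Poly_Mapping.single p 1"] p by simp
    finally show "(\<Sum>p'\<in>?P. N p'' p' * N p' p) = 0" by (simp add: mult.commute)
  qed
  also have "(\<Sum>p\<in>?P. N p p) = (\<Sum>q\<in>?P. \<Sum>p\<in>?P. if sandwich q r p = p then ?l u q * t ^ sandwich_loops q r p else 0)"
    unfolding N by (rule sum.swap)
  also have "\<dots> = (\<Sum>q\<in>?P. ?l u q * poly (of_int_poly (trace_poly k l q r)) t)"
  proof (rule sum.cong[OF refl])
    fix q
    have "poly (of_int_poly (trace_poly k l q r)) t
        = (\<Sum>p\<in>?P. if sandwich q r p = p then t ^ sandwich_loops q r p else 0)"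
      unfolding trace_poly_def of_int_poly_hom.hom_sum poly_sum
      by (intro sum.cong refl) (simp add: poly_monom of_int_hom.map_poly_hom_monom)
    then show "(\<Sum>p\<in>?P. if sandwich q r p = p then ?l u q * t ^ sandwich_loops q r p else 0)
        = ?l u q * poly (of_int_poly (trace_poly k l q r)) t"
      by (simp only: sum_distrib_left) (intro sum.cong refl, simp)
  qed
  finally show ?thesis by simp
qed

lemma semiprime_Rep0:
  assumes t: "\<not> algebraic t"
  shows "semiprime_category (Rep0 C t)"
  unfolding semiprime_category_def
proof (intro ballI impI, rule ccontr)
  fix k l u assume u: "u \<in> Hom (Rep0 C t) k l" "u \<noteq> 0"
    and nil: "\<not> (\<exists>h\<in>Hom (Rep0 C t) l k. Comp (Rep0 C t) k k l u (Comp (Rep0 C t) k l k h u) \<noteq> 0)"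
  have keys: "Poly_Mapping.keys u \<subseteq> C k l" using u by simp
  have "\<forall>r\<in>C k l. (\<Sum>q\<in>C k l. Poly_Mapping.lookup u q * poly (of_int_poly (trace_poly k l q r)) t) = 0"
    using trace_poly_vanishes[OF keys] nil by simp
  moreover obtain n :: nat where "\<forall>v::parti \<Rightarrow> real.
      (\<forall>r\<in>C k l. (\<Sum>q\<in>C k l. v q * of_int (poly (trace_poly k l q r) (int n))) = 0) \<longrightarrow> (\<forall>q\<in>C k l. v q = 0)"
    by (rule trace_poly_nonsingular)
  ultimately have "Poly_Mapping.lookup u q = 0" if "q \<in> C k l" for q
    using nonsingular_at_transcendental[OF finite_C _ t _ that] by blast
  then have "Poly_Mapping.lookup u q = 0" for q using keys by (cases "q \<in> C k l") (auto simp: in_keys_iff)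
  then have "u = 0" by (intro poly_mapping_eqI) simp
  then show False using u by simp
qed

end

theorem corollary3p9:
  fixes C :: "nat \<Rightarrow> nat \<Rightarrow> parti set" and t :: complex
  assumes "category_of_partitions C"
    and "\<not> algebraic t"
  shows "semisimple_category (Rep C t)"
proof -
  interpret partition_category C t by unfold_locales (rule assms(1))
  show ?thesis unfolding Rep_def
    by (rule semisimple_karoubi_envelope[OF linear_Rep0 finite_dim_Rep0 semiprime_Rep0[OF assms(2)]])
qed

end
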